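(* Let $\gamma\in\mathbb C$ and let $D_0^{\gamma}$ be the adelic fractional operator of order $\gamma$ on $\Phi(\widetilde{\mathbb A})$. Let $m$ be a prime and let $$\widetilde\Psi_\alpha(x')=\prod_{2\le q\le m}q^{j_q/2}\chi_q\Big(\frac{k_q}{q}(q^{-j_q}x_q-a_q)\Big)\Omega\big(|q^{-j_q}x_q-a_q|_q\big)\prod_{q>m}\Omega(|x_q|_q),\qquad x'\in\widetilde{\mathbb A},$$ where $k_q\in\{1,\dots,q-1\}$, $j_q\in\{0,1,2,\dots\}$, $a_q\in I_q$ for each prime $q\le m$. Then $\widetilde\Psi_\alpha$ is an eigenfunction of $D_0^{\gamma}$: $$D_0^{\gamma}\widetilde\Psi_\alpha=\Big(\prod_{2\le q\le m}q^{j_q+1}\Big)^{\gamma}\widetilde\Psi_\alpha,$$ the product being over primes $q$.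
   Context: Throughout $p,q,m$ denote primes. $\mathbb Q_p$, $|\cdot|_p$, $\mathbb Z_p$: $p$-adic numbers, norm, integers; $\chi_p(x)=e^{2\pi i\{x\}_p}$ with $\{x\}_p$ the $p$-adic fractional part; $\Omega$ is the characteristic function of $[0,1]$. $I_q\subset\mathbb Q_q$ is the set of finite sums $a_{-\gamma}q^{-\gamma}+\dots+a_{-1}q^{-1}$, $a_i\in\{0,\dots,q-1\}$ (including $0$). $\widetilde{\mathbb A}$ is the ring of finite adeles (sequences $x'=(x_2,x_3,x_5,\dots)$, $x_p\in\mathbb Q_p$, $x_p\in\mathbb Z_p$ for almost all $p$) with Haar measure giving $\prod_p\mathbb Z_p$ measure 1. $F[\varphi](\xi')=\int_{\widetilde{\mathbb A}}\prod_p\chi_p(\xi_px_p)\varphi(x')\,dx'$. Let $\mathcal D(\mathbb Q_p)$ be the space of locally constant compactly supported complex functions on $\mathbb Q_p$. For a prime $m$, $\Psi^{[m]}(\widetilde{\mathbb A})$ is the space of finite linear combinations of functions $\prod_p\eta_p(\xi_p)$ with $\eta_p\in\mathcal D(\mathbb Q_p)$, $\eta_p(\xi_p)=\Omega(|\xi_p|_p)$ for $p>m$, that vanish when $\xi_r=0$ for any prime $r\le m$. Put $\Phi^{[m]}(\widetilde{\mathbb A})=F[\Psi^{[m]}(\widetilde{\mathbb A})]$; $\Phi(\widetilde{\mathbb A})$ is the span of all $\Phi^{[m]}(\widetilde{\mathbb A})$. $D_0^{\gamma}$ is defined on each $\Phi^{[m]}(\widetilde{\mathbb A})$ by $D_0^{\gamma}\zeta=F^{-1}\big[|\cdot|^{\gamma}_{0(m)}F[\zeta]\big]$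 with $|\xi'|^{\gamma}_{0(m)}=\prod_{q\le m}|\xi_q|_q^{\gamma}\prod_{q>m}\Omega(|\xi_q|_q)$ (the product with $F[\zeta]$ being $0$ where some $\xi_q=0$, $q\le m$), and extended linearly. *)

theory Defs
  imports
    "HOL-Analysis.Analysis"
    "HOL-Computational_Algebra.Primes"
    "HOL-Library.Groups_Big_Fun"
    "HOL-Algebra.QuotRing"
begin

section \<open>The fields of p-adic numbers\<close>

definition padic_norm_rat :: "nat \<Rightarrow> rat \<Rightarrow> real" where
  "padic_norm_rat p r =
     (if r = 0 then 0
      else case quotient_of r of (a, b) \<Rightarrow>
        real p powi (int (multiplicity (int p) b) - int (multiplicity (int p) a)))"

lemma padic_norm_rat_0 [simp]: "padic_norm_rat p 0 = 0"
  by (simp add: padic_norm_rat_def)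

lemma padic_norm_rat_nonneg: "padic_norm_rat p r \<ge> 0"
  by (auto simp: padic_norm_rat_def split: prod.split)

lemma padic_norm_rat_fraction:
  assumes "prime p" "a \<noteq> 0" "b \<noteq> 0"
  shows "padic_norm_rat p (of_int a / of_int b) =
    real p powi (int (multiplicity (int p) b) - int (multiplicity (int p) a))"
proof -
  obtain c d where cd: "quotient_of (of_int a / of_int b) = (c, d)"
    by fastforce
  have d: "d > 0" using quotient_of_denom_pos[OF cd] .
  have eq: "(of_int a / of_int b :: rat) = of_int c / of_int d"
    using quotient_of_div[OF cd] .
  have c: "c \<noteq> 0" using eq assms d by auto
  have "(of_int (a * d) :: rat) = of_int (c * b)"
    using eq assms d by (simp add: field_simps)
  hence ad: "a * d = c * b" by (simp only: of_int_eq_iff)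
  have pe: "prime_elem (int p)" using assms by simp
  have "multiplicity (int p) a + multiplicity (int p) d
      = multiplicity (int p) c + multiplicity (int p) b"
    using arg_cong[OF ad, of "multiplicity (int p)"] pe assms c d
    by (simp add: prime_elem_multiplicity_mult_distrib)
  hence "int (multiplicity (int p) d) - int (multiplicity (int p) c)
      = int (multiplicity (int p) b) - int (multiplicity (int p) a)" by linarith
  thus ?thesis using cd assms by (simp add: padic_norm_rat_def)
qed

lemma rat_fraction: obtains a b where "r = (of_int a / of_int b :: rat)" "b \<noteq> 0"
proof -
  obtain c d where cd: "quotient_of r = (c, d)" by fastforce
  show ?thesis
    using that quotient_of_div[OF cd] quotient_of_denom_pos[OF cd] by force
qed

lemma padic_norm_rat_mult:
  assumes "prime p"
  shows "padic_norm_rat p (r * s) = padic_norm_rat p r * padic_norm_rat p s"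
proof (cases "r = 0 \<or> s = 0")
  case False
  obtain a b where r: "r = of_int a / of_int b" "b \<noteq> 0" by (rule rat_fraction)
  obtain c d where s: "s = of_int c / of_int d" "d \<noteq> 0" by (rule rat_fraction)
  have nz: "a \<noteq> 0" "c \<noteq> 0" using False r s by auto
  have rs: "r * s = of_int (a * c) / of_int (b * d)" using r s by simp
  have pe: "prime_elem (int p)" using assms by simp
  have p0: "real p \<noteq> 0" using assms by auto
  show ?thesis
    unfolding rs using assms nz r(2) s(2) pe p0
    by (simp only: r(1) s(1) padic_norm_rat_fraction mult_eq_0_iff de_Morgan_disj
        prime_elem_multiplicity_mult_distrib not_False_eq_True simp_thms)
       (simp add: power_int_add [symmetric] algebra_simps)
qed auto

lemma padic_norm_rat_add:
  assumes "prime p"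
  shows "padic_norm_rat p (r + s) \<le> max (padic_norm_rat p r) (padic_norm_rat p s)"
proof (cases "r = 0 \<or> s = 0 \<or> r + s = 0")
  case True
  thus ?thesis using padic_norm_rat_nonneg[of p r] padic_norm_rat_nonneg[of p s]
    by (auto simp: le_max_iff_disj)
next
  case False
  obtain a b where r: "r = of_int a / of_int b" "b \<noteq> 0" by (rule rat_fraction)
  obtain c d where s: "s = of_int c / of_int d" "d \<noteq> 0" by (rule rat_fraction)
  define A C D where "A = a * d" and "C = c * b" and "D = b * d"
  have D: "D \<noteq> 0" using r s by (simp add: D_def)
  have rs: "r = of_int A / of_int D" "s = of_int C / of_int D"
      "r + s = of_int (A + C) / of_int D"
    using r s by (auto simp: A_def C_def D_def field_simps)
  have nz: "A \<noteq> 0" "C \<noteq> 0" "A + C \<noteq> 0" using False rs by force+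
  let ?m = "multiplicity (int p)"
  have "int p ^ min (?m A) (?m C) dvd A + C"
    by (intro dvd_add) (auto intro: multiplicity_dvd')
  hence "min (?m A) (?m C) \<le> ?m (A + C)"
    using assms nz(3) by (intro multiplicity_geI) auto
  moreover have "real p \<ge> 1" using assms prime_ge_1_nat by auto
  ultimately have
    "real p powi (int (?m D) - int (?m (A + C))) \<le> real p powi (int (?m D) - int (min (?m A) (?m C)))"
    by (intro power_int_increasing) auto
  also have "\<dots> \<le> max (real p powi (int (?m D) - int (?m A))) (real p powi (int (?m D) - int (?m C)))"
    by (auto simp: min_def)
  finally show ?thesis
    unfolding rs(3) unfolding rs(1,2) padic_norm_rat_fraction[OF assms nz(1) D]
      padic_norm_rat_fraction[OF assms nz(2) D] padic_norm_rat_fraction[OF assms nz(3) D] .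
qed

lemma padic_norm_rat_uminus [simp]: "padic_norm_rat p (- r) = padic_norm_rat p r"
proof -
  obtain a b where "quotient_of r = (a, b)" by fastforce
  thus ?thesis using multiplicity_normalize_right[of "int p" "- a"] multiplicity_normalize_right[of "int p" a]
    by (simp add: padic_norm_rat_def rat_uminus_code del: multiplicity_normalize_right)
qed

lemma padic_norm_rat_diff:
  assumes "prime p"
  shows "padic_norm_rat p (r - s) \<le> max (padic_norm_rat p r) (padic_norm_rat p s)"
  using padic_norm_rat_add[OF assms, of r "- s"] by simp

lemma padic_norm_rat_diff_abs:
  assumes "prime p"
  shows "\<bar>padic_norm_rat p r - padic_norm_rat p s\<bar> \<le> padic_norm_rat p (r - s)"
proof -
  have "padic_norm_rat p (s - r) = padic_norm_rat p (r - s)"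
    using padic_norm_rat_uminus[of p "r - s"] by simp
  moreover have "padic_norm_rat p r \<le> max (padic_norm_rat p (r - s)) (padic_norm_rat p s)"
    using padic_norm_rat_add[OF assms, of "r - s" s] by simp
  moreover have "padic_norm_rat p s \<le> max (padic_norm_rat p (s - r)) (padic_norm_rat p r)"
    using padic_norm_rat_add[OF assms, of "s - r" r] by simp
  ultimately show ?thesis
    using padic_norm_rat_nonneg[of p r] padic_norm_rat_nonneg[of p s]
      padic_norm_rat_nonneg[of p "r - s"] by linarith
qed

definition padic_Cauchy :: "nat \<Rightarrow> (nat \<Rightarrow> rat) \<Rightarrow> bool" where
  "padic_Cauchy p u \<longleftrightarrow>
     (\<forall>e>0. \<exists>N. \<forall>m\<ge>N. \<forall>n\<ge>N. padic_norm_rat p (u m - u n) < e)"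

definition Cauchy_ring :: "nat \<Rightarrow> (nat \<Rightarrow> rat) ring" where
  "Cauchy_ring p =
     \<lparr>carrier = {u. padic_Cauchy p u},
      mult = (\<lambda>u v n. u n * v n), one = (\<lambda>n. 1),
      zero = (\<lambda>n. 0), add = (\<lambda>u v n. u n + v n)\<rparr>"

definition null_ideal :: "nat \<Rightarrow> (nat \<Rightarrow> rat) set" where
  "null_ideal p = {u. (\<lambda>n. padic_norm_rat p (u n)) \<longlonglongrightarrow> 0}"

type_synonym padic = "(nat \<Rightarrow> rat) set"

text \<open>The completion of the rationals: Cauchy sequences modulo null sequences. All of the
  following is meaningful only for prime \<open>p\<close>.\<close>

definition Qp :: "nat \<Rightarrow> padic ring" where
  "Qp p = Cauchy_ring p Quot null_ideal p"

definition of_rat_padic :: "nat \<Rightarrow> rat \<Rightarrow> padic" where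
  "of_rat_padic p r = null_ideal p +>\<^bsub>Cauchy_ring p\<^esub> (\<lambda>n. r)"

definition padic_norm :: "nat \<Rightarrow> padic \<Rightarrow> real" where
  "padic_norm p x = (THE l. \<forall>u\<in>x. (\<lambda>n. padic_norm_rat p (u n)) \<longlonglongrightarrow> l)"

definition Zp :: "nat \<Rightarrow> padic set" where
  "Zp p = {x \<in> carrier (Qp p). padic_norm p x \<le> 1}"

lemma padic_Cauchy_const [simp]: "padic_Cauchy p (\<lambda>n. r)"
  by (auto simp: padic_Cauchy_def)

lemma padic_Cauchy_add:
  assumes "prime p" "padic_Cauchy p u" "padic_Cauchy p v"
  shows "padic_Cauchy p (\<lambda>n. u n + v n)"
  unfolding padic_Cauchy_def
proof (intro allI impI)
  fix e :: real assume "e > 0"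
  obtain M where M: "\<And>m n. m \<ge> M \<Longrightarrow> n \<ge> M \<Longrightarrow> padic_norm_rat p (u m - u n) < e"
    using assms(2) \<open>e > 0\<close> unfolding padic_Cauchy_def by blast
  obtain N where N: "\<And>m n. m \<ge> N \<Longrightarrow> n \<ge> N \<Longrightarrow> padic_norm_rat p (v m - v n) < e"
    using assms(3) \<open>e > 0\<close> unfolding padic_Cauchy_def by blast
  have "padic_norm_rat p (u m + v m - (u n + v n)) < e" if "m \<ge> max M N" "n \<ge> max M N" for m n
    using padic_norm_rat_add[OF assms(1), of "u m - u n" "v m - v n"] M[of m n] N[of m n] that
    by (simp add: algebra_simps)
  thus "\<exists>N. \<forall>m\<ge>N. \<forall>n\<ge>N. padic_norm_rat p (u m + v m - (u n + v n)) < e" by blast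
qed

lemma padic_Cauchy_uminus:
  assumes "padic_Cauchy p u"
  shows "padic_Cauchy p (\<lambda>n. - u n)"
proof -
  have "padic_norm_rat p (- u m - - u n) = padic_norm_rat p (u m - u n)" for m n
    using padic_norm_rat_uminus[of p "u m - u n"] by simp
  thus ?thesis using assms by (simp only: padic_Cauchy_def)
qed

lemma padic_Cauchy_norm_convergent:
  assumes "prime p" "padic_Cauchy p u"
  shows "convergent (\<lambda>n. padic_norm_rat p (u n))"
proof -
  have "Cauchy (\<lambda>n. padic_norm_rat p (u n))"
    using assms(2) padic_norm_rat_diff_abs[OF assms(1)] unfolding Cauchy_def padic_Cauchy_def dist_real_def
    by (meson le_less_trans)
  thus ?thesis using Cauchy_convergent_iff by blast
qed

lemma padic_Cauchy_mult:
  assumes "prime p" "padic_Cauchy p u" "padic_Cauchy p v"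
  shows "padic_Cauchy p (\<lambda>n. u n * v n)"
  unfolding padic_Cauchy_def
proof (intro allI impI)
  fix e :: real assume "e > 0"
  have "Bseq (\<lambda>n. padic_norm_rat p (u n))" "Bseq (\<lambda>n. padic_norm_rat p (v n))"
    using padic_Cauchy_norm_convergent assms convergent_imp_Bseq by blast+
  then obtain A B where A: "A > 0" "\<And>n. padic_norm_rat p (u n) \<le> A"
    and B: "B > 0" "\<And>n. padic_norm_rat p (v n) \<le> B"
    unfolding Bseq_def by (auto simp: padic_norm_rat_nonneg)
  obtain M where M: "\<And>m n. m \<ge> M \<Longrightarrow> n \<ge> M \<Longrightarrow> padic_norm_rat p (u m - u n) < e / B"
    using assms(2) \<open>e > 0\<close> B(1) unfolding padic_Cauchy_def by (meson divide_pos_pos)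
  obtain N where N: "\<And>m n. m \<ge> N \<Longrightarrow> n \<ge> N \<Longrightarrow> padic_norm_rat p (v m - v n) < e / A"
    using assms(3) \<open>e > 0\<close> A(1) unfolding padic_Cauchy_def by (meson divide_pos_pos)
  have "padic_norm_rat p (u m * v m - u n * v n) < e" if "m \<ge> max M N" "n \<ge> max M N" for m n
  proof -
    have "padic_norm_rat p (u m * (v m - v n)) \<le> A * padic_norm_rat p (v m - v n)"
      using A by (simp add: padic_norm_rat_mult[OF assms(1)] mult_right_mono padic_norm_rat_nonneg)
    also have "\<dots> < e" using N[of m n] that A by (simp add: field_simps)
    finally have 1: "padic_norm_rat p (u m * (v m - v n)) < e" .
    have "padic_norm_rat p ((u m - u n) * v n) \<le> padic_norm_rat p (u m - u n) * B"
      using B by (simp add: padic_norm_rat_mult[OF assms(1)] mult_left_mono padic_norm_rat_nonneg)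
    also have "\<dots> < e" using M[of m n] that B by (simp add: field_simps)
    finally have 2: "padic_norm_rat p ((u m - u n) * v n) < e" .
    show ?thesis
      using padic_norm_rat_add[OF assms(1), of "u m * (v m - v n)" "(u m - u n) * v n"] 1 2
      by (simp add: algebra_simps)
  qed
  thus "\<exists>N. \<forall>m\<ge>N. \<forall>n\<ge>N. padic_norm_rat p (u m * v m - u n * v n) < e" by blast
qed

lemma Cauchy_ring_cring:
  assumes "prime p"
  shows "cring (Cauchy_ring p)"
proof (rule cringI)
  show "abelian_group (Cauchy_ring p)"
  proof (rule abelian_groupI)
    fix u assume "u \<in> carrier (Cauchy_ring p)"
    thus "\<exists>v\<in>carrier (Cauchy_ring p). v \<oplus>\<^bsub>Cauchy_ring p\<^esub> u = \<zero>\<^bsub>Cauchy_ring p\<^esub>"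
      by (intro bexI[of _ "\<lambda>n. - u n"]) (auto simp: Cauchy_ring_def padic_Cauchy_uminus)
  qed (auto simp: Cauchy_ring_def padic_Cauchy_add[OF assms] algebra_simps)
  show "comm_monoid (Cauchy_ring p)"
    by (rule comm_monoidI) (auto simp: Cauchy_ring_def padic_Cauchy_mult[OF assms] algebra_simps)
qed (auto simp: Cauchy_ring_def algebra_simps)

lemma null_ideal_subset:
  assumes "prime p" "u \<in> null_ideal p"
  shows "padic_Cauchy p u"
  unfolding padic_Cauchy_def
proof (intro allI impI)
  fix e :: real assume "e > 0"
  then obtain N where N: "\<And>n. n \<ge> N \<Longrightarrow> padic_norm_rat p (u n) < e"
    using assms(2) unfolding null_ideal_def LIMSEQ_def
    by (auto simp: padic_norm_rat_nonneg)
  have "padic_norm_rat p (u m - u n) < e" if "m \<ge> N" "n \<ge> N" for m n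
    using padic_norm_rat_diff[OF assms(1), of "u m" "u n"] N[of m] N[of n] that by linarith
  thus "\<exists>N. \<forall>m\<ge>N. \<forall>n\<ge>N. padic_norm_rat p (u m - u n) < e" by blast
qed

lemma null_ideal_ideal:
  assumes "prime p"
  shows "ideal (null_ideal p) (Cauchy_ring p)"
proof -
  interpret cring "Cauchy_ring p" using Cauchy_ring_cring[OF assms] .
  have uminus: "(\<ominus>\<^bsub>Cauchy_ring p\<^esub> u) = (\<lambda>n. - u n)" if "u \<in> carrier (Cauchy_ring p)" for u
    using that by (intro minus_equality)
      (auto simp: Cauchy_ring_def padic_Cauchy_uminus)
  have add: "(\<lambda>n. u n + v n) \<in> null_ideal p" if "u \<in> null_ideal p" "v \<in> null_ideal p" for u v
  proof -
    have *: "(\<lambda>n. max (padic_norm_rat p (u n)) (padic_norm_rat p (v n))) \<longlonglongrightarrow> max 0 0"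
      using that by (intro tendsto_max) (auto simp: null_ideal_def)
    have "(\<lambda>n. padic_norm_rat p (u n + v n)) \<longlonglongrightarrow> 0"
      by (rule Lim_null_comparison[OF always_eventually])
        (use * in \<open>auto simp: padic_norm_rat_nonneg padic_norm_rat_add[OF assms]\<close>)
    thus ?thesis by (simp add: null_ideal_def)
  qed
  have mult: "(\<lambda>n. u n * v n) \<in> null_ideal p" if u: "u \<in> null_ideal p" and v: "padic_Cauchy p v" for u v
  proof -
    obtain l where "(\<lambda>n. padic_norm_rat p (v n)) \<longlonglongrightarrow> l"
      using padic_Cauchy_norm_convergent[OF assms v] convergent_def by blast
    hence "(\<lambda>n. padic_norm_rat p (u n) * padic_norm_rat p (v n)) \<longlonglongrightarrow> 0 * l"
      using u by (intro tendsto_mult) (auto simp: null_ideal_def)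
    thus ?thesis by (simp add: null_ideal_def padic_norm_rat_mult[OF assms])
  qed
  show ?thesis
  proof (rule idealI)
    show "ring (Cauchy_ring p)" by (rule ring_axioms)
    show "subgroup (null_ideal p) (add_monoid (Cauchy_ring p))"
    proof (rule add.subgroupI)
      show "null_ideal p \<subseteq> carrier (Cauchy_ring p)"
        using null_ideal_subset[OF assms] by (auto simp: Cauchy_ring_def)
      have "(\<lambda>n. 0) \<in> null_ideal p" by (simp add: null_ideal_def)
      thus "null_ideal p \<noteq> {}" by blast
      fix u v assume u: "u \<in> null_ideal p" and v: "v \<in> null_ideal p"
      show "\<ominus>\<^bsub>Cauchy_ring p\<^esub> u \<in> null_ideal p"
        using u null_ideal_subset[OF assms u] uminus[of u]
        by (simp add: Cauchy_ring_def) (simp add: null_ideal_def)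
      show "u \<oplus>\<^bsub>Cauchy_ring p\<^esub> v \<in> null_ideal p"
        using add[OF u v] by (simp add: Cauchy_ring_def)
    qed
  next
    fix u v assume u: "u \<in> null_ideal p" and v: "v \<in> carrier (Cauchy_ring p)"
    show "v \<otimes>\<^bsub>Cauchy_ring p\<^esub> u \<in> null_ideal p" "u \<otimes>\<^bsub>Cauchy_ring p\<^esub> v \<in> null_ideal p"
      using mult[OF u, of v] v by (auto simp: Cauchy_ring_def mult.commute)
  qed
qed

lemma Qp_cring: "prime p \<Longrightarrow> cring (Qp p)"
  unfolding Qp_def using ideal.quotient_is_cring[OF null_ideal_ideal Cauchy_ring_cring] .

lemma Qp_cases:
  assumes "prime p" "x \<in> carrier (Qp p)"
  obtains u where "padic_Cauchy p u" "x = null_ideal p +>\<^bsub>Cauchy_ring p\<^esub> u"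
  using assms(2) that unfolding Qp_def FactRing_def A_RCOSETS_def'
  by (auto simp: Cauchy_ring_def)

lemma padic_norm_coset:
  assumes "prime p" "padic_Cauchy p u" "(\<lambda>n. padic_norm_rat p (u n)) \<longlonglongrightarrow> l"
  shows "padic_norm p (null_ideal p +>\<^bsub>Cauchy_ring p\<^esub> u) = l"
proof -
  let ?x = "null_ideal p +>\<^bsub>Cauchy_ring p\<^esub> u"
  have lim: "(\<lambda>n. padic_norm_rat p (v n)) \<longlonglongrightarrow> l" if v: "v \<in> ?x" for v
  proof -
    obtain h where h: "h \<in> null_ideal p" "v = (\<lambda>n. h n + u n)"
      using v by (auto simp: a_r_coset_def' Cauchy_ring_def)
    have "(\<lambda>n. padic_norm_rat p (v n) - padic_norm_rat p (u n)) \<longlonglongrightarrow> 0"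
    proof (rule Lim_null_comparison[OF always_eventually])
      show "(\<lambda>n. padic_norm_rat p (h n)) \<longlonglongrightarrow> 0" using h by (simp add: null_ideal_def)
      show "\<forall>n. norm (padic_norm_rat p (v n) - padic_norm_rat p (u n)) \<le> padic_norm_rat p (h n)"
        using padic_norm_rat_diff_abs[OF assms(1), of "v n" "u n" for n] h(2) by auto
    qed
    from tendsto_add[OF this assms(3)] show ?thesis by simp
  qed
  have u: "u \<in> ?x"
    using ideal.axioms(1)[OF null_ideal_ideal[OF assms(1)]]
    by (force simp: a_r_coset_def' Cauchy_ring_def null_ideal_def intro!: bexI[of _ "\<lambda>n. 0"])
  show ?thesis unfolding padic_norm_def
    using lim u LIMSEQ_unique by (intro the_equality) blast+
qed

lemma padic_norm_add:
  assumes "prime p" "x \<in> carrier (Qp p)" "y \<in> carrier (Qp p)"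
  shows "padic_norm p (x \<oplus>\<^bsub>Qp p\<^esub> y) \<le> max (padic_norm p x) (padic_norm p y)"
proof -
  obtain u where u: "padic_Cauchy p u" "x = null_ideal p +>\<^bsub>Cauchy_ring p\<^esub> u"
    using Qp_cases[OF assms(1,2)] .
  obtain v where v: "padic_Cauchy p v" "y = null_ideal p +>\<^bsub>Cauchy_ring p\<^esub> v"
    using Qp_cases[OF assms(1,3)] .
  interpret ideal "null_ideal p" "Cauchy_ring p" using null_ideal_ideal[OF assms(1)] .
  have xy: "x \<oplus>\<^bsub>Qp p\<^esub> y = null_ideal p +>\<^bsub>Cauchy_ring p\<^esub> (\<lambda>n. u n + v n)"
    using a_rcos_sum[of u v] u v by (simp add: Qp_def FactRing_def Cauchy_ring_def)
  obtain l where l: "(\<lambda>n. padic_norm_rat p (u n)) \<longlonglongrightarrow> l"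
    using padic_Cauchy_norm_convergent[OF assms(1) u(1)] convergent_def by blast
  obtain k where k: "(\<lambda>n. padic_norm_rat p (v n)) \<longlonglongrightarrow> k"
    using padic_Cauchy_norm_convergent[OF assms(1) v(1)] convergent_def by blast
  have uv: "padic_Cauchy p (\<lambda>n. u n + v n)" using padic_Cauchy_add assms(1) u v by blast
  obtain j where j: "(\<lambda>n. padic_norm_rat p (u n + v n)) \<longlonglongrightarrow> j"
    using padic_Cauchy_norm_convergent[OF assms(1) uv] convergent_def by blast
  have "j \<le> max l k"
    using LIMSEQ_le[OF j tendsto_max[OF l k]] padic_norm_rat_add[OF assms(1)] by blast
  thus ?thesis
    using padic_norm_coset[OF assms(1) u(1) l] padic_norm_coset[OF assms(1) v(1) k]
      padic_norm_coset[OF assms(1) uv j] u v xy by simp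
qed

lemma Zp_add: "prime p \<Longrightarrow> x \<in> Zp p \<Longrightarrow> y \<in> Zp p \<Longrightarrow> x \<oplus>\<^bsub>Qp p\<^esub> y \<in> Zp p"
  using padic_norm_add[of p x y] cring.cring_simprules(1)[OF Qp_cring, of p x y]
  unfolding Zp_def by auto

lemma Zp_zero: "prime p \<Longrightarrow> \<zero>\<^bsub>Qp p\<^esub> \<in> Zp p"
proof -
  assume p: "prime p"
  interpret ideal "null_ideal p" "Cauchy_ring p" using null_ideal_ideal[OF p] .
  have "\<zero>\<^bsub>Qp p\<^esub> = null_ideal p +>\<^bsub>Cauchy_ring p\<^esub> (\<lambda>n. 0)"
    using a_rcos_const[of "\<lambda>n. 0"] by (simp add: Qp_def FactRing_def null_ideal_def)
  moreover have "padic_norm p (null_ideal p +>\<^bsub>Cauchy_ring p\<^esub> (\<lambda>n. 0)) = 0"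
    by (rule padic_norm_coset[OF p]) auto
  ultimately show ?thesis
    using cring.cring_simprules(2)[OF Qp_cring[OF p]] by (simp add: Zp_def)
qed

lemma Qp_zero: "\<zero>\<^bsub>Qp p\<^esub> = null_ideal p"
  by (simp add: Qp_def FactRing_def)

lemma Qp_minus_coset:
  assumes "prime p" "padic_Cauchy p u" "padic_Cauchy p v"
  shows "(null_ideal p +>\<^bsub>Cauchy_ring p\<^esub> u) \<ominus>\<^bsub>Qp p\<^esub> (null_ideal p +>\<^bsub>Cauchy_ring p\<^esub> v) =
    null_ideal p +>\<^bsub>Cauchy_ring p\<^esub> (\<lambda>n. u n - v n)"
proof -
  interpret I: ideal "null_ideal p" "Cauchy_ring p" using null_ideal_ideal[OF assms(1)] .
  interpret Q: cring "Qp p" using Qp_cring[OF assms(1)] .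
  have w: "padic_Cauchy p (\<lambda>n. u n - v n)"
    using padic_Cauchy_add[OF assms(1,2) padic_Cauchy_uminus[OF assms(3)]] by simp
  have carr: "null_ideal p +>\<^bsub>Cauchy_ring p\<^esub> f \<in> carrier (Qp p)" if "padic_Cauchy p f" for f
    using that by (auto simp: Qp_def FactRing_def A_RCOSETS_def' Cauchy_ring_def)
  have eq: "(null_ideal p +>\<^bsub>Cauchy_ring p\<^esub> (\<lambda>n. u n - v n)) \<oplus>\<^bsub>Qp p\<^esub> (null_ideal p +>\<^bsub>Cauchy_ring p\<^esub> v)
      = null_ideal p +>\<^bsub>Cauchy_ring p\<^esub> u"
    using I.a_rcos_sum[of "\<lambda>n. u n - v n" v] w assms(3)
    by (simp add: Qp_def FactRing_def Cauchy_ring_def)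
  have "(x \<oplus>\<^bsub>Qp p\<^esub> y) \<ominus>\<^bsub>Qp p\<^esub> y = x" if "x \<in> carrier (Qp p)" "y \<in> carrier (Qp p)" for x y
    using that by algebra
  from this[OF carr[OF w] carr[OF assms(3)]] show ?thesis by (simp only: eq)
qed

lemma padic_norm_eq_0:
  assumes "prime p" "x \<in> carrier (Qp p)" "padic_norm p x = 0"
  shows "x = \<zero>\<^bsub>Qp p\<^esub>"
proof -
  interpret I: ideal "null_ideal p" "Cauchy_ring p" using null_ideal_ideal[OF assms(1)] .
  obtain u where u: "padic_Cauchy p u" "x = null_ideal p +>\<^bsub>Cauchy_ring p\<^esub> u"
    using Qp_cases[OF assms(1,2)] .
  obtain l where l: "(\<lambda>n. padic_norm_rat p (u n)) \<longlonglongrightarrow> l"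
    using padic_Cauchy_norm_convergent[OF assms(1) u(1)] convergent_def by blast
  have "l = 0" using padic_norm_coset[OF assms(1) u(1) l] u(2) assms(3) by simp
  hence "u \<in> null_ideal p" using l by (simp add: null_ideal_def)
  thus ?thesis using I.a_rcos_const u(2) by (simp add: Qp_zero)
qed

lemma padic_norm_nonneg:
  assumes "prime p" "x \<in> carrier (Qp p)"
  shows "padic_norm p x \<ge> 0"
proof -
  obtain u where u: "padic_Cauchy p u" "x = null_ideal p +>\<^bsub>Cauchy_ring p\<^esub> u"
    using Qp_cases[OF assms] .
  obtain l where l: "(\<lambda>n. padic_norm_rat p (u n)) \<longlonglongrightarrow> l"
    using padic_Cauchy_norm_convergent[OF assms(1) u(1)] convergent_def by blast
  have "l \<ge> 0" by (rule LIMSEQ_le_const[OF l]) (auto simp: padic_norm_rat_nonneg)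
  thus ?thesis using padic_norm_coset[OF assms(1) u(1) l] u(2) by simp
qed

definition padic_dist :: "nat \<Rightarrow> padic \<Rightarrow> padic \<Rightarrow> real" where
  "padic_dist p x y =
     (if x \<in> carrier (Qp p) \<and> y \<in> carrier (Qp p) then padic_norm p (x \<ominus>\<^bsub>Qp p\<^esub> y) else 0)"

lemma padic_norm_minus_commute:
  assumes "prime p" "x \<in> carrier (Qp p)" "y \<in> carrier (Qp p)"
  shows "padic_norm p (x \<ominus>\<^bsub>Qp p\<^esub> y) = padic_norm p (y \<ominus>\<^bsub>Qp p\<^esub> x)"
proof -
  obtain u where u: "padic_Cauchy p u" "x = null_ideal p +>\<^bsub>Cauchy_ring p\<^esub> u"
    using Qp_cases[OF assms(1,2)] .
  obtain v where v: "padic_Cauchy p v" "y = null_ideal p +>\<^bsub>Cauchy_ring p\<^esub> v"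
    using Qp_cases[OF assms(1,3)] .
  have uv: "padic_Cauchy p (\<lambda>n. u n - v n)" and vu: "padic_Cauchy p (\<lambda>n. v n - u n)"
    using padic_Cauchy_add[OF assms(1) u(1) padic_Cauchy_uminus[OF v(1)]]
      padic_Cauchy_add[OF assms(1) v(1) padic_Cauchy_uminus[OF u(1)]] by auto
  obtain l where l: "(\<lambda>n. padic_norm_rat p (u n - v n)) \<longlonglongrightarrow> l"
    using padic_Cauchy_norm_convergent[OF assms(1) uv] convergent_def by blast
  have "padic_norm_rat p (v n - u n) = padic_norm_rat p (u n - v n)" for n
    using padic_norm_rat_uminus[of p "u n - v n"] by simp
  hence l': "(\<lambda>n. padic_norm_rat p (v n - u n)) \<longlonglongrightarrow> l" using l by simp
  show ?thesis
    unfolding u(2) v(2) Qp_minus_coset[OF assms(1) u(1) v(1)] Qp_minus_coset[OF assms(1) v(1) u(1)]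
    using padic_norm_coset[OF assms(1) uv l] padic_norm_coset[OF assms(1) vu l'] by simp
qed

lemma padic_metric:
  assumes "prime p"
  shows "Metric_space (carrier (Qp p)) (padic_dist p)"
proof
  interpret Q: cring "Qp p" using Qp_cring[OF assms] .
  show "0 \<le> padic_dist p x y" for x y
    using padic_norm_nonneg[OF assms] by (simp add: padic_dist_def)
  show "padic_dist p x y = padic_dist p y x" for x y
    using padic_norm_minus_commute[OF assms] by (simp add: padic_dist_def)
  show "padic_dist p x y = 0 \<longleftrightarrow> x = y" if x: "x \<in> carrier (Qp p)" and y: "y \<in> carrier (Qp p)" for x y
  proof
    assume "padic_dist p x y = 0"
    hence "x \<ominus>\<^bsub>Qp p\<^esub> y = \<zero>\<^bsub>Qp p\<^esub>"
      using x y padic_norm_eq_0[OF assms, of "x \<ominus>\<^bsub>Qp p\<^esub> y"] by (simp add: padic_dist_def)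
    moreover have "(x \<ominus>\<^bsub>Qp p\<^esub> y) \<oplus>\<^bsub>Qp p\<^esub> y = x" using x y by algebra
    ultimately show "x = y" using x y by simp
  next
    assume "x = y"
    moreover obtain u where u: "padic_Cauchy p u" "x = null_ideal p +>\<^bsub>Cauchy_ring p\<^esub> u"
      using Qp_cases[OF assms x] .
    ultimately show "padic_dist p x y = 0"
      using x y Qp_minus_coset[OF assms u(1) u(1)] padic_norm_coset[OF assms, of "\<lambda>n. 0" 0]
      by (simp add: padic_dist_def)
  qed
  show "padic_dist p x z \<le> padic_dist p x y + padic_dist p y z"
    if "x \<in> carrier (Qp p)" "y \<in> carrier (Qp p)" "z \<in> carrier (Qp p)" for x y z
  proof -
    have "x \<ominus>\<^bsub>Qp p\<^esub> z = (x \<ominus>\<^bsub>Qp p\<^esub> y) \<oplus>\<^bsub>Qp p\<^esub> (y \<ominus>\<^bsub>Qp p\<^esub> z)"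
      using that by algebra
    thus ?thesis
      using that padic_norm_add[OF assms, of "x \<ominus>\<^bsub>Qp p\<^esub> y" "y \<ominus>\<^bsub>Qp p\<^esub> z"]
        padic_norm_nonneg[OF assms, of "x \<ominus>\<^bsub>Qp p\<^esub> y"] padic_norm_nonneg[OF assms, of "y \<ominus>\<^bsub>Qp p\<^esub> z"]
      by (simp add: padic_dist_def)
  qed
qed

definition Qp_topology :: "nat \<Rightarrow> padic topology" where
  "Qp_topology p = Metric_space.mtopology (carrier (Qp p)) (padic_dist p)"

text \<open>The finite sums \<open>a\<^sub>1 / p + \<dots> + a\<^sub>n / p^n\<close> with digits \<open>0 \<le> a\<^sub>i < p\<close>.\<close>

definition I_set :: "nat \<Rightarrow> rat set" where
  "I_set p = {(\<Sum>i=1..n. of_nat (d i) / of_nat p ^ i) | (n::nat) d. \<forall>i. d i < p}"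

text \<open>The part with negative powers of \<open>p\<close> in the digit expansion of \<open>x\<close>: the remaining part
  of the expansion lies in \<open>Zp p\<close>.\<close>

definition padic_frac :: "nat \<Rightarrow> padic \<Rightarrow> rat" where
  "padic_frac p x = (THE r. r \<in> I_set p \<and> x \<ominus>\<^bsub>Qp p\<^esub> of_rat_padic p r \<in> Zp p)"

definition padic_char :: "nat \<Rightarrow> padic \<Rightarrow> complex" where
  "padic_char p x = exp (2 * of_real pi * \<i> * of_rat (padic_frac p x))"

definition \<Omega> :: "real \<Rightarrow> complex" where
  "\<Omega> t = indicator {0..1} t"

definition test_functions :: "nat \<Rightarrow> (padic \<Rightarrow> complex) set" where
  "test_functions p =
     {f. (\<forall>x\<in>carrier (Qp p). \<exists>U. openin (Qp_topology p) U \<and> x \<in> U \<and> (\<forall>y\<in>U. f y = f x)) \<and>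
         compactin (Qp_topology p)
           (Abstract_Topology.closure_of (Qp_topology p) {x \<in> carrier (Qp p). f x \<noteq> 0})}"


section \<open>The finite adeles\<close>

typedef finite_adele =
  "{x \<in> \<Pi>\<^sub>E p\<in>{p. prime p}. carrier (Qp p). finite {p. prime p \<and> x p \<notin> Zp p}}"
  morphisms component Abs_finite_adele
proof (intro exI CollectI conjI)
  let ?z = "\<lambda>p\<in>{p. prime p}. \<zero>\<^bsub>Qp p\<^esub>"
  show "?z \<in> (\<Pi>\<^sub>E p\<in>{p. prime p}. carrier (Qp p))" using Zp_zero by (auto simp: Zp_def)
  have "{p. prime p \<and> ?z p \<notin> Zp p} = {}" using Zp_zero by auto
  thus "finite {p. prime p \<and> ?z p \<notin> Zp p}" by (simp only: finite.emptyI)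
qed

instantiation finite_adele :: plus
begin

definition plus_finite_adele :: "finite_adele \<Rightarrow> finite_adele \<Rightarrow> finite_adele" where
  "x + y = Abs_finite_adele (\<lambda>p\<in>{p. prime p}. component x p \<oplus>\<^bsub>Qp p\<^esub> component y p)"

instance ..

end

lemma component_plus:
  assumes "prime p"
  shows "component (x + y) p = component x p \<oplus>\<^bsub>Qp p\<^esub> component y p"
proof -
  let ?s = "\<lambda>p\<in>{p. prime p}. component x p \<oplus>\<^bsub>Qp p\<^esub> component y p"
  have xy: "component x q \<in> carrier (Qp q)" "component y q \<in> carrier (Qp q)" if "prime q" for q
    using component[of x] component[of y] that by (auto simp: PiE_iff)
  have 1: "?s \<in> (\<Pi>\<^sub>E p\<in>{p. prime p}. carrier (Qp p))"
    by (rule restrict_PiE_iff[THEN iffD2], rule ballI)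
      (simp add: xy cring.cring_simprules(1)[OF Qp_cring])
  have "finite ({p. prime p \<and> component x p \<notin> Zp p} \<union> {p. prime p \<and> component y p \<notin> Zp p})"
    using component[of x] component[of y] by simp
  hence 2: "finite {p. prime p \<and> ?s p \<notin> Zp p}"
    by (rule rev_finite_subset) (auto simp: Zp_add)
  from 1 2 have
    "?s \<in> {x \<in> \<Pi>\<^sub>E p\<in>{p. prime p}. carrier (Qp p). finite {p. prime p \<and> x p \<notin> Zp p}}"
    by (intro CollectI conjI)
  thus ?thesis using assms by (simp add: plus_finite_adele_def Abs_finite_adele_inverse)
qed

instantiation finite_adele :: topological_space
begin

text \<open>The restricted product topology.\<close>

definition open_finite_adele :: "finite_adele set \<Rightarrow> bool" where
  "open_finite_adele =
     generate_topology {{x. \<forall>p. prime p \<longrightarrow> component x p \<in> U p} | U.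
       (\<forall>p. prime p \<longrightarrow> openin (Qp_topology p) (U p)) \<and> finite {p. prime p \<and> U p \<noteq> Zp p}}"

instance
  by standard (auto simp: open_finite_adele_def intro: generate_topology.intros)

end

text \<open>The Haar measure for which the product of all \<open>Zp p\<close>, an open compact subgroup, has
  measure 1; in particular it is finite on compact sets.\<close>

definition normalized_Haar :: "finite_adele measure \<Rightarrow> bool" where
  "normalized_Haar \<mu> \<longleftrightarrow>
     sets \<mu> = sets borel \<and>
     (\<forall>a. \<forall>A\<in>sets \<mu>. emeasure \<mu> ((+) a ` A) = emeasure \<mu> A) \<and>
     emeasure \<mu> {x. \<forall>p. prime p \<longrightarrow> component x p \<in> Zp p} = 1"

text \<open>\<^const>\<open>Prod_any\<close> is the product of the factors different from 1, provided that there are only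
  finitely many of these. For the products below this is so at every adele.\<close>

definition prime_prod :: "(nat \<Rightarrow> complex) \<Rightarrow> complex" where
  "prime_prod f = Prod_any (\<lambda>p. if prime p then f p else 1)"

definition fourier ::
    "finite_adele measure \<Rightarrow> (finite_adele \<Rightarrow> complex) \<Rightarrow> finite_adele \<Rightarrow> complex" where
  "fourier \<mu> \<phi> \<xi> =
     (\<integral>x. prime_prod (\<lambda>p. padic_char p (component \<xi> p \<otimes>\<^bsub>Qp p\<^esub> component x p)) * \<phi> x \<partial>\<mu>)"


section \<open>Spaces of test functions\<close>

definition complex_span :: "(finite_adele \<Rightarrow> complex) set \<Rightarrow> (finite_adele \<Rightarrow> complex) set" where
  "complex_span S = {\<lambda>x. \<Sum>g\<in>T. c g * g x | T c. finite T \<and> T \<subseteq> S}"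

definition product_functions :: "nat \<Rightarrow> (finite_adele \<Rightarrow> complex) set" where
  "product_functions m =
     {\<lambda>\<xi>. prime_prod (\<lambda>p. \<eta> p (component \<xi> p)) | \<eta>.
        (\<forall>p. prime p \<longrightarrow> \<eta> p \<in> test_functions p) \<and>
        (\<forall>p. prime p \<and> p > m \<longrightarrow> (\<forall>x\<in>carrier (Qp p). \<eta> p x = \<Omega> (padic_norm p x)))}"

definition Schwartz_Bruhat :: "(finite_adele \<Rightarrow> complex) set" where
  "Schwartz_Bruhat = complex_span (\<Union>m. product_functions m)"

definition \<Psi>_space :: "nat \<Rightarrow> (finite_adele \<Rightarrow> complex) set" where
  "\<Psi>_space m =
     {\<psi> \<in> complex_span (product_functions m).
        \<forall>\<xi> r. prime r \<and> r \<le> m \<and> component \<xi> r = \<zero>\<^bsub>Qp r\<^esub> \<longrightarrow> \<psi> \<xi> = 0}"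

definition \<Phi>_space :: "finite_adele measure \<Rightarrow> nat \<Rightarrow> (finite_adele \<Rightarrow> complex) set" where
  "\<Phi>_space \<mu> m = fourier \<mu> ` \<Psi>_space m"

definition \<Phi>_total :: "finite_adele measure \<Rightarrow> (finite_adele \<Rightarrow> complex) set" where
  "\<Phi>_total \<mu> = complex_span (\<Union>m\<in>{m. prime m}. \<Phi>_space \<mu> m)"


section \<open>The fractional operator\<close>

text \<open>The Fourier transform is a bijection of \<open>Schwartz_Bruhat\<close>, which contains all the spaces
  above, onto itself.\<close>

definition fourier_inv ::
    "finite_adele measure \<Rightarrow> (finite_adele \<Rightarrow> complex) \<Rightarrow> finite_adele \<Rightarrow> complex" where
  "fourier_inv \<mu> = inv_into Schwartz_Bruhat (fourier \<mu>)"

text \<open>Since \<open>0 powr \<gamma> = 0\<close>, this vanishes where \<open>\<xi>\<close> has a zero component at some prime \<open>q \<le> m\<close>.\<close>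

definition symbol :: "nat \<Rightarrow> complex \<Rightarrow> finite_adele \<Rightarrow> complex" where
  "symbol m \<gamma> \<xi> =
     (\<Prod>q | prime q \<and> q \<le> m. of_real (padic_norm q (component \<xi> q)) powr \<gamma>) *
     prime_prod (\<lambda>q. if q > m then \<Omega> (padic_norm q (component \<xi> q)) else 1)"

definition D0_on ::
    "finite_adele measure \<Rightarrow> nat \<Rightarrow> complex \<Rightarrow> (finite_adele \<Rightarrow> complex) \<Rightarrow> finite_adele \<Rightarrow> complex" where
  "D0_on \<mu> m \<gamma> \<zeta> = fourier_inv \<mu> (\<lambda>\<xi>. symbol m \<gamma> \<xi> * fourier \<mu> \<zeta> \<xi>)"

text \<open>The linear extension of the operators \<open>D0_on \<mu> m \<gamma>\<close> on \<open>\<Phi>_space \<mu> m\<close> to the sum of these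
  spaces. The sum is direct: at an adele with component 0 at the prime \<open>m\<close>, every function
  in \<open>\<Psi>_space m\<close> vanishes, while those in \<open>\<Psi>_space m'\<close> with \<open>m' < m\<close> do not depend on that component
  inside \<open>Zp m\<close>.\<close>

definition D0 ::
    "finite_adele measure \<Rightarrow> complex \<Rightarrow> (finite_adele \<Rightarrow> complex) \<Rightarrow> finite_adele \<Rightarrow> complex" where
  "D0 \<mu> \<gamma> \<zeta> =
     (THE \<eta>. \<exists>M Z. finite M \<and> (\<forall>m\<in>M. prime m \<and> Z m \<in> \<Phi>_space \<mu> m) \<and>
        \<zeta> = (\<lambda>x. \<Sum>m\<in>M. Z m x) \<and> \<eta> = (\<lambda>x. \<Sum>m\<in>M. D0_on \<mu> m \<gamma> (Z m) x))"


section \<open>The adelic wavelets\<close>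

definition adelic_wavelet ::
    "nat \<Rightarrow> (nat \<Rightarrow> nat) \<Rightarrow> (nat \<Rightarrow> nat) \<Rightarrow> (nat \<Rightarrow> rat) \<Rightarrow> finite_adele \<Rightarrow> complex" where
  "adelic_wavelet m k j a x =
     (\<Prod>q | prime q \<and> q \<le> m.
        let y = (of_rat_padic q (1 / of_nat q ^ j q) \<otimes>\<^bsub>Qp q\<^esub> component x q)
                  \<ominus>\<^bsub>Qp q\<^esub> of_rat_padic q (a q)
        in of_real (real q powr (real (j q) / 2)) *
           padic_char q (of_rat_padic q (of_nat (k q) / of_nat q) \<otimes>\<^bsub>Qp q\<^esub> y) *
           \<Omega> (padic_norm q y)) *
     prime_prod (\<lambda>q. if q > m then \<Omega> (padic_norm q (component x q)) else 1)"

end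

theory Submission
  imports Defs "HOL-Number_Theory.Cong"
begin

text \<open>
  Subtracting the sum of its local fractional parts, a rational number, makes an adele integral.
  So \<open>\<rat>/\<int>\<close> is the group of finite adeles modulo \<open>Zhat\<close>, the character is
  \<open>x \<mapsto> exp (2\<pi>i r)\<close> for any rational \<open>r\<close> congruent to \<open>x\<close>, and its kernel is \<open>Zhat\<close>.

  For an invertible adele \<open>s\<close> put \<open>h(\<kappa>, a, s)(x) = \<chi>(\<kappa>(x - a)) 1(s(x - a) \<in> Zhat)\<close>. Translation invariance
  of the Haar measure alone gives
  \<open>F h(\<kappa>, a, s) = \<mu>(s\<inverse> Zhat) \<chi>(-\<kappa> a) h(a, -\<kappa>, s\<inverse>)\<close>, and every Schwartz-Bruhat function is a
  finite combination of \<open>h(0, c/N, 1/N)\<close> for one \<open>N\<close>; hence \<open>F\<close> is injective there. The wavelet is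
  a multiple of such an \<open>h\<close>, with \<open>|\<kappa>\<^sub>q| = q ^ (j q + 1)\<close> and \<open>s\<^sub>q = q ^ (- j q)\<close> for \<open>q \<le> m\<close>, so by the ultrametric
  inequality the symbol is constant on the support of its Fourier transform.\<close>

section \<open>Arithmetic of p-adic numbers\<close>

text \<open>\<open>D0\<close> is a definite description over all decompositions of its argument. So
  besides the eigenvalue identity at level m, the wavelet must be shown to have essentially only one
  decomposition. Transformed back, this is the directness of the sum of the spaces
  \<open>\<Psi>_space\<close>. The inverse transform is an \<open>inv_into\<close>, hence the weight
  put on injectivity over all of \<open>Schwartz_Bruhat\<close>.

  The measure is known only through invariance and normalization. Local Haar measures and iterated
  integrals are avoided by describing functions with one natural number N: periodic modulo N
  \<open>Zhat\<close> and supported in 1/N \<open>Zhat\<close>. Such a function lives on a finite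
  group of order \<open>N * N\<close>, and all integrals reduce to lattices and their translates.
  Lattice measures stay unevaluated; finite and positive is enough, since they are only divided out.

  The decisive inequality is local: at q \<le> m the frequency has norm
  \<open>q ^ (j q + 1)\<close>, while the spectrum deviates from its negative by at most
  \<open>q ^ j q\<close>. This factor q keeps the spectrum away from zero components.\<close>

abbreviation Cauchy_class :: "nat \<Rightarrow> (nat \<Rightarrow> rat) \<Rightarrow> padic" where
  "Cauchy_class p u \<equiv> null_ideal p +>\<^bsub>Cauchy_ring p\<^esub> u"

lemma Cauchy_class_carrier: "padic_Cauchy p u \<Longrightarrow> Cauchy_class p u \<in> carrier (Qp p)"
  by (auto simp: Qp_def FactRing_def A_RCOSETS_def' Cauchy_ring_def)

lemma Cauchy_class_add:
  assumes "prime p" "padic_Cauchy p u" "padic_Cauchy p v"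
  shows "Cauchy_class p u \<oplus>\<^bsub>Qp p\<^esub> Cauchy_class p v = Cauchy_class p (\<lambda>n. u n + v n)"
proof -
  interpret ideal "null_ideal p" "Cauchy_ring p" using null_ideal_ideal[OF assms(1)] .
  show ?thesis using a_rcos_sum[of u v] assms by (simp add: Qp_def FactRing_def Cauchy_ring_def)
qed

lemma Cauchy_class_mult:
  assumes "prime p" "padic_Cauchy p u" "padic_Cauchy p v"
  shows "Cauchy_class p u \<otimes>\<^bsub>Qp p\<^esub> Cauchy_class p v = Cauchy_class p (\<lambda>n. u n * v n)"
proof -
  interpret ideal "null_ideal p" "Cauchy_ring p" using null_ideal_ideal[OF assms(1)] .
  show ?thesis using rcoset_mult_add[of u v] assms by (simp add: Qp_def FactRing_def Cauchy_ring_def)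
qed

lemma padic_norm_Cauchy_class_tendsto:
  assumes "prime p" "padic_Cauchy p u"
  shows "(\<lambda>n. padic_norm_rat p (u n)) \<longlonglongrightarrow> padic_norm p (Cauchy_class p u)"
  using padic_Cauchy_norm_convergent[OF assms] padic_norm_coset[OF assms] convergent_def by metis

lemma padic_norm_mult:
  assumes "prime p" "x \<in> carrier (Qp p)" "y \<in> carrier (Qp p)"
  shows "padic_norm p (x \<otimes>\<^bsub>Qp p\<^esub> y) = padic_norm p x * padic_norm p y"
proof -
  obtain u where u: "padic_Cauchy p u" "x = Cauchy_class p u"
    using Qp_cases[OF assms(1,2)] .
  obtain v where v: "padic_Cauchy p v" "y = Cauchy_class p v"
    using Qp_cases[OF assms(1,3)] .
  have "(\<lambda>n. padic_norm_rat p (u n * v n)) \<longlonglongrightarrow> padic_norm p x * padic_norm p y"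
    using tendsto_mult[OF padic_norm_Cauchy_class_tendsto[OF assms(1) u(1)]
        padic_norm_Cauchy_class_tendsto[OF assms(1) v(1)]] u v
    by (simp add: padic_norm_rat_mult[OF assms(1)])
  thus ?thesis
    using padic_norm_coset[OF assms(1) padic_Cauchy_mult[OF assms(1) u(1) v(1)]]
      Cauchy_class_mult[OF assms(1) u(1) v(1)] u v by simp
qed

lemma of_rat_padic_carrier [simp]: "of_rat_padic p r \<in> carrier (Qp p)"
  by (simp add: of_rat_padic_def Cauchy_class_carrier)

lemma of_rat_padic_add:
  "prime p \<Longrightarrow> of_rat_padic p (r + s) = of_rat_padic p r \<oplus>\<^bsub>Qp p\<^esub> of_rat_padic p s"
  by (simp add: of_rat_padic_def Cauchy_class_add)

lemma of_rat_padic_mult: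
  "prime p \<Longrightarrow> of_rat_padic p (r * s) = of_rat_padic p r \<otimes>\<^bsub>Qp p\<^esub> of_rat_padic p s"
  by (simp add: of_rat_padic_def Cauchy_class_mult)

lemma of_rat_padic_diff:
  "prime p \<Longrightarrow> of_rat_padic p (r - s) = of_rat_padic p r \<ominus>\<^bsub>Qp p\<^esub> of_rat_padic p s"
  by (simp add: of_rat_padic_def Qp_minus_coset)

lemma padic_norm_of_rat [simp]: "prime p \<Longrightarrow> padic_norm p (of_rat_padic p r) = padic_norm_rat p r"
  unfolding of_rat_padic_def by (rule padic_norm_coset) auto

lemma padic_norm_zero [simp]: "prime p \<Longrightarrow> padic_norm p \<zero>\<^bsub>Qp p\<^esub> = 0"
proof -
  assume p: "prime p"
  interpret Q: cring "Qp p" using Qp_cring[OF p] .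
  have "\<zero>\<^bsub>Qp p\<^esub> = of_rat_padic p 0"
    using of_rat_padic_diff[OF p, of 0 0] by (simp add: a_minus_def Q.r_neg)
  thus ?thesis using p by simp
qed

lemma of_rat_padic_0 [simp]: "prime p \<Longrightarrow> of_rat_padic p 0 = \<zero>\<^bsub>Qp p\<^esub>"
  using padic_norm_eq_0[of p "of_rat_padic p 0"] by simp

lemma of_rat_padic_1 [simp]: "of_rat_padic p 1 = \<one>\<^bsub>Qp p\<^esub>"
  by (simp add: of_rat_padic_def Qp_def FactRing_def Cauchy_ring_def)

lemma padic_norm_uminus:
  assumes "prime p" "x \<in> carrier (Qp p)"
  shows "padic_norm p (\<ominus>\<^bsub>Qp p\<^esub> x) = padic_norm p x"
proof -
  interpret Q: cring "Qp p" using Qp_cring[OF assms(1)] .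
  have "\<zero>\<^bsub>Qp p\<^esub> \<ominus>\<^bsub>Qp p\<^esub> x = \<ominus>\<^bsub>Qp p\<^esub> x" "x \<ominus>\<^bsub>Qp p\<^esub> \<zero>\<^bsub>Qp p\<^esub> = x"
    using assms(2) by algebra+
  thus ?thesis using padic_norm_minus_commute[OF assms(1) Q.zero_closed assms(2)] by simp
qed

lemma padic_norm_diff:
  assumes "prime p" "x \<in> carrier (Qp p)" "y \<in> carrier (Qp p)"
  shows "padic_norm p (x \<ominus>\<^bsub>Qp p\<^esub> y) \<le> max (padic_norm p x) (padic_norm p y)"
proof -
  interpret Q: cring "Qp p" using Qp_cring[OF assms(1)] .
  show ?thesis
    using padic_norm_add[OF assms(1,2), of "\<ominus>\<^bsub>Qp p\<^esub> y"] padic_norm_uminus[OF assms(1,3)] assms(3)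
    by (simp add: a_minus_def)
qed

lemma Zp_carrier: "x \<in> Zp p \<Longrightarrow> x \<in> carrier (Qp p)"
  by (simp add: Zp_def)

lemma Zp_diff:
  assumes "prime p" "x \<in> Zp p" "y \<in> Zp p"
  shows "x \<ominus>\<^bsub>Qp p\<^esub> y \<in> Zp p"
proof -
  interpret Q: cring "Qp p" using Qp_cring[OF assms(1)] .
  show ?thesis using padic_norm_diff[OF assms(1), of x y] assms(2,3) by (auto simp: Zp_def)
qed

lemma Zp_uminus: "prime p \<Longrightarrow> x \<in> Zp p \<Longrightarrow> \<ominus>\<^bsub>Qp p\<^esub> x \<in> Zp p"
  using padic_norm_uminus[of p x] cring.cring_simprules(3)[OF Qp_cring, of p x] by (auto simp: Zp_def)

lemma Zp_mult:
  assumes "prime p" "x \<in> Zp p" "y \<in> Zp p"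
  shows "x \<otimes>\<^bsub>Qp p\<^esub> y \<in> Zp p"
proof -
  interpret Q: cring "Qp p" using Qp_cring[OF assms(1)] .
  show ?thesis using padic_norm_mult[OF assms(1), of x y] assms(2,3) padic_norm_nonneg[OF assms(1)]
    by (auto simp: Zp_def intro: mult_le_one)
qed

section \<open>Norms of rational numbers and integrality\<close>

lemma of_rat_padic_in_Zp_iff: "prime p \<Longrightarrow> of_rat_padic p r \<in> Zp p \<longleftrightarrow> padic_norm_rat p r \<le> 1"
  by (simp add: Zp_def)

lemma padic_norm_rat_1 [simp]: "prime p \<Longrightarrow> padic_norm_rat p 1 = 1"
  using padic_norm_rat_fraction[of p 1 1] by simp

lemma Zp_one: "prime p \<Longrightarrow> \<one>\<^bsub>Qp p\<^esub> \<in> Zp p"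
  using of_rat_padic_in_Zp_iff[of p 1] by simp

lemma padic_norm_rat_fraction_le_1:
  assumes "prime p" "\<not> int p dvd b"
  shows "padic_norm_rat p (of_int a / of_int b) \<le> 1"
proof (cases "a = 0")
  case False
  have "b \<noteq> 0" using assms(2) by auto
  moreover have "multiplicity (int p) b = 0" using assms(2) by (simp add: not_dvd_imp_multiplicity_0)
  moreover have "real p \<ge> 1" using assms prime_ge_1_nat by auto
  ultimately show ?thesis using assms False
    by (simp add: padic_norm_rat_fraction power_int_minus inverse_le_1_iff)
qed auto

lemma padic_norm_rat_of_int: "prime p \<Longrightarrow> padic_norm_rat p (of_int a) \<le> 1"
  using padic_norm_rat_fraction_le_1[of p 1 a] prime_gt_1_nat[of p] by auto

lemma padic_norm_rat_prime_power:
  assumes "prime p"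
  shows "padic_norm_rat p (of_nat p ^ n) = 1 / real p ^ n"
proof -
  have "multiplicity (int p) (int p ^ n) = n"
    using assms by (simp add: prime_gt_1_nat)
  thus ?thesis using padic_norm_rat_fraction[of p "int p ^ n" 1] assms
    by (auto simp: power_int_minus field_simps)
qed

text \<open>Only p can divide the denominator, so the norm at this single prime decides integrality:
  it forces \<open>p ^ n\<close> to divide c.\<close>

lemma prime_power_fraction_integral:
  assumes "prime p" "padic_norm_rat p (of_int c / of_nat p ^ n) \<le> 1"
  shows "(of_int c / of_nat p ^ n :: rat) \<in> \<int>"
proof (cases "c = 0")
  case False
  have p: "real p > 1" using assms prime_gt_1_nat by auto
  have m: "multiplicity (int p) (int p ^ n) = n"
    using assms by (simp add: prime_gt_1_nat)
  have "real p powi (int n - int (multiplicity (int p) c)) \<le> real p powi 0"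
    using padic_norm_rat_fraction[OF assms(1) False, of "int p ^ n"] assms m by auto
  hence "n \<le> multiplicity (int p) c" using p power_int_strict_increasing[of 0 "int n - int (multiplicity (int p) c)" "real p"]
    by (cases "n \<le> multiplicity (int p) c") auto
  hence "int p ^ n dvd c" by (rule multiplicity_dvd')
  then obtain d where "c = int p ^ n * d" by auto
  thus ?thesis using p by simp
qed auto

text \<open>Integrality is local: a prime divisor of the reduced denominator does not divide the
  numerator, so at that prime the norm exceeds 1.\<close>

lemma rat_integral_iff_norms:
  fixes r :: rat
  shows "r \<in> \<int> \<longleftrightarrow> (\<forall>p. prime p \<longrightarrow> padic_norm_rat p r \<le> 1)"
proof
  assume "\<forall>p. prime p \<longrightarrow> padic_norm_rat p r \<le> 1"
  obtain a b where ab: "quotient_of r = (a, b)" by fastforce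
  have b: "b > 0" using quotient_of_denom_pos[OF ab] .
  have r: "r = of_int a / of_int b" using quotient_of_div[OF ab] .
  have cop: "coprime a b" using quotient_of_coprime[OF ab] .
  have "b = 1"
  proof (rule ccontr)
    assume "b \<noteq> 1"
    hence "nat b \<noteq> 1" using b by auto
    then obtain p where p: "prime p" "p dvd nat b" using prime_factor_nat by blast
    have pb: "int p dvd b" using p(2) b by (simp add: int_dvd_int_iff[symmetric])
    have "\<not> int p dvd a" using cop pb p(1)
      by (metis coprime_common_divisor not_prime_unit prime_nat_int_transfer)
    hence a: "a \<noteq> 0" "multiplicity (int p) a = 0" by (auto simp: not_dvd_imp_multiplicity_0)
    have "multiplicity (int p) b > 0" using pb p b
      by (subst prime_multiplicity_gt_zero_iff) auto
    hence "real p powi int (multiplicity (int p) b) > 1"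
      using prime_gt_1_nat[OF p(1)] by (simp add: power_int_def)
    moreover have "padic_norm_rat p r \<le> 1" using \<open>\<forall>p. _\<close> p by simp
    ultimately show False using padic_norm_rat_fraction[OF p(1) a(1), of b] a b r by simp
  qed
  thus "r \<in> \<int>" using r by simp
qed (auto elim!: Ints_cases simp: padic_norm_rat_of_int)

text \<open>Over the common denominator \<open>p ^ n\<close> the digits become the base p digits of
  the numerator, so exactly the numerators below \<open>p ^ n\<close> occur.\<close>

lemma I_set_eq:
  assumes "prime p"
  shows "I_set p = {of_nat c / of_nat p ^ n | c n. c < p ^ n}"
proof -
  have p: "p > 0" using assms prime_gt_0_nat by blast
  have 1: "\<exists>c<p ^ n. (\<Sum>i=1..n. of_nat (d i) / of_nat p ^ i) = (of_nat c / of_nat p ^ n :: rat)"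
    if "\<forall>i. d i < p" for n and d :: "nat \<Rightarrow> nat"
  proof (induction n)
    case (Suc n)
    then obtain c where c: "c < p ^ n" "(\<Sum>i=1..n. of_nat (d i) / of_nat p ^ i) = (of_nat c / of_nat p ^ n :: rat)"
      by blast
    \<comment> \<open>The new digit is the least significant one: the numerator c becomes
      \<open>p * c + d (Suc n)\<close>.\<close>
    have "p * c + d (Suc n) < p * c + p" using that by simp
    also have "\<dots> = p * Suc c" by simp
    also have "\<dots> \<le> p * p ^ n" using c(1) by (intro mult_left_mono) auto
    finally show ?case using c p
      by (intro exI[of _ "p * c + d (Suc n)"]) (simp add: field_simps)
  qed auto
  have 2: "\<exists>d. (\<forall>i. d i < p) \<and> (\<Sum>i=1..n. of_nat (d i) / of_nat p ^ i) = (of_nat c / of_nat p ^ n :: rat)"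
    if "c < p ^ n" for c n
    using that
  proof (induction n arbitrary: c)
    case 0
    thus ?case using p by (intro exI[of _ "\<lambda>_. 0"]) auto
  next
    case (Suc n)
    \<comment> \<open>Division with remainder by p: \<open>c mod p\<close> is the last digit, and
      the quotient carries the others.\<close>
    have "c div p < p ^ n" using Suc.prems p by (simp add: less_mult_imp_div_less mult.commute)
    then obtain d where d: "\<forall>i. d i < p"
        "(\<Sum>i=1..n. of_nat (d i) / of_nat p ^ i) = (of_nat (c div p) / of_nat p ^ n :: rat)"
      using Suc.IH by blast
    have "of_nat c = (of_nat (p * (c div p) + c mod p) :: rat)" by simp
    hence c: "of_nat c = (of_nat p * of_nat (c div p) + of_nat (c mod p) :: rat)"
      by (simp only: of_nat_add of_nat_mult)
    have "(\<Sum>i=1..n. of_nat ((d(Suc n := c mod p)) i) / of_nat p ^ i)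
      = (\<Sum>i=1..n. of_nat (d i) / of_nat p ^ i :: rat)"
      by (intro sum.cong) auto
    thus ?case using d p c
      by (intro exI[of _ "d(Suc n := c mod p)"]) (auto simp: field_simps simp del: fun_upd_apply, auto)
  qed
  show ?thesis unfolding I_set_def using 1 2 by (auto; metis)
qed

text \<open>The denominator is a power of p, a unit at q; fractional parts taken at different primes
  therefore do not interfere.\<close>

lemma padic_norm_rat_I_set:
  assumes "prime p" "prime q" "p \<noteq> q" "r \<in> I_set p"
  shows "padic_norm_rat q r \<le> 1"
proof -
  obtain c n where r: "r = of_nat c / of_nat p ^ n" using assms I_set_eq by auto
  have "\<not> q dvd p ^ n" using assms by (metis prime_dvd_power primes_dvd_imp_eq)
  hence "\<not> int q dvd int (p ^ n)" using int_dvd_int_iff by blast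
  from padic_norm_rat_fraction_le_1[OF assms(2) this, of "int c"] r show ?thesis by simp
qed

lemma I_set_unit_interval: "prime p \<Longrightarrow> r \<in> I_set p \<Longrightarrow> 0 \<le> r \<and> r < 1"
  using prime_gt_0_nat[of p] by (auto simp: I_set_eq simp flip: of_nat_power)

text \<open>Split the denominator of r as \<open>p ^ n * b'\<close> with b' prime to p. Inverting b'
  modulo \<open>p ^ n\<close> gives c with b' c congruent to a, and then
  \<open>r - c / p ^ n\<close> has denominator b' only.\<close>

lemma I_set_approx:
  assumes "prime p"
  shows "\<exists>t\<in>I_set p. padic_norm_rat p (r - t) \<le> 1"
proof -
  obtain a b where r: "r = of_int a / of_int b" "b \<noteq> 0" by (rule rat_fraction)
  have p: "p > 0" "\<not> is_unit (int p)" using assms prime_gt_1_nat[of p] by auto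
  obtain b' where b': "b = int p ^ multiplicity (int p) b * b'" "\<not> int p dvd b'"
    using multiplicity_decompose'[of b "int p"] r p by auto
  define n where "n = multiplicity (int p) b"
  have "coprime b' (int p ^ n)" using b'(2) assms
    by (intro coprime_power_right_iff[THEN iffD2] disjI1)
      (use prime_imp_coprime[of "int p" b'] in \<open>simp add: coprime_commute\<close>)
  then obtain e where e: "[b' * e = 1] (mod int p ^ n)" using cong_solve_coprime_int by blast
  define c where "c = (a * e) mod (int p ^ n)"
  have "[b' * c = a] (mod int p ^ n)"
  proof -
    have "[b' * c = b' * (a * e)] (mod int p ^ n)" unfolding c_def by (simp add: cong_scalar_left)
    also have "b' * (a * e) = a * (b' * e)" by simp
    also have "[a * (b' * e) = a * 1] (mod int p ^ n)" using e by (rule cong_scalar_left)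
    finally show ?thesis by simp
  qed
  hence "int p ^ n dvd a - b' * c" by (simp add: cong_iff_dvd_diff[symmetric] cong_sym)
  then obtain k where k: "a - b' * c = int p ^ n * k" by (rule dvdE)
  have c: "0 \<le> c" "c < int p ^ n" using p by (auto simp: c_def)
  have "b' \<noteq> 0" using b' r by auto
  have "r - of_nat (nat c) / of_nat p ^ n = of_int (a - b' * c) / of_int (int p ^ n * b')"
    using r(1) b'(1) c p \<open>b' \<noteq> 0\<close> by (simp add: n_def[symmetric] field_simps)
  also have "\<dots> = of_int k / of_int b'" unfolding k using p by simp
  finally have "padic_norm_rat p (r - of_nat (nat c) / of_nat p ^ n) \<le> 1"
    using padic_norm_rat_fraction_le_1[OF assms b'(2)] by simp
  moreover have "nat c < p ^ n" using c by (simp add: nat_less_iff)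
  ultimately show ?thesis using I_set_eq[OF assms] by blast
qed

text \<open>The difference has a power of p as denominator and is p-integral, so it is an integer;
  it lies strictly between -1 and 1.\<close>

lemma I_set_cong_imp_eq:
  assumes "prime p" "r \<in> I_set p" "s \<in> I_set p" "padic_norm_rat p (r - s) \<le> 1"
  shows "r = s"
proof -
  obtain c n where r: "r = of_nat c / of_nat p ^ n" using assms I_set_eq by auto
  obtain d k where s: "s = of_nat d / of_nat p ^ k" using assms I_set_eq by auto
  have p: "p > 0" using assms prime_gt_0_nat by blast
  have eq: "r - s = of_int (int c * int p ^ k - int d * int p ^ n) / of_nat p ^ (n + k)"
    unfolding r s using p by (simp add: power_add diff_divide_distrib)
  have "r - s \<in> \<int>" unfolding eq
    by (rule prime_power_fraction_integral[OF assms(1)]) (use eq assms(4) in simp)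
  then obtain z where z: "r - s = of_int z" by (auto elim: Ints_cases)
  have "of_int z < (1::rat)" "of_int (- z) < (1::rat)"
    using I_set_unit_interval[OF assms(1,2)] I_set_unit_interval[OF assms(1,3)] z
    unfolding of_int_minus by linarith+
  hence "z < 1" "- z < 1" by (simp_all only: of_int_less_1_iff)
  hence "z = 0" by simp
  thus ?thesis using z by simp
qed

lemma padic_approx_rat:
  assumes "prime p" "x \<in> carrier (Qp p)" "e > 0"
  shows "\<exists>r. padic_norm p (x \<ominus>\<^bsub>Qp p\<^esub> of_rat_padic p r) < e"
proof -
  obtain u where u: "padic_Cauchy p u" "x = Cauchy_class p u"
    using Qp_cases[OF assms(1,2)] .
  \<comment> \<open>Half of e, because passing to the limit preserves only the weak
    inequality.\<close>
  obtain N where N: "\<And>m n. m \<ge> N \<Longrightarrow> n \<ge> N \<Longrightarrow> padic_norm_rat p (u m - u n) < e / 2"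
    using u(1) assms(3) unfolding padic_Cauchy_def by (meson half_gt_zero)
  have c: "padic_Cauchy p (\<lambda>n. u n - u N)"
    using padic_Cauchy_add[OF assms(1) u(1), of "\<lambda>_. - u N"] by simp
  have "padic_norm p (Cauchy_class p (\<lambda>n. u n - u N)) \<le> e / 2"
    by (rule LIMSEQ_le_const2[OF padic_norm_Cauchy_class_tendsto[OF assms(1) c]])
      (use N in \<open>auto intro!: exI[of _ N] less_imp_le\<close>)
  hence "padic_norm p (x \<ominus>\<^bsub>Qp p\<^esub> of_rat_padic p (u N)) < e"
    using Qp_minus_coset[OF assms(1) u(1), of "\<lambda>_. u N"] u(2) assms(3)
    by (simp add: of_rat_padic_def)
  thus ?thesis by blast
qed

text \<open>This gives the definite description in \<open>padic_frac\<close> its meaning. For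
  existence, a rational at distance less than 1 from x is exchanged for an element of
  \<open>I_set\<close> that differs from it by a p-adic integer.\<close>

lemma padic_frac_ex1:
  assumes "prime p" "x \<in> carrier (Qp p)"
  shows "\<exists>!r. r \<in> I_set p \<and> x \<ominus>\<^bsub>Qp p\<^esub> of_rat_padic p r \<in> Zp p"
proof -
  interpret Q: cring "Qp p" using Qp_cring[OF assms(1)] .
  obtain r where r: "padic_norm p (x \<ominus>\<^bsub>Qp p\<^esub> of_rat_padic p r) < 1"
    using padic_approx_rat[OF assms] zero_less_one by blast
  obtain t where t: "t \<in> I_set p" "padic_norm_rat p (r - t) \<le> 1" using I_set_approx[OF assms(1)] by blast
  have "(x \<ominus>\<^bsub>Qp p\<^esub> of_rat_padic p r) \<oplus>\<^bsub>Qp p\<^esub> of_rat_padic p (r - t) \<in> Zp p"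
    using r t assms by (intro Zp_add) (auto simp: Zp_def)
  moreover have "(x \<ominus>\<^bsub>Qp p\<^esub> R) \<oplus>\<^bsub>Qp p\<^esub> (R \<ominus>\<^bsub>Qp p\<^esub> T) = x \<ominus>\<^bsub>Qp p\<^esub> T"
    if "R \<in> carrier (Qp p)" "T \<in> carrier (Qp p)" for R T
    using that assms(2) by algebra
  ultimately have ex: "x \<ominus>\<^bsub>Qp p\<^esub> of_rat_padic p t \<in> Zp p"
    using of_rat_padic_diff[OF assms(1)] by simp
  have uni: "s = t" if s: "s \<in> I_set p" "x \<ominus>\<^bsub>Qp p\<^esub> of_rat_padic p s \<in> Zp p" for s
  proof (rule I_set_cong_imp_eq[OF assms(1) s(1) t(1)])
    have "(x \<ominus>\<^bsub>Qp p\<^esub> T) \<ominus>\<^bsub>Qp p\<^esub> (x \<ominus>\<^bsub>Qp p\<^esub> S) = S \<ominus>\<^bsub>Qp p\<^esub> T"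
      if "S \<in> carrier (Qp p)" "T \<in> carrier (Qp p)" for S T
      using that assms(2) by algebra
    hence "of_rat_padic p (s - t) \<in> Zp p"
      using Zp_diff[OF assms(1) ex s(2)] of_rat_padic_diff[OF assms(1)] by simp
    thus "padic_norm_rat p (s - t) \<le> 1" using of_rat_padic_in_Zp_iff[OF assms(1)] by blast
  qed
  show ?thesis using t(1) ex uni by blast
qed

lemma padic_frac:
  assumes "prime p" "x \<in> carrier (Qp p)"
  shows "padic_frac p x \<in> I_set p" "x \<ominus>\<^bsub>Qp p\<^esub> of_rat_padic p (padic_frac p x) \<in> Zp p"
  using theI'[OF padic_frac_ex1[OF assms]] by (simp_all add: padic_frac_def)

lemma padic_frac_eqI:
  assumes "prime p" "x \<in> carrier (Qp p)" "r \<in> I_set p" "x \<ominus>\<^bsub>Qp p\<^esub> of_rat_padic p r \<in> Zp p"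
  shows "padic_frac p x = r"
  unfolding padic_frac_def using the1_equality[OF padic_frac_ex1[OF assms(1,2)]] assms(3,4) by blast

text \<open>Consequently \<open>padic_char\<close> is invariant under translation by
  \<open>Zp\<close>, which makes it locally constant.\<close>

lemma padic_frac_add_Zp:
  assumes "prime p" "x \<in> carrier (Qp p)" "z \<in> Zp p"
  shows "padic_frac p (x \<oplus>\<^bsub>Qp p\<^esub> z) = padic_frac p x"
proof (rule padic_frac_eqI[OF assms(1)])
  interpret Q: cring "Qp p" using Qp_cring[OF assms(1)] .
  have z: "z \<in> carrier (Qp p)" using assms(3) by (rule Zp_carrier)
  show "x \<oplus>\<^bsub>Qp p\<^esub> z \<in> carrier (Qp p)" using assms(2) z by simp
  show "padic_frac p x \<in> I_set p" using padic_frac assms by blast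
  have "(x \<oplus>\<^bsub>Qp p\<^esub> z) \<ominus>\<^bsub>Qp p\<^esub> R = (x \<ominus>\<^bsub>Qp p\<^esub> R) \<oplus>\<^bsub>Qp p\<^esub> z" if "R \<in> carrier (Qp p)" for R
    using that assms(2) z by algebra
  thus "(x \<oplus>\<^bsub>Qp p\<^esub> z) \<ominus>\<^bsub>Qp p\<^esub> of_rat_padic p (padic_frac p x) \<in> Zp p"
    using Zp_add[OF assms(1) padic_frac(2)[OF assms(1,2)] assms(3)] by simp
qed

lemma padic_frac_Zp:
  assumes "prime p" "x \<in> Zp p"
  shows "padic_frac p x = 0"
proof (rule padic_frac_eqI[OF assms(1) Zp_carrier[OF assms(2)]])
  interpret Q: cring "Qp p" using Qp_cring[OF assms(1)] .
  show "0 \<in> I_set p" using I_set_eq[OF assms(1)] by (auto intro!: exI[of _ 0])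
  have "x \<ominus>\<^bsub>Qp p\<^esub> \<zero>\<^bsub>Qp p\<^esub> = x" using Zp_carrier[OF assms(2)] by algebra
  thus "x \<ominus>\<^bsub>Qp p\<^esub> of_rat_padic p 0 \<in> Zp p" using assms by simp
qed

section \<open>Locally constant functions on the p-adic numbers\<close>

lemma padic_norm_triangle:
  assumes "prime p" "x \<in> carrier (Qp p)" "y \<in> carrier (Qp p)" "z \<in> carrier (Qp p)"
  shows "padic_norm p (x \<ominus>\<^bsub>Qp p\<^esub> z)
    \<le> max (padic_norm p (x \<ominus>\<^bsub>Qp p\<^esub> y)) (padic_norm p (y \<ominus>\<^bsub>Qp p\<^esub> z))"
proof -
  interpret Q: cring "Qp p" using Qp_cring[OF assms(1)] .
  have "x \<ominus>\<^bsub>Qp p\<^esub> z = (x \<ominus>\<^bsub>Qp p\<^esub> y) \<oplus>\<^bsub>Qp p\<^esub> (y \<ominus>\<^bsub>Qp p\<^esub> z)"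
    using assms(2-4) by algebra
  thus ?thesis using padic_norm_add[OF assms(1)] assms(2-4) by simp
qed

lemma padic_minus_of_rat_Cauchy_le:
  assumes "prime p" "padic_Cauchy p r" "\<And>m. m \<ge> N \<Longrightarrow> padic_norm_rat p (r n - r m) \<le> e"
  shows "padic_norm p (of_rat_padic p (r n) \<ominus>\<^bsub>Qp p\<^esub> Cauchy_class p r) \<le> e"
proof -
  have c: "padic_Cauchy p (\<lambda>m. r n - r m)"
    using padic_Cauchy_add[OF assms(1) _ padic_Cauchy_uminus[OF assms(2)], of "\<lambda>_. r n"] by simp
  have "padic_norm p (Cauchy_class p (\<lambda>m. r n - r m)) \<le> e"
    by (rule LIMSEQ_le_const2[OF padic_norm_Cauchy_class_tendsto[OF assms(1) c]])
      (use assms(3) in blast)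
  thus ?thesis using Qp_minus_coset[OF assms(1) _ assms(2), of "\<lambda>_. r n"]
    by (simp add: of_rat_padic_def)
qed

text \<open>Each term \<open>s n\<close> is replaced by a rational at distance less than
  \<open>inverse (Suc n)\<close>. These rationals form a p-adic Cauchy sequence, and its class is
  the limit. Completeness is what gives totally bounded sets a compact closure.\<close>

lemma Qp_mcomplete:
  assumes "prime p"
  shows "Metric_space.mcomplete (carrier (Qp p)) (padic_dist p)"
proof -
  interpret Q: cring "Qp p" using Qp_cring[OF assms] .
  interpret M: Metric_space "carrier (Qp p)" "padic_dist p" using padic_metric[OF assms] .
  show ?thesis unfolding M.mcomplete_def
  proof (intro allI impI)
    fix s assume s: "M.MCauchy s"
    hence sc: "s n \<in> carrier (Qp p)" for n by (auto simp: M.MCauchy_def)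
    have "\<exists>r. padic_norm p (s n \<ominus>\<^bsub>Qp p\<^esub> of_rat_padic p r) < inverse (real (Suc n))" for n
      by (rule padic_approx_rat[OF assms sc]) simp
    then obtain r where r: "\<And>n. padic_norm p (s n \<ominus>\<^bsub>Qp p\<^esub> of_rat_padic p (r n)) < inverse (real (Suc n))"
      by metis
    have small: "\<exists>N. \<forall>n\<ge>N. padic_norm p (s n \<ominus>\<^bsub>Qp p\<^esub> of_rat_padic p (r n)) < e" if e: "e > 0" for e
    proof -
      obtain N where N: "inverse (real (Suc N)) < e" using reals_Archimedean[OF e] by auto
      have "padic_norm p (s n \<ominus>\<^bsub>Qp p\<^esub> of_rat_padic p (r n)) < e" if "n \<ge> N" for n
      proof -
        have "inverse (real (Suc n)) \<le> inverse (real (Suc N))" using that by simp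
        with r[of n] N show ?thesis by linarith
      qed
      thus ?thesis by blast
    qed
    have cauchy: "\<exists>N. \<forall>m\<ge>N. \<forall>n\<ge>N. padic_norm_rat p (r m - r n) < e" if e: "e > 0" for e
    proof -
      obtain N1 where N1: "\<And>n. n \<ge> N1 \<Longrightarrow> padic_norm p (s n \<ominus>\<^bsub>Qp p\<^esub> of_rat_padic p (r n)) < e"
        using small[OF e] by blast
      obtain N2 where N2: "\<And>m n. m \<ge> N2 \<Longrightarrow> n \<ge> N2 \<Longrightarrow> padic_norm p (s m \<ominus>\<^bsub>Qp p\<^esub> s n) < e"
        using s e sc unfolding M.MCauchy_def padic_dist_def by fastforce
      have "padic_norm_rat p (r m - r n) < e" if "m \<ge> max N1 N2" "n \<ge> max N1 N2" for m n
      proof -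
        have "padic_norm p (of_rat_padic p (r m) \<ominus>\<^bsub>Qp p\<^esub> s m) < e"
          using N1[of m] that sc padic_norm_minus_commute[OF assms, of "s m"] by simp
        moreover have "padic_norm p (s m \<ominus>\<^bsub>Qp p\<^esub> of_rat_padic p (r n)) < e"
          using padic_norm_triangle[OF assms sc sc, of "of_rat_padic p (r n)" m n] N1[of n] N2[of m n] that
          by simp
        ultimately have "padic_norm p (of_rat_padic p (r m) \<ominus>\<^bsub>Qp p\<^esub> of_rat_padic p (r n)) < e"
          using padic_norm_triangle[OF assms of_rat_padic_carrier sc of_rat_padic_carrier, of "r m" "r n" m]
          by simp
        thus ?thesis by (simp add: of_rat_padic_diff[OF assms, symmetric] assms)
      qed
      thus ?thesis by blast
    qed
    hence rC: "padic_Cauchy p r" by (simp add: padic_Cauchy_def)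
    define x where "x = Cauchy_class p r"
    have x: "x \<in> carrier (Qp p)" using Cauchy_class_carrier[OF rC] by (simp add: x_def)
    have "\<exists>N. \<forall>n\<ge>N. padic_dist p (s n) x < e" if e: "e > 0" for e
    proof -
      obtain N1 where N1: "\<And>n. n \<ge> N1 \<Longrightarrow> padic_norm p (s n \<ominus>\<^bsub>Qp p\<^esub> of_rat_padic p (r n)) < e"
        using small[OF e] by blast
      obtain N2 where N2: "\<And>m n. m \<ge> N2 \<Longrightarrow> n \<ge> N2 \<Longrightarrow> padic_norm_rat p (r m - r n) < e / 2"
        using cauchy[of "e / 2"] e by auto
      have "padic_dist p (s n) x < e" if n: "n \<ge> max N1 N2" for n
      proof -
        have "padic_norm p (of_rat_padic p (r n) \<ominus>\<^bsub>Qp p\<^esub> x) \<le> e / 2"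
          unfolding x_def
          by (rule padic_minus_of_rat_Cauchy_le[OF assms rC, of N2]) (use N2[of n] n in \<open>auto intro: less_imp_le\<close>)
        thus ?thesis using padic_norm_triangle[OF assms sc _ x, of "of_rat_padic p (r n)" n] N1[of n] n e sc x
          by (simp add: padic_dist_def)
      qed
      thus ?thesis by blast
    qed
    thus "\<exists>x. limitin M.mtopology s x sequentially"
      using x sc by (auto simp: M.limitin_metric eventually_sequentially)
  qed
qed

lemma inverse_prime_power_less:
  assumes "prime p" "e > 0"
  shows "\<exists>n. 1 / real p ^ n < e"
  using real_arch_pow_inv[of e "1 / real p"] prime_gt_1_nat[OF assms(1)] assms(2)
  by (auto simp: power_one_over)

text \<open>The ball is a finite union of cosets of the ball of radius \<open>1 / p ^ k\<close>,
  represented by the rationals \<open>z / p ^ n\<close> with 0 \<le> z <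
  \<open>p ^ (n + k)\<close>.\<close>

lemma padic_ball_mtotally_bounded:
  assumes "prime p"
  shows "Metric_space.mtotally_bounded (carrier (Qp p)) (padic_dist p)
    {x \<in> carrier (Qp p). padic_norm p x \<le> real p ^ n}"
proof -
  interpret Q: cring "Qp p" using Qp_cring[OF assms] .
  interpret M: Metric_space "carrier (Qp p)" "padic_dist p" using padic_metric[OF assms] .
  let ?B = "{x \<in> carrier (Qp p). padic_norm p x \<le> real p ^ n}"
  have p: "p > 1" "p > 0" using assms prime_gt_1_nat prime_gt_0_nat by blast+
  show ?thesis unfolding M.mtotally_bounded_def
  proof (intro allI impI)
    fix e :: real assume "e > 0"
    then obtain k where k: "1 / real p ^ k < e" using inverse_prime_power_less[OF assms] by blast
    define R where "R = (\<lambda>z. of_rat_padic p (of_nat p ^ k * (of_int z / of_nat p ^ (n + k)))) ` {0..<int p ^ (n + k)} \<inter> ?B"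
    have "\<exists>y\<in>R. padic_dist p y x < e" if x: "x \<in> ?B" for x
    proof -
      \<comment> \<open>Division by \<open>p ^ k\<close> moves the cut to the position where
        \<open>padic_frac\<close> makes it: the fractional part of \<open>?x\<close>, scaled back,
        is x truncated modulo \<open>p ^ k\<close>.\<close>
      let ?x = "of_rat_padic p (1 / of_nat p ^ k) \<otimes>\<^bsub>Qp p\<^esub> x"
      have xc: "x \<in> carrier (Qp p)" "?x \<in> carrier (Qp p)" using x by auto
      define t where "t = padic_frac p ?x"
      define y where "y = of_rat_padic p (of_nat p ^ k * t)"
      have t: "t \<in> I_set p" "padic_norm p (?x \<ominus>\<^bsub>Qp p\<^esub> of_rat_padic p t) \<le> 1"
        using padic_frac[OF assms xc(2)] by (auto simp: t_def Zp_def)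
      have "of_rat_padic p (of_nat p ^ k) \<otimes>\<^bsub>Qp p\<^esub> ?x = x"
        using xc p x by (simp add: Q.m_assoc[symmetric] of_rat_padic_mult[OF assms, symmetric])
      hence eq: "x \<ominus>\<^bsub>Qp p\<^esub> y = of_rat_padic p (of_nat p ^ k) \<otimes>\<^bsub>Qp p\<^esub> (?x \<ominus>\<^bsub>Qp p\<^esub> of_rat_padic p t)"
        unfolding y_def of_rat_padic_mult[OF assms] a_minus_def using xc
        by (simp add: Q.r_distr Q.r_minus)
      have "padic_norm p (x \<ominus>\<^bsub>Qp p\<^esub> y) = 1 / real p ^ k * padic_norm p (?x \<ominus>\<^bsub>Qp p\<^esub> of_rat_padic p t)"
        unfolding eq using xc by (simp add: padic_norm_mult assms padic_norm_rat_prime_power)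
      also have "\<dots> \<le> 1 / real p ^ k * 1" using t p by (intro mult_left_mono) auto
      finally have d: "padic_norm p (x \<ominus>\<^bsub>Qp p\<^esub> y) \<le> 1 / real p ^ k" by simp
      have yc: "y \<in> carrier (Qp p)" by (simp add: y_def)
      have "1 / real p ^ k \<le> real p ^ n"
      proof -
        have "1 / real p ^ k \<le> 1" using p by simp
        also have "\<dots> \<le> real p ^ n" using p by (intro one_le_power) auto
        finally show ?thesis .
      qed
      moreover have "y = x \<ominus>\<^bsub>Qp p\<^esub> (x \<ominus>\<^bsub>Qp p\<^esub> y)" using xc yc by algebra
      ultimately have yn: "padic_norm p y \<le> real p ^ n"
        using padic_norm_diff[OF assms xc(1), of "x \<ominus>\<^bsub>Qp p\<^esub> y"] d x xc yc by simp
      \<comment> \<open>The bound on y makes \<open>p ^ (n + k) * t\<close> a p-adic integer. As t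
        has a power of p as denominator, the product is an integer z, which exhibits y as one of the
        representatives.\<close>
      have "padic_norm_rat p (of_nat p ^ (n + k) * t) = 1 / real p ^ n * padic_norm p y"
        using assms by (simp add: y_def padic_norm_rat_mult padic_norm_rat_prime_power power_add)
      also have "\<dots> \<le> 1" using yn p by (simp add: field_simps)
      finally have le1: "padic_norm_rat p (of_nat p ^ (n + k) * t) \<le> 1" .
      obtain c l where c: "t = of_nat c / of_nat p ^ l" using t(1) I_set_eq[OF assms] by auto
      have eq: "of_nat p ^ (n + k) * t = of_int (int p ^ (n + k) * int c) / of_nat p ^ l"
        by (simp add: c)
      have "of_nat p ^ (n + k) * t \<in> \<int>"
        unfolding eq by (rule prime_power_fraction_integral[OF assms]) (use le1 eq in simp)
      then obtain z where z: "of_nat p ^ (n + k) * t = of_int z" by (auto elim: Ints_cases)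
      have t01: "0 \<le> t" "t < 1" using I_set_unit_interval[OF assms t(1)] by auto
      have "of_int z \<ge> (0::rat)" unfolding z[symmetric] using t01 by simp
      moreover have "of_int z < (of_int (int p ^ (n + k)) :: rat)"
        unfolding z[symmetric] using t01 p by simp
      ultimately have "z \<in> {0..<int p ^ (n + k)}" by (auto simp only: of_int_less_iff of_int_0_le_iff atLeastLessThan_iff)
      moreover have "t = of_int z / of_nat p ^ (n + k)" using z p by (simp add: field_simps)
      ultimately have "y \<in> R" using yn yc unfolding R_def y_def by blast
      moreover have "padic_dist p y x < e"
        using d k xc yc padic_norm_minus_commute[OF assms xc(1) yc] by (simp add: padic_dist_def)
      ultimately show ?thesis by blast
    qed
    hence "?B \<subseteq> (\<Union>x\<in>R. M.mball x e)" by (fastforce simp: R_def)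
    moreover have "finite R" "R \<subseteq> ?B" by (auto simp: R_def)
    ultimately show "\<exists>K. finite K \<and> K \<subseteq> ?B \<and> ?B \<subseteq> (\<Union>x\<in>K. M.mball x e)" by blast
  qed
qed

text \<open>Functions constant on the cosets of \<open>p ^ n\<close> \<open>Zp\<close> and supported
  in the ball of radius \<open>p ^ n\<close>: the uniform form of a test function, with one exponent
  for both conditions.\<close>

definition step_function :: "nat \<Rightarrow> nat \<Rightarrow> (padic \<Rightarrow> complex) \<Rightarrow> bool" where
  "step_function p n f \<longleftrightarrow>
     (\<forall>x\<in>carrier (Qp p). \<forall>y\<in>carrier (Qp p). padic_norm p (x \<ominus>\<^bsub>Qp p\<^esub> y) \<le> 1 / real p ^ n \<longrightarrow> f x = f y) \<and>
     (\<forall>x\<in>carrier (Qp p). f x \<noteq> 0 \<longrightarrow> padic_norm p x \<le> real p ^ n)"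

text \<open>In an ultrametric space a closed ball contains, with each of its points, the open ball
  of the same radius around that point.\<close>

lemma openin_Qp_ball:
  assumes "prime p" "x \<in> carrier (Qp p)" "r > 0"
  shows "openin (Qp_topology p) {y \<in> carrier (Qp p). padic_norm p (x \<ominus>\<^bsub>Qp p\<^esub> y) \<le> r}"
proof -
  interpret M: Metric_space "carrier (Qp p)" "padic_dist p" using padic_metric[OF assms(1)] .
  show ?thesis unfolding Qp_topology_def M.openin_mtopology
  proof (intro conjI allI impI)
    fix y assume y: "y \<in> {y \<in> carrier (Qp p). padic_norm p (x \<ominus>\<^bsub>Qp p\<^esub> y) \<le> r}"
    have "padic_norm p (x \<ominus>\<^bsub>Qp p\<^esub> z) \<le> r" if "z \<in> M.mball y r" for z
      using padic_norm_triangle[OF assms(1,2), of y z] y that by (auto simp: padic_dist_def)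
    hence "M.mball y r \<subseteq> {y \<in> carrier (Qp p). padic_norm p (x \<ominus>\<^bsub>Qp p\<^esub> y) \<le> r}" by auto
    thus "\<exists>r'>0. M.mball y r' \<subseteq> {y \<in> carrier (Qp p). padic_norm p (x \<ominus>\<^bsub>Qp p\<^esub> y) \<le> r}"
      using assms(3) by blast
  qed auto
qed

text \<open>Balls of radius \<open>1 / p ^ n\<close> are open and witness local constancy. The
  support is totally bounded, so by completeness its closure is compact.\<close>

lemma step_function_imp_test_function:
  assumes "prime p" "step_function p n f"
  shows "f \<in> test_functions p"
proof -
  interpret Q: cring "Qp p" using Qp_cring[OF assms(1)] .
  interpret M: Metric_space "carrier (Qp p)" "padic_dist p" using padic_metric[OF assms(1)] .
  have p: "p > 0" using assms prime_gt_0_nat by blast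
  have "\<exists>U. openin (Qp_topology p) U \<and> x \<in> U \<and> (\<forall>y\<in>U. f y = f x)" if x: "x \<in> carrier (Qp p)" for x
  proof (intro exI conjI ballI)
    let ?U = "{y \<in> carrier (Qp p). padic_norm p (x \<ominus>\<^bsub>Qp p\<^esub> y) \<le> 1 / real p ^ n}"
    show "openin (Qp_topology p) ?U" using openin_Qp_ball[OF assms(1) x] p by simp
    have "x \<ominus>\<^bsub>Qp p\<^esub> x = \<zero>\<^bsub>Qp p\<^esub>" using x by (simp add: Q.r_neg a_minus_def)
    thus "x \<in> ?U" using x assms(1) by simp
    show "f y = f x" if "y \<in> ?U" for y
    proof -
      have "f x = f y" using assms(2) x that unfolding step_function_def by blast
      thus ?thesis by simp
    qed
  qed
  moreover have "M.mtotally_bounded {x \<in> carrier (Qp p). f x \<noteq> 0}"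
    by (rule M.mtotally_bounded_subset[OF padic_ball_mtotally_bounded[OF assms(1), of n]])
      (use assms(2) in \<open>auto simp: step_function_def\<close>)
  hence "compactin (Qp_topology p) ((Qp_topology p) closure_of {x \<in> carrier (Qp p). f x \<noteq> 0})"
    using M.mtotally_bounded_eq_compact_closure_of[OF Qp_mcomplete[OF assms(1)]]
    by (simp add: Qp_topology_def)
  ultimately show ?thesis by (simp add: test_functions_def)
qed

text \<open>Compactness of the support makes both conditions uniform: a Lebesgue number of the cover
  by open sets on which f is constant gives the radius of constancy, and boundedness gives the
  radius of the support.\<close>

lemma test_function_imp_step_function:
  assumes "prime p" "f \<in> test_functions p"
  shows "\<exists>n. step_function p n f"
proof -
  interpret Q: cring "Qp p" using Qp_cring[OF assms(1)] .
  interpret M: Metric_space "carrier (Qp p)" "padic_dist p" using padic_metric[OF assms(1)] .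
  have p: "p > 1" using assms prime_gt_1_nat by blast
  let ?S = "{x \<in> carrier (Qp p). f x \<noteq> 0}"
  define K where "K = (Qp_topology p) closure_of ?S"
  have KS: "?S \<subseteq> K" unfolding K_def Qp_topology_def by (rule closure_of_subset) auto
  have Kc: "compactin M.mtopology K" using assms(2) by (simp add: test_functions_def K_def Qp_topology_def)
  have Kcar: "K \<subseteq> carrier (Qp p)" using compactin_subset_topspace[OF Kc] by simp
  have norm_dist: "padic_dist p \<zero>\<^bsub>Qp p\<^esub> x = padic_norm p x" if "x \<in> carrier (Qp p)" for x
    using that padic_norm_uminus[OF assms(1) that] by (simp add: padic_dist_def a_minus_def)
  obtain B where B: "\<And>x. x \<in> K \<Longrightarrow> padic_norm p x \<le> B"
  proof -
    have "M.mbounded (insert \<zero>\<^bsub>Qp p\<^esub> K)"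
      using M.compactin_imp_mbounded[OF Kc] by (simp add: M.mbounded_insert)
    then obtain B where "\<forall>x\<in>insert \<zero>\<^bsub>Qp p\<^esub> K. \<forall>y\<in>insert \<zero>\<^bsub>Qp p\<^esub> K. padic_dist p x y \<le> B"
      unfolding M.mbounded_alt by blast
    hence dB: "padic_dist p \<zero>\<^bsub>Qp p\<^esub> x \<le> B" if "x \<in> K" for x using that by blast
    have "padic_norm p x \<le> B" if x: "x \<in> K" for x
    proof -
      have "x \<in> carrier (Qp p)" using x Kcar by blast
      from norm_dist[OF this] dB[OF x] show ?thesis by simp
    qed
    thus ?thesis by (rule that)
  qed
  define C where "C = {U. openin M.mtopology U \<and> (\<forall>x\<in>U. \<forall>y\<in>U. f x = f y)}"
  have "K \<subseteq> \<Union> C"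
  proof
    fix x assume "x \<in> K"
    then obtain U where "openin M.mtopology U" "x \<in> U" "\<forall>y\<in>U. f y = f x"
      using assms(2) Kcar unfolding test_functions_def Qp_topology_def by blast
    moreover from this(3) have "\<forall>a\<in>U. \<forall>b\<in>U. f a = f b" by metis
    ultimately show "x \<in> \<Union> C" unfolding C_def by blast
  qed
  moreover have "openin M.mtopology U" if "U \<in> C" for U using that by (simp add: C_def)
  ultimately obtain e where e: "e > 0" "\<And>x. x \<in> K \<Longrightarrow> \<exists>U\<in>C. M.mball x e \<subseteq> U"
    using M.lebesgue_number[OF Kc, of C] by blast
  obtain n1 where n1: "1 / real p ^ n1 < e" using inverse_prime_power_less[OF assms(1) e(1)] by blast
  obtain n2 where n2: "B < real p ^ n2" using real_arch_pow[of "real p" B] p by auto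
  define n where "n = max n1 n2"
  have "real p ^ n1 \<le> real p ^ n" using p by (intro power_increasing) (auto simp: n_def)
  hence "1 / real p ^ n \<le> 1 / real p ^ n1" using p by (simp add: field_simps)
  hence n: "1 / real p ^ n < e" using n1 by simp
  have K_near: "f x = f y" if "x \<in> K" "y \<in> carrier (Qp p)" "padic_norm p (x \<ominus>\<^bsub>Qp p\<^esub> y) \<le> 1 / real p ^ n" for x y
  proof -
    obtain U where U: "U \<in> C" "M.mball x e \<subseteq> U" using e(2) \<open>x \<in> K\<close> by blast
    have "x \<in> carrier (Qp p)" using that(1) Kcar by blast
    moreover from this have "y \<in> M.mball x e" using that(2,3) n by (simp add: padic_dist_def)
    ultimately have "x \<in> M.mball x e" "y \<in> M.mball x e" using e(1) by blast+
    hence "x \<in> U" "y \<in> U" using U(2) by blast+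
    thus ?thesis using U(1) unfolding C_def by blast
  qed
  have "f x = f y" if "x \<in> carrier (Qp p)" "y \<in> carrier (Qp p)"
    "padic_norm p (x \<ominus>\<^bsub>Qp p\<^esub> y) \<le> 1 / real p ^ n" for x y
  proof -
    \<comment> \<open>The Lebesgue number speaks only about points of K; off K the function
      vanishes.\<close>
    consider "x \<in> K" | "y \<in> K" | "x \<notin> K" "y \<notin> K" by blast
    thus ?thesis
    proof cases
      case 2
      thus ?thesis using K_near[of y x] that padic_norm_minus_commute[OF assms(1)] by simp
    next
      case 3
      hence "f x = 0" "f y = 0" using KS that by auto
      thus ?thesis by simp
    qed (use K_near that in blast)
  qed
  moreover have "padic_norm p x \<le> real p ^ n" if "x \<in> carrier (Qp p)" "f x \<noteq> 0" for x
  proof -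
    have "padic_norm p x \<le> real p ^ n2" using B[of x] KS that n2 by force
    also have "\<dots> \<le> real p ^ n" using p by (intro power_increasing) (auto simp: n_def)
    finally show ?thesis .
  qed
  ultimately show ?thesis unfolding step_function_def by blast
qed

section \<open>The ring of finite adeles and its character\<close>

lemma component_carrier [simp]: "prime p \<Longrightarrow> component x p \<in> carrier (Qp p)"
  using component[of x] by (auto simp: PiE_iff)

lemma finite_not_integral: "finite {p. prime p \<and> component x p \<notin> Zp p}"
  using component[of x] by simp

lemma finite_adele_eqI:
  assumes "\<And>p. prime p \<Longrightarrow> component x p = component y p"
  shows "x = y"
proof -
  have "component x p = component y p" for p
    using assms component[of x] component[of y] by (cases "prime p") (auto simp: PiE_iff extensional_def)
  thus ?thesis by (simp add: component_inject[symmetric] fun_eq_iff)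
qed

definition adele :: "(nat \<Rightarrow> padic) \<Rightarrow> finite_adele" where
  "adele c = Abs_finite_adele (\<lambda>p\<in>{p. prime p}. c p)"

lemma component_adele:
  assumes "\<And>p. prime p \<Longrightarrow> c p \<in> carrier (Qp p)" "finite {p. prime p \<and> c p \<notin> Zp p}" "prime q"
  shows "component (adele c) q = c q"
proof -
  have "{p. prime p \<and> (\<lambda>p\<in>{p. prime p}. c p) p \<notin> Zp p} = {p. prime p \<and> c p \<notin> Zp p}" by auto
  hence "(\<lambda>p\<in>{p. prime p}. c p)
    \<in> {x \<in> \<Pi>\<^sub>E p\<in>{p. prime p}. carrier (Qp p). finite {p. prime p \<and> x p \<notin> Zp p}}"
    using assms(1,2) by (intro CollectI conjI) auto
  thus ?thesis using assms(3) by (simp add: adele_def Abs_finite_adele_inverse)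
qed

text \<open>Componentwise operations, extending the given addition. Adeles can then be scaled and
  translated by type class arithmetic, without carriers.\<close>

instantiation finite_adele :: comm_ring_1
begin

definition zero_finite_adele :: finite_adele where
  "0 = adele (\<lambda>p. \<zero>\<^bsub>Qp p\<^esub>)"

definition one_finite_adele :: finite_adele where
  "1 = adele (\<lambda>p. \<one>\<^bsub>Qp p\<^esub>)"

definition uminus_finite_adele :: "finite_adele \<Rightarrow> finite_adele" where
  "- x = adele (\<lambda>p. \<ominus>\<^bsub>Qp p\<^esub> component x p)"

definition minus_finite_adele :: "finite_adele \<Rightarrow> finite_adele \<Rightarrow> finite_adele" where
  "x - y = adele (\<lambda>p. component x p \<ominus>\<^bsub>Qp p\<^esub> component y p)"

definition times_finite_adele :: "finite_adele \<Rightarrow> finite_adele \<Rightarrow> finite_adele" where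
  "x * y = adele (\<lambda>p. component x p \<otimes>\<^bsub>Qp p\<^esub> component y p)"

lemma component_zero: "prime p \<Longrightarrow> component 0 p = \<zero>\<^bsub>Qp p\<^esub>"
  unfolding zero_finite_adele_def
  by (rule component_adele) (simp_all add: Zp_zero Zp_carrier cong: conj_cong)

lemma component_one: "prime p \<Longrightarrow> component 1 p = \<one>\<^bsub>Qp p\<^esub>"
  unfolding one_finite_adele_def
  by (rule component_adele) (simp_all add: Zp_one Zp_carrier cong: conj_cong)

lemma component_uminus: "prime p \<Longrightarrow> component (- x) p = \<ominus>\<^bsub>Qp p\<^esub> component x p"
  unfolding uminus_finite_adele_def
  by (rule component_adele)
    (auto intro: rev_finite_subset[OF finite_not_integral[of x]] simp: cring.cring_simprules(3)[OF Qp_cring] Zp_uminus)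

lemma component_minus:
  "prime p \<Longrightarrow> component (x - y) p = component x p \<ominus>\<^bsub>Qp p\<^esub> component y p"
  unfolding minus_finite_adele_def
  by (rule component_adele)
    (auto intro: rev_finite_subset[OF finite_UnI[OF finite_not_integral[of x] finite_not_integral[of y]]]
      simp: cring.cring_simprules(4)[OF Qp_cring] Zp_diff)

lemma component_times:
  "prime p \<Longrightarrow> component (x * y) p = component x p \<otimes>\<^bsub>Qp p\<^esub> component y p"
  unfolding times_finite_adele_def
  by (rule component_adele)
    (auto intro: rev_finite_subset[OF finite_UnI[OF finite_not_integral[of x] finite_not_integral[of y]]]
      simp: cring.cring_simprules(5)[OF Qp_cring] Zp_mult)

lemmas component_simps = component_plus component_zero component_one component_uminus
  component_minus component_times

instance
proof
  fix x y z :: finite_adele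
  note simps = cring.cring_simprules[OF Qp_cring] component_simps
  show "x + y + z = x + (y + z)" by (rule finite_adele_eqI) (simp add: simps)
  show "x + y = y + x" by (rule finite_adele_eqI) (simp add: simps)
  show "0 + x = x" by (rule finite_adele_eqI) (simp add: simps)
  show "- x + x = 0" by (rule finite_adele_eqI) (simp add: simps)
  show "x - y = x + - y" by (rule finite_adele_eqI) (simp add: component_simps a_minus_def)
  show "x * y * z = x * (y * z)" by (rule finite_adele_eqI) (simp add: simps)
  show "x * y = y * x" by (rule finite_adele_eqI) (simp add: simps)
  show "1 * x = x"
  proof (rule finite_adele_eqI)
    fix p :: nat assume p: "prime p"
    interpret Q: cring "Qp p" using Qp_cring[OF p] .
    show "component (1 * x) p = component x p" using p by (simp add: component_simps)
  qed
  show "(x + y) * z = x * z + y * z" by (rule finite_adele_eqI) (simp add: simps)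
  have p: "prime (2::nat)" by simp
  have "padic_norm 2 (component 0 2) = 0" using p by (simp add: component_zero)
  moreover have "padic_norm 2 (component 1 2) = 1"
    using padic_norm_of_rat[OF p, of 1] p by (simp add: component_one)
  ultimately show "(0::finite_adele) \<noteq> 1" by auto
qed

end

section \<open>Integral adeles and the diagonal embedding of the rationals\<close>

definition Zhat :: "finite_adele set" where
  "Zhat = {x. \<forall>p. prime p \<longrightarrow> component x p \<in> Zp p}"

lemma Zhat_closed [intro]:
  "0 \<in> Zhat" "1 \<in> Zhat" "x \<in> Zhat \<Longrightarrow> - x \<in> Zhat"
  "x \<in> Zhat \<Longrightarrow> y \<in> Zhat \<Longrightarrow> x + y \<in> Zhat" "x \<in> Zhat \<Longrightarrow> y \<in> Zhat \<Longrightarrow> x - y \<in> Zhat"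
  "x \<in> Zhat \<Longrightarrow> y \<in> Zhat \<Longrightarrow> x * y \<in> Zhat"
  by (auto simp: Zhat_def component_simps Zp_zero Zp_one Zp_uminus Zp_add Zp_diff Zp_mult)

definition of_rat_adele :: "rat \<Rightarrow> finite_adele" where
  "of_rat_adele r = adele (\<lambda>p. of_rat_padic p r)"

text \<open>Only the finitely many primes dividing the denominator can spoil integrality, so the
  constant family is an adele.\<close>

lemma component_of_rat_adele:
  assumes "prime p"
  shows "component (of_rat_adele r) p = of_rat_padic p r"
proof -
  obtain a b where r: "r = of_int a / of_int b" "b \<noteq> 0" by (rule rat_fraction)
  have "{p. prime p \<and> of_rat_padic p r \<notin> Zp p} \<subseteq> {p. prime p \<and> p dvd nat \<bar>b\<bar>}"
  proof safe
    fix p assume p: "prime p" "of_rat_padic p r \<notin> Zp p"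
    hence "int p dvd b" using padic_norm_rat_fraction_le_1[OF p(1), of b a] r
      by (auto simp: of_rat_padic_in_Zp_iff)
    thus "p dvd nat \<bar>b\<bar>" by (simp add: int_dvd_int_iff[symmetric])
  qed
  moreover have "finite {p. prime p \<and> p dvd nat \<bar>b\<bar>}"
    by (rule finite_subset[OF _ finite_divisors_nat[of "nat \<bar>b\<bar>"]]) (use r in auto)
  ultimately have "finite {p. prime p \<and> of_rat_padic p r \<notin> Zp p}" by (rule finite_subset)
  thus ?thesis unfolding of_rat_adele_def using assms by (intro component_adele) auto
qed

lemma of_rat_adele_1 [simp]: "of_rat_adele 1 = 1"
  by (rule finite_adele_eqI) (simp add: component_of_rat_adele component_simps)

lemma of_rat_adele_diff: "of_rat_adele (r - s) = of_rat_adele r - of_rat_adele s"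
  by (rule finite_adele_eqI) (simp add: component_of_rat_adele component_simps of_rat_padic_diff)

lemma of_rat_adele_mult: "of_rat_adele (r * s) = of_rat_adele r * of_rat_adele s"
  by (rule finite_adele_eqI) (simp add: component_of_rat_adele component_simps of_rat_padic_mult)

text \<open>This is the injectivity of the map from \<rat>/\<int> to the adeles modulo
  \<open>Zhat\<close>.\<close>

lemma of_rat_adele_in_Zhat_iff: "of_rat_adele r \<in> Zhat \<longleftrightarrow> r \<in> \<int>"
  by (simp add: Zhat_def component_of_rat_adele of_rat_padic_in_Zp_iff rat_integral_iff_norms)

text \<open>Modulo the integers, the inverse of the isomorphism of \<open>\<rat>/\<int>\<close> onto the finite adeles
  modulo \<open>Zhat\<close>.\<close>

definition adele_frac :: "finite_adele \<Rightarrow> rat" where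
  "adele_frac x = (\<Sum>p | prime p \<and> component x p \<notin> Zp p. padic_frac p (component x p))"

lemma padic_norm_rat_sum_le_1:
  assumes "prime q" "finite S" "\<And>p. p \<in> S \<Longrightarrow> padic_norm_rat q (f p) \<le> 1"
  shows "padic_norm_rat q (\<Sum>p\<in>S. f p) \<le> 1"
  using assms(2,3)
proof (induction S rule: finite_induct)
  case (insert p S)
  have "padic_norm_rat q (f p) \<le> 1" "padic_norm_rat q (\<Sum>p\<in>S. f p) \<le> 1"
    using insert by simp_all
  thus ?case using padic_norm_rat_add[OF assms(1), of "f p" "\<Sum>p\<in>S. f p"] insert.hyps by simp
qed auto

text \<open>At q only the fractional part taken at q matters: the other summands have denominators
  prime to q and add up to a q-adic integer.\<close>

lemma adele_minus_frac: "x - of_rat_adele (adele_frac x) \<in> Zhat"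
  unfolding Zhat_def
proof (intro CollectI allI impI)
  fix q :: nat assume q: "prime q"
  interpret Q: cring "Qp q" using Qp_cring[OF q] .
  let ?S = "{p. prime p \<and> component x p \<notin> Zp p}" and ?f = "\<lambda>p. padic_frac p (component x p)"
  define s where "s = (\<Sum>p\<in>?S - {q}. ?f p)"
  \<comment> \<open>If q is not a summation index, its fractional part is 0, so the splitting holds
    in both cases.\<close>
  have split: "adele_frac x = ?f q + s"
  proof (cases "q \<in> ?S")
    case True
    thus ?thesis unfolding adele_frac_def s_def using finite_not_integral by (intro sum.remove)
  next
    case False
    hence "?f q = 0" using q by (simp add: padic_frac_Zp)
    thus ?thesis using False by (simp add: adele_frac_def s_def)
  qed
  have "padic_norm_rat q s \<le> 1" unfolding s_def
    by (rule padic_norm_rat_sum_le_1[OF q])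
      (use padic_norm_rat_I_set[OF _ q _ padic_frac(1)] in \<open>auto simp: finite_not_integral\<close>)
  hence s: "of_rat_padic q s \<in> Zp q" using q by (simp add: of_rat_padic_in_Zp_iff)
  have "X \<ominus>\<^bsub>Qp q\<^esub> (F \<oplus>\<^bsub>Qp q\<^esub> S) = (X \<ominus>\<^bsub>Qp q\<^esub> F) \<ominus>\<^bsub>Qp q\<^esub> S"
    if "X \<in> carrier (Qp q)" "F \<in> carrier (Qp q)" "S \<in> carrier (Qp q)" for X F S
    using that by algebra
  hence "component (x - of_rat_adele (adele_frac x)) q
      = (component x q \<ominus>\<^bsub>Qp q\<^esub> of_rat_padic q (?f q)) \<ominus>\<^bsub>Qp q\<^esub> of_rat_padic q s"
    using q by (simp add: component_simps component_of_rat_adele split of_rat_padic_add)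
  thus "component (x - of_rat_adele (adele_frac x)) q \<in> Zp q"
    using Zp_diff[OF q padic_frac(2)[OF q component_carrier[OF q]] s] by simp
qed

section \<open>The additive character of the finite adeles\<close>

definition adele_char :: "finite_adele \<Rightarrow> complex" where
  "adele_char x = exp (2 * of_real pi * \<i> * of_rat (adele_frac x))"

text \<open>\<open>Prod_any\<close> runs over the exact support, which is rarely known; any finite
  set of primes containing it serves as well.\<close>

lemma prime_prod_eq:
  assumes "finite S" "\<And>p. prime p \<Longrightarrow> p \<notin> S \<Longrightarrow> f p = 1" "\<And>p. p \<in> S \<Longrightarrow> prime p"
  shows "prime_prod f = (\<Prod>p\<in>S. f p)"
proof -
  have "prime_prod f = (\<Prod>p\<in>S. if prime p then f p else 1)"
    unfolding prime_prod_def by (rule Prod_any.expand_superset) (use assms in auto)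
  thus ?thesis using assms(3) by simp
qed

lemma prime_prod_cong:
  assumes "\<And>p. prime p \<Longrightarrow> f p = g p"
  shows "prime_prod f = prime_prod g"
proof -
  have "(\<lambda>p. if prime p then f p else 1) = (\<lambda>p. if prime p then g p else 1)" using assms by auto
  thus ?thesis by (simp only: prime_prod_def)
qed

lemma padic_char_Zp: "prime p \<Longrightarrow> x \<in> Zp p \<Longrightarrow> padic_char p x = 1"
  by (simp add: padic_char_def padic_frac_Zp)

lemma of_rat_sum: "of_rat (\<Sum>a\<in>A. f a) = (\<Sum>a\<in>A. of_rat (f a) :: 'a :: field_char_0)"
  by (induction A rule: infinite_finite_induct) (auto simp: of_rat_add)

lemma prime_prod_padic_char: "prime_prod (\<lambda>p. padic_char p (component x p)) = adele_char x"
proof -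
  let ?S = "{p. prime p \<and> component x p \<notin> Zp p}"
  have "prime_prod (\<lambda>p. padic_char p (component x p)) = (\<Prod>p\<in>?S. padic_char p (component x p))"
    by (rule prime_prod_eq) (auto simp: finite_not_integral padic_char_Zp)
  also have "\<dots> = exp (\<Sum>p\<in>?S. 2 * of_real pi * \<i> * of_rat (padic_frac p (component x p)))"
    by (simp add: exp_sum finite_not_integral padic_char_def)
  also have "\<dots> = adele_char x" by (simp add: adele_char_def adele_frac_def of_rat_sum sum_distrib_left)
  finally show ?thesis .
qed

lemma complex_of_rat_eq: "(of_rat r :: complex) = of_real (of_rat r)"
proof -
  obtain a b where "r = of_int a / of_int b" by (rule rat_fraction)
  thus ?thesis by (simp add: of_rat_divide)
qed

lemma exp_2pi_rat_eq_1_iff: "exp (2 * of_real pi * \<i> * of_rat r) = 1 \<longleftrightarrow> r \<in> \<int>"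
proof
  assume "exp (2 * of_real pi * \<i> * of_rat r) = 1"
  then obtain n where "2 * pi * real_of_rat r = of_int (2 * n) * pi"
    by (auto simp: exp_eq_1 complex_of_rat_eq)
  hence "real_of_rat r = of_int n" by simp
  hence "real_of_rat r = real_of_rat (of_int n)" by simp
  hence "r = of_int n" by (simp only: of_rat_eq_iff)
  thus "r \<in> \<int>" by simp
next
  assume "r \<in> \<int>"
  then obtain n where "r = of_int n" by (auto elim: Ints_cases)
  thus "exp (2 * of_real pi * \<i> * of_rat r) = 1"
    using exp_integer_2pi[of "of_int n"] by (simp add: mult_ac)
qed

text \<open>x agrees with the rational \<open>adele_frac x\<close> modulo \<open>Zhat\<close>, and
  among rationals the exponential is 1 exactly on the integers. That the kernel is no larger than
  \<open>Zhat\<close> is what later makes oscillating integrals vanish.\<close>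

lemma adele_char_eq_1_iff: "adele_char x = 1 \<longleftrightarrow> x \<in> Zhat"
proof -
  let ?t = "of_rat_adele (adele_frac x)"
  have "?t \<in> Zhat \<longleftrightarrow> x \<in> Zhat"
  proof
    assume "?t \<in> Zhat"
    hence "(x - ?t) + ?t \<in> Zhat" using adele_minus_frac by blast
    thus "x \<in> Zhat" by simp
  next
    assume "x \<in> Zhat"
    hence "x - (x - ?t) \<in> Zhat" using adele_minus_frac by blast
    thus "?t \<in> Zhat" by simp
  qed
  thus ?thesis unfolding adele_char_def exp_2pi_rat_eq_1_iff of_rat_adele_in_Zhat_iff .
qed

text \<open>\<open>adele_frac\<close> is additive only up to an integer: the defect is a rational
  whose adele is integral, and the exponential does not see it.\<close>

lemma adele_char_add: "adele_char (x + y) = adele_char x * adele_char y"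
proof -
  let ?d = "adele_frac (x + y) - adele_frac x - adele_frac y"
  have "of_rat_adele ?d = (x - of_rat_adele (adele_frac x)) + (y - of_rat_adele (adele_frac y))
      - (x + y - of_rat_adele (adele_frac (x + y)))"
    by (simp add: of_rat_adele_diff)
  hence "of_rat_adele ?d \<in> Zhat" using adele_minus_frac by (metis Zhat_closed(4,5))
  hence "exp (2 * of_real pi * \<i> * of_rat ?d) = 1"
    by (simp only: exp_2pi_rat_eq_1_iff of_rat_adele_in_Zhat_iff)
  moreover have "adele_char (x + y) = exp (2 * of_real pi * \<i> * of_rat ?d) * (adele_char x * adele_char y)"
    unfolding adele_char_def by (simp add: exp_add[symmetric] of_rat_diff right_diff_distrib)
  ultimately show ?thesis by simp
qed

lemma adele_char_nonzero [simp]: "adele_char x \<noteq> 0"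
  by (simp add: adele_char_def)

lemma adele_char_Zhat: "x \<in> Zhat \<Longrightarrow> adele_char x = 1"
  by (simp add: adele_char_eq_1_iff)

lemma fourier_eq: "fourier \<mu> \<phi> \<xi> = (\<integral>x. adele_char (\<xi> * x) * \<phi> x \<partial>\<mu>)"
proof -
  have "prime_prod (\<lambda>p. padic_char p (component \<xi> p \<otimes>\<^bsub>Qp p\<^esub> component x p)) = adele_char (\<xi> * x)" for x
    unfolding prime_prod_padic_char[symmetric] by (rule prime_prod_cong) (simp add: component_times)
  thus ?thesis by (simp add: fourier_def)
qed

section \<open>Denominators and residues of adeles\<close>

lemma of_rat_adele_inverse_nat:
  "K > 0 \<Longrightarrow> of_rat_adele (of_nat K) * of_rat_adele (1 / of_nat K) = 1"
  "K > 0 \<Longrightarrow> of_rat_adele (1 / of_nat K) * of_rat_adele (of_nat K) = 1"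
  by (simp_all add: of_rat_adele_mult[symmetric])

text \<open>The denominator of the rational \<open>adele_frac x\<close> clears all components at
  once.\<close>

lemma ex_denominator:
  obtains K :: nat where "K > 0" "of_rat_adele (of_nat K) * x \<in> Zhat"
proof -
  let ?t = "adele_frac x"
  obtain a b where ab: "quotient_of ?t = (a, b)" by fastforce
  have b: "b > 0" using quotient_of_denom_pos[OF ab] .
  have t: "?t = of_int a / of_int b" using quotient_of_div[OF ab] .
  have "of_nat (nat b) * ?t = of_int a" using t b by simp
  hence "of_rat_adele (of_nat (nat b) * ?t) \<in> Zhat" by (simp add: of_rat_adele_in_Zhat_iff)
  moreover have "of_rat_adele (of_nat (nat b)) * (x - of_rat_adele ?t) \<in> Zhat"
    using adele_minus_frac[of x] by (rule Zhat_closed(6)[rotated]) (simp add: of_rat_adele_in_Zhat_iff)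
  ultimately have "of_rat_adele (of_nat (nat b)) * (x - of_rat_adele ?t) + of_rat_adele (of_nat (nat b) * ?t) \<in> Zhat"
    by blast
  thus ?thesis using b that[of "nat b"] by (simp add: of_rat_adele_mult algebra_simps)
qed

text \<open>\<open>Zhat\<close> modulo K \<open>Zhat\<close> is \<int> modulo K. For existence, z/K
  is congruent to a rational t modulo \<open>Zhat\<close>; integrality of z makes K t an integer,
  and c is its residue.\<close>

lemma Zhat_residue_ex1:
  assumes "z \<in> Zhat" "K > 0"
  shows "\<exists>!c. c < K \<and> of_rat_adele (1 / of_nat K) * (z - of_rat_adele (of_nat c)) \<in> Zhat"
proof (rule ex_ex1I)
  let ?k = "of_rat_adele (1 / of_nat K)"
  let ?t = "adele_frac (?k * z)"
  have d: "?k * z - of_rat_adele ?t \<in> Zhat" by (rule adele_minus_frac)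
  have "of_rat_adele (of_nat K) * (?k * z - of_rat_adele ?t) \<in> Zhat"
    using d by (rule Zhat_closed(6)[rotated]) (simp add: of_rat_adele_in_Zhat_iff)
  hence "z - of_rat_adele (of_nat K * ?t) \<in> Zhat"
    using of_rat_adele_inverse_nat(1)[OF assms(2)]
    by (simp add: right_diff_distrib mult.assoc[symmetric] of_rat_adele_mult)
  from Zhat_closed(5)[OF assms(1) this] have "of_rat_adele (of_nat K * ?t) \<in> Zhat" by simp
  then obtain n where n: "of_nat K * ?t = of_int n" by (auto simp: of_rat_adele_in_Zhat_iff elim: Ints_cases)
  define c where "c = nat (n mod int K)"
  have c: "int c = n mod int K" "c < K" using assms(2) by (auto simp: c_def nat_less_iff)
  have "of_int n = (of_int (int K * (n div int K) + int c) :: rat)" using c(1) by simp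
  hence "?t - of_nat c / of_nat K = of_int (n div int K)"
    using n assms(2) by (simp add: field_simps)
  hence "of_rat_adele (?t - of_nat c / of_nat K) \<in> Zhat" by (simp add: of_rat_adele_in_Zhat_iff)
  from Zhat_closed(4)[OF d this]
  have "?k * z - of_rat_adele (1 / of_nat K * of_nat c) \<in> Zhat" by (simp add: of_rat_adele_diff)
  hence "?k * (z - of_rat_adele (of_nat c)) \<in> Zhat"
    by (simp only: of_rat_adele_mult right_diff_distrib)
  thus "\<exists>c. c < K \<and> ?k * (z - of_rat_adele (of_nat c)) \<in> Zhat" using c(2) by blast
next
  let ?k = "of_rat_adele (1 / of_nat K)"
  fix c d
  assume c: "c < K \<and> ?k * (z - of_rat_adele (of_nat c)) \<in> Zhat"
    and d: "d < K \<and> ?k * (z - of_rat_adele (of_nat d)) \<in> Zhat"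
  have "?k * (z - of_rat_adele (of_nat d)) - ?k * (z - of_rat_adele (of_nat c)) \<in> Zhat"
    using c d by blast
  hence "of_rat_adele (1 / of_nat K * (of_nat c - of_nat d)) \<in> Zhat"
    by (simp only: of_rat_adele_mult of_rat_adele_diff) (simp add: algebra_simps)
  then obtain n where "1 / of_nat K * (of_nat c - of_nat d) = (of_int n :: rat)"
    by (auto simp only: of_rat_adele_in_Zhat_iff elim: Ints_cases)
  hence "(of_nat c - of_nat d :: rat) = of_int n * of_nat K" using assms(2) by (simp add: field_simps)
  hence "(of_int (int c - int d) :: rat) = of_int (n * int K)" by simp
  hence eq: "int c - int d = n * int K" by (simp only: of_int_eq_iff)
  have "int c mod int K = int d mod int K"
    using eq by (metis add_diff_cancel_right' diff_add_cancel mod_mult_self3)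
  thus "c = d" using c d by simp
qed

section \<open>Integration over the finite adeles\<close>

lemma open_adele_product:
  assumes "\<And>p. prime p \<Longrightarrow> openin (Qp_topology p) (U p)" "finite {p. prime p \<and> U p \<noteq> Zp p}"
  shows "open {x. \<forall>p. prime p \<longrightarrow> component x p \<in> U p}"
  unfolding open_finite_adele_def by (rule generate_topology.Basis) (use assms in blast)

lemma openin_Qp_topology_iff:
  assumes "prime p"
  shows "openin (Qp_topology p) U \<longleftrightarrow> U \<subseteq> carrier (Qp p) \<and>
    (\<forall>x\<in>U. \<exists>r>0. \<forall>y\<in>carrier (Qp p). padic_norm p (x \<ominus>\<^bsub>Qp p\<^esub> y) < r \<longrightarrow> y \<in> U)"
proof -
  interpret M: Metric_space "carrier (Qp p)" "padic_dist p" using padic_metric[OF assms] .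
  have "M.mball x r \<subseteq> U \<longleftrightarrow> (\<forall>y\<in>carrier (Qp p). padic_norm p (x \<ominus>\<^bsub>Qp p\<^esub> y) < r \<longrightarrow> y \<in> U)"
    if "x \<in> carrier (Qp p)" for x r
    using that by (auto simp: subset_iff padic_dist_def)
  thus ?thesis unfolding Qp_topology_def M.openin_mtopology by blast
qed

text \<open>Continuity of translations, needed for their Borel measurability. Preimages respect
  unions and intersections, and a basic set pulls back to a basic set: wherever a is integral, a
  factor \<open>Zp\<close> stays \<open>Zp\<close>.\<close>

lemma open_vimage_translate:
  fixes a :: finite_adele
  assumes "open S"
  shows "open ((+) a -` S)"
proof -
  from assms have "generate_topology {{x. \<forall>p. prime p \<longrightarrow> component x p \<in> U p} | U.
       (\<forall>p. prime p \<longrightarrow> openin (Qp_topology p) (U p)) \<and> finite {p. prime p \<and> U p \<noteq> Zp p}} S"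
    by (simp only: open_finite_adele_def)
  thus ?thesis
  proof induction
    case UNIV
    show ?case by simp
  next
    case (Int S T)
    thus ?case by (simp add: open_Int vimage_Int)
  next
    case (UN K)
    thus ?case unfolding vimage_Union by (intro open_UN) blast
  next
    case (Basis S)
    then obtain U where U: "\<And>p. prime p \<Longrightarrow> openin (Qp_topology p) (U p)" "finite {p. prime p \<and> U p \<noteq> Zp p}"
      and S: "S = {x. \<forall>p. prime p \<longrightarrow> component x p \<in> U p}" by blast
    define V where "V = (\<lambda>p. {y \<in> carrier (Qp p). component a p \<oplus>\<^bsub>Qp p\<^esub> y \<in> U p})"
    have "openin (Qp_topology p) (V p)" if p: "prime p" for p
      unfolding openin_Qp_topology_iff[OF p]
    proof (intro conjI ballI)
      interpret Q: cring "Qp p" using Qp_cring[OF p] .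
      fix y assume y: "y \<in> V p"
      hence yc: "y \<in> carrier (Qp p)" by (simp add: V_def)
      have "component a p \<oplus>\<^bsub>Qp p\<^esub> y \<in> U p" using y by (simp add: V_def)
      then obtain r where r: "r > 0" "\<And>z. z \<in> carrier (Qp p) \<Longrightarrow>
          padic_norm p ((component a p \<oplus>\<^bsub>Qp p\<^esub> y) \<ominus>\<^bsub>Qp p\<^esub> z) < r \<Longrightarrow> z \<in> U p"
        using U(1)[OF p] unfolding openin_Qp_topology_iff[OF p] by blast
      have eq: "(A \<oplus>\<^bsub>Qp p\<^esub> y) \<ominus>\<^bsub>Qp p\<^esub> (A \<oplus>\<^bsub>Qp p\<^esub> z) = y \<ominus>\<^bsub>Qp p\<^esub> z"
        if "z \<in> carrier (Qp p)" "A \<in> carrier (Qp p)" for z A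
        using that yc by algebra
      show "\<exists>r>0. \<forall>z\<in>carrier (Qp p). padic_norm p (y \<ominus>\<^bsub>Qp p\<^esub> z) < r \<longrightarrow> z \<in> V p"
        using r p by (intro exI[of _ r]) (auto simp: V_def eq)
    qed (auto simp: V_def)
    moreover have "V p = Zp p" if p: "prime p" "U p = Zp p" "component a p \<in> Zp p" for p
    proof -
      interpret Q: cring "Qp p" using Qp_cring[OF p(1)] .
      have "(A \<oplus>\<^bsub>Qp p\<^esub> y) \<ominus>\<^bsub>Qp p\<^esub> A = y" if "y \<in> carrier (Qp p)" "A \<in> carrier (Qp p)" for y A
        using that by algebra
      hence "y \<in> Zp p" if "y \<in> V p" for y
        using that p Zp_diff[OF p(1), of "component a p \<oplus>\<^bsub>Qp p\<^esub> y" "component a p"] by (simp add: V_def)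
      moreover have "y \<in> V p" if "y \<in> Zp p" for y
        using that p Zp_add[OF p(1,3)] Zp_carrier by (simp add: V_def)
      ultimately show ?thesis by blast
    qed
    hence "finite {p. prime p \<and> V p \<noteq> Zp p}"
      by (intro rev_finite_subset[OF finite_UnI[OF U(2) finite_not_integral[of a]]]) blast
    ultimately have "open {x. \<forall>p. prime p \<longrightarrow> component x p \<in> V p}" by (rule open_adele_product)
    also have "{x. \<forall>p. prime p \<longrightarrow> component x p \<in> V p} = (+) a -` S"
      by (auto simp: S V_def component_plus)
    finally show ?case .
  qed
qed

text \<open>For invertible s this is the inverse of s times \<open>Zhat\<close>; the defining
  condition multiplies by s, so no inverse has to be named.\<close>

definition adele_lattice :: "finite_adele \<Rightarrow> finite_adele set" where
  "adele_lattice s = {x. s * x \<in> Zhat}"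

text \<open>s and s' are both integral at almost every prime; there s is a unit and the local
  condition is membership in \<open>Zp\<close>, as the restricted product topology demands.\<close>

lemma open_lattice:
  assumes "s * s' = 1"
  shows "open (adele_lattice s)"
proof -
  define U where "U = (\<lambda>p. {y \<in> carrier (Qp p). component s p \<otimes>\<^bsub>Qp p\<^esub> y \<in> Zp p})"
  have "openin (Qp_topology p) (U p)" if p: "prime p" for p
    unfolding openin_Qp_topology_iff[OF p]
  proof (intro conjI ballI)
    interpret Q: cring "Qp p" using Qp_cring[OF p] .
    let ?s = "component s p"
    have sc: "?s \<in> carrier (Qp p)" using p by simp
    fix y assume y: "y \<in> U p"
    \<comment> \<open>Any positive radius whose product with the norm of \<open>?s\<close> is at
      most 1 serves; the summand 1 keeps the denominator positive.\<close>
    define r where "r = 1 / (padic_norm p ?s + 1)"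
    have s0: "padic_norm p ?s \<ge> 0" using padic_norm_nonneg[OF p sc] .
    have "z \<in> U p" if z: "z \<in> carrier (Qp p)" "padic_norm p (y \<ominus>\<^bsub>Qp p\<^esub> z) < r" for z
    proof -
      have yc: "y \<in> carrier (Qp p)" "?s \<otimes>\<^bsub>Qp p\<^esub> y \<in> Zp p" using y by (auto simp: U_def)
      have "padic_norm p (?s \<otimes>\<^bsub>Qp p\<^esub> (y \<ominus>\<^bsub>Qp p\<^esub> z)) = padic_norm p ?s * padic_norm p (y \<ominus>\<^bsub>Qp p\<^esub> z)"
        using p sc yc z by (simp add: padic_norm_mult)
      also have "\<dots> \<le> padic_norm p ?s * r" using s0 z by (intro mult_left_mono) auto
      also have "\<dots> \<le> 1" using s0 by (simp add: r_def field_simps)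
      finally have "?s \<otimes>\<^bsub>Qp p\<^esub> (y \<ominus>\<^bsub>Qp p\<^esub> z) \<in> Zp p" using sc yc z by (simp add: Zp_def)
      from Zp_diff[OF p yc(2) this]
      have "(?s \<otimes>\<^bsub>Qp p\<^esub> y) \<ominus>\<^bsub>Qp p\<^esub> (?s \<otimes>\<^bsub>Qp p\<^esub> (y \<ominus>\<^bsub>Qp p\<^esub> z)) \<in> Zp p" .
      moreover have "(?s \<otimes>\<^bsub>Qp p\<^esub> y) \<ominus>\<^bsub>Qp p\<^esub> (?s \<otimes>\<^bsub>Qp p\<^esub> (y \<ominus>\<^bsub>Qp p\<^esub> z)) = ?s \<otimes>\<^bsub>Qp p\<^esub> z"
        using sc yc(1) z(1) by algebra
      ultimately show ?thesis using z by (simp add: U_def)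
    qed
    moreover have "r > 0" using s0 by (simp add: r_def)
    ultimately show "\<exists>r>0. \<forall>z\<in>carrier (Qp p). padic_norm p (y \<ominus>\<^bsub>Qp p\<^esub> z) < r \<longrightarrow> z \<in> U p" by blast
  qed (auto simp: U_def)
  moreover have "U p = Zp p" if p: "prime p" "component s p \<in> Zp p" "component s' p \<in> Zp p" for p
  proof -
    interpret Q: cring "Qp p" using Qp_cring[OF p(1)] .
    have one: "component s' p \<otimes>\<^bsub>Qp p\<^esub> component s p = \<one>\<^bsub>Qp p\<^esub>"
      using assms p by (metis component_one component_times mult.commute)
    have "y \<in> Zp p" if y: "y \<in> U p" for y
    proof -
      have "component s' p \<otimes>\<^bsub>Qp p\<^esub> (component s p \<otimes>\<^bsub>Qp p\<^esub> y) \<in> Zp p"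
        using y by (intro Zp_mult[OF p(1,3)]) (simp add: U_def)
      moreover have "component s' p \<otimes>\<^bsub>Qp p\<^esub> (component s p \<otimes>\<^bsub>Qp p\<^esub> y) = y"
        using y p by (simp add: U_def Q.m_assoc[symmetric] one)
      ultimately show ?thesis by (simp only:)
    qed
    moreover have "y \<in> U p" if "y \<in> Zp p" for y
      using that p Zp_mult Zp_carrier by (simp add: U_def)
    ultimately show ?thesis by blast
  qed
  hence "finite {p. prime p \<and> U p \<noteq> Zp p}"
    by (intro rev_finite_subset[OF finite_UnI[OF finite_not_integral[of s] finite_not_integral[of s']]]) blast
  ultimately have "open {x. \<forall>p. prime p \<longrightarrow> component x p \<in> U p}" by (rule open_adele_product)
  also have "{x. \<forall>p. prime p \<longrightarrow> component x p \<in> U p} = adele_lattice s"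
    by (auto simp: adele_lattice_def Zhat_def U_def component_times)
  finally show ?thesis .
qed

text \<open>A function on the finite group 1/N \<open>Zhat\<close> modulo N \<open>Zhat\<close>,
  extended by zero. One integer controls period and support, and it may be replaced by a multiple,
  so finite families have a common N.\<close>

definition adelic_step :: "nat \<Rightarrow> (finite_adele \<Rightarrow> complex) \<Rightarrow> bool" where
  "adelic_step N f \<longleftrightarrow> N > 0 \<and>
     (\<forall>x. \<forall>z\<in>Zhat. f (x + of_rat_adele (of_nat N) * z) = f x) \<and>
     (\<forall>x. f x \<noteq> 0 \<longrightarrow> of_rat_adele (of_nat N) * x \<in> Zhat)"

lemma of_rat_adele_nat_mult_Zhat:
  "of_rat_adele (of_nat N) * x \<in> Zhat \<Longrightarrow> of_rat_adele (of_nat (N * K)) * x \<in> Zhat"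
  "of_rat_adele (of_nat N) * x \<in> Zhat \<Longrightarrow> of_rat_adele (of_nat (K * N)) * x \<in> Zhat"
proof -
  assume "of_rat_adele (of_nat N) * x \<in> Zhat"
  hence "of_rat_adele (of_nat K) * (of_rat_adele (of_nat N) * x) \<in> Zhat"
    by (rule Zhat_closed(6)[rotated]) (simp add: of_rat_adele_in_Zhat_iff)
  thus "of_rat_adele (of_nat (N * K)) * x \<in> Zhat" "of_rat_adele (of_nat (K * N)) * x \<in> Zhat"
    by (simp_all add: of_rat_adele_mult mult_ac)
qed

lemma adelic_step_mult_right:
  assumes "adelic_step N f" "K > 0"
  shows "adelic_step (N * K) f"
proof -
  have "f (x + of_rat_adele (of_nat (N * K)) * z) = f x" if "z \<in> Zhat" for x z
  proof -
    have "of_rat_adele (of_nat K) * z \<in> Zhat"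
      using that by (rule Zhat_closed(6)[rotated]) (simp add: of_rat_adele_in_Zhat_iff)
    hence "f (x + of_rat_adele (of_nat N) * (of_rat_adele (of_nat K) * z)) = f x"
      using assms(1) unfolding adelic_step_def by blast
    thus ?thesis by (simp add: of_rat_adele_mult mult_ac)
  qed
  thus ?thesis using assms of_rat_adele_nat_mult_Zhat(1) unfolding adelic_step_def by auto
qed

lemma adelic_step_common:
  assumes "finite A" "\<And>a. a \<in> A \<Longrightarrow> \<exists>N. adelic_step N (f a)"
  shows "\<exists>N>0. \<forall>a\<in>A. adelic_step N (f a)"
  using assms
proof (induction A rule: finite_induct)
  case (insert a A)
  then obtain N where N: "N > 0" "\<And>b. b \<in> A \<Longrightarrow> adelic_step N (f b)" by blast
  obtain K where K: "adelic_step K (f a)" using insert.prems by blast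
  hence "K > 0" by (simp add: adelic_step_def)
  have "adelic_step (K * N) (f b)" if "b \<in> insert a A" for b
  proof (cases "b = a")
    case True
    show ?thesis using adelic_step_mult_right[OF K N(1)] unfolding True .
  next
    case False
    hence "adelic_step N (f b)" using N(2) that by blast
    from adelic_step_mult_right[OF this \<open>K > 0\<close>] show ?thesis by (simp only: mult.commute)
  qed
  thus ?case using N(1) \<open>K > 0\<close> by (intro exI[of _ "K * N"]) simp
qed auto

lemma adelic_step_sum:
  assumes "finite A" "\<And>a. a \<in> A \<Longrightarrow> \<exists>N. adelic_step N (f a)"
  shows "\<exists>N. adelic_step N (\<lambda>x. \<Sum>a\<in>A. c a * f a x)"
proof -
  obtain N where N: "N > 0" "\<And>a. a \<in> A \<Longrightarrow> adelic_step N (f a)"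
    using adelic_step_common[of A f, OF assms] by metis
  have "(\<Sum>a\<in>A. c a * f a (x + of_rat_adele (of_nat N) * z)) = (\<Sum>a\<in>A. c a * f a x)"
    if z: "z \<in> Zhat" for x z
  proof (rule sum.cong[OF refl])
    fix a assume "a \<in> A"
    hence "f a (x + of_rat_adele (of_nat N) * z) = f a x"
      using N(2) z unfolding adelic_step_def by blast
    thus "c a * f a (x + of_rat_adele (of_nat N) * z) = c a * f a x" by (rule arg_cong)
  qed
  moreover have "of_rat_adele (of_nat N) * x \<in> Zhat" if nz: "(\<Sum>a\<in>A. c a * f a x) \<noteq> 0" for x
  proof -
    obtain a where a: "a \<in> A" "c a * f a x \<noteq> 0"
      using nz by (rule sum.not_neutral_contains_not_neutral)
    hence "f a x \<noteq> 0" by force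
    thus ?thesis using N(2)[OF a(1)] unfolding adelic_step_def by blast
  qed
  ultimately have "adelic_step N (\<lambda>x. \<Sum>a\<in>A. c a * f a x)"
    using N(1) by (simp add: adelic_step_def)
  thus ?thesis ..
qed

text \<open>The function h of the overview. With \<kappa> = 0 it is the indicator of the coset of
  \<open>adele_lattice s\<close> around a.\<close>

definition adelic_wave ::
    "finite_adele \<Rightarrow> finite_adele \<Rightarrow> finite_adele \<Rightarrow> finite_adele \<Rightarrow> complex" where
  "adelic_wave \<kappa> a s x = adele_char (\<kappa> * (x - a)) * indicator Zhat (s * (x - a))"

text \<open>If K clears the denominators of \<xi>, the character has period K \<open>Zhat\<close>,
  and multiplying by it does not enlarge the support. So the integrands of \<open>fourier\<close>
  are again step functions.\<close>

lemma adelic_step_char_mult: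
  assumes "adelic_step N f"
  shows "\<exists>N. adelic_step N (\<lambda>x. adele_char (\<xi> * x) * f x)"
proof -
  obtain K where K: "K > 0" "of_rat_adele (of_nat K) * \<xi> \<in> Zhat" by (rule ex_denominator)
  have st: "adelic_step (N * K) f" using adelic_step_mult_right[OF assms K(1)] .
  have "adele_char (\<xi> * (x + of_rat_adele (of_nat (N * K)) * z)) = adele_char (\<xi> * x)" if "z \<in> Zhat" for x z
  proof -
    have "of_rat_adele (of_nat (N * K)) * \<xi> * z \<in> Zhat"
      using of_rat_adele_nat_mult_Zhat(2)[OF K(2)] that by blast
    thus ?thesis by (simp add: distrib_left adele_char_add adele_char_Zhat mult_ac)
  qed
  hence "adelic_step (N * K) (\<lambda>x. adele_char (\<xi> * x) * f x)" using st unfolding adelic_step_def by auto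
  thus ?thesis by blast
qed

lemma Zhat_add_iff: "z \<in> Zhat \<Longrightarrow> x + z \<in> Zhat \<longleftrightarrow> x \<in> Zhat"
  by (metis Zhat_closed(4,5) add_diff_cancel_right')

text \<open>N is a common denominator of \<kappa>, a, s and s'. Integrality of N \<kappa> and N s
  gives the period; integrality of N s' and N a bounds the support.\<close>

lemma adelic_step_wave:
  assumes "s * s' = 1"
  shows "\<exists>N. adelic_step N (adelic_wave \<kappa> a s)"
proof -
  obtain K1 where K1: "K1 > 0" "of_rat_adele (of_nat K1) * \<kappa> \<in> Zhat" by (rule ex_denominator)
  obtain K2 where K2: "K2 > 0" "of_rat_adele (of_nat K2) * a \<in> Zhat" by (rule ex_denominator)
  obtain K3 where K3: "K3 > 0" "of_rat_adele (of_nat K3) * s \<in> Zhat" by (rule ex_denominator)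
  obtain K4 where K4: "K4 > 0" "of_rat_adele (of_nat K4) * s' \<in> Zhat" by (rule ex_denominator)
  define N where "N = (K1 * K2) * (K3 * K4)"
  let ?N = "of_rat_adele (of_nat N)"
  have N: "N > 0" "?N * \<kappa> \<in> Zhat" "?N * a \<in> Zhat" "?N * s \<in> Zhat" "?N * s' \<in> Zhat"
  proof -
    note l = of_rat_adele_nat_mult_Zhat(1) and r = of_rat_adele_nat_mult_Zhat(2)
    show "N > 0" using K1 K2 K3 K4 by (simp add: N_def)
    show "?N * \<kappa> \<in> Zhat" unfolding N_def by (rule l, rule l, rule K1)
    show "?N * a \<in> Zhat" unfolding N_def by (rule l, rule r, rule K2)
    show "?N * s \<in> Zhat" unfolding N_def by (rule r, rule l, rule K3)
    show "?N * s' \<in> Zhat" unfolding N_def by (rule r, rule r, rule K4)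
  qed
  have "adelic_step N (adelic_wave \<kappa> a s)"
    unfolding adelic_step_def
  proof (intro conjI allI ballI impI)
    fix x z assume z: "z \<in> Zhat"
    have "?N * \<kappa> * z \<in> Zhat" "?N * s * z \<in> Zhat" using N z by blast+
    moreover have "\<kappa> * (x + ?N * z - a) = \<kappa> * (x - a) + ?N * \<kappa> * z"
      "s * (x + ?N * z - a) = s * (x - a) + ?N * s * z" by (simp_all add: algebra_simps)
    ultimately show "adelic_wave \<kappa> a s (x + ?N * z) = adelic_wave \<kappa> a s x"
      by (simp add: adelic_wave_def adele_char_add adele_char_Zhat indicator_def Zhat_add_iff)
  next
    fix x assume "adelic_wave \<kappa> a s x \<noteq> 0"
    hence "s * (x - a) \<in> Zhat" by (auto simp: adelic_wave_def indicator_def split: if_splits)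
    hence "(?N * s') * (s * (x - a)) + ?N * a \<in> Zhat" using N by blast
    moreover have "(?N * s') * (s * (x - a)) = ?N * ((s * s') * (x - a))" by (simp add: mult_ac)
    ultimately show "?N * x \<in> Zhat" unfolding assms by (simp add: algebra_simps)
  qed (rule N)
  thus ?thesis by blast
qed

text \<open>The fractions c/N with c < \<open>N * N\<close> represent 1/N \<open>Zhat\<close> modulo
  N \<open>Zhat\<close>, and f is the sum of the indicators of these cosets weighted by its values
  there.\<close>

lemma adelic_step_expand:
  assumes "adelic_step N f"
  shows "f x = (\<Sum>c<N * N. f (of_rat_adele (of_nat c / of_nat N)) *
    adelic_wave 0 (of_rat_adele (of_nat c / of_nat N)) (of_rat_adele (1 / of_nat N)) x)"
proof -
  let ?a = "\<lambda>c. of_rat_adele (of_nat c / of_nat N)" and ?N = "of_rat_adele (of_nat N)"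
    and ?M = "of_rat_adele (1 / of_nat N)"
  have N: "N > 0" using assms by (simp add: adelic_step_def)
  have summand: "f (?a c) * adelic_wave 0 (?a c) ?M x = f x * indicator Zhat (?M * (x - ?a c))" for c
  proof (cases "?M * (x - ?a c) \<in> Zhat")
    case True
    have "f (?a c + ?N * (?M * (x - ?a c))) = f (?a c)" using assms True unfolding adelic_step_def by blast
    moreover have "?a c + ?N * (?M * (x - ?a c)) = x"
      by (simp add: mult.assoc[symmetric] of_rat_adele_inverse_nat[OF N])
    ultimately have "f x = f (?a c)" by (simp only:)
    thus ?thesis using True by (simp add: adelic_wave_def adele_char_Zhat Zhat_closed(1))
  qed (simp add: adelic_wave_def)
  have "f x = f x * (\<Sum>c<N * N. indicator Zhat (?M * (x - ?a c)))"
  proof (cases "f x = 0")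
    case False
    hence "?N * x \<in> Zhat" using assms unfolding adelic_step_def by blast
    moreover have "N * N > 0" using N by simp
    \<comment> \<open>Residues of the integral adele N x modulo \<open>N * N\<close>; division by N
      turns the residue c into the coset c/N + N \<open>Zhat\<close> containing x.\<close>
    ultimately have ex: "\<exists>!c. c < N * N \<and> of_rat_adele (1 / of_nat (N * N)) * (?N * x - of_rat_adele (of_nat c)) \<in> Zhat"
      by (rule Zhat_residue_ex1)
    have "of_rat_adele (1 / of_nat (N * N)) * (?N * x - of_rat_adele (of_nat c)) = ?M * (x - ?a c)" for c
    proof -
      have M: "of_rat_adele (1 / of_nat (N * N)) = ?M * ?M" by (simp add: of_rat_adele_mult[symmetric])
      have c: "of_rat_adele (of_nat c) = ?N * ?a c" using N by (simp add: of_rat_adele_mult[symmetric])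
      have "?M * ?M * (?N * x - ?N * ?a c) = (?M * ?N) * (?M * (x - ?a c))" by (simp add: algebra_simps)
      thus ?thesis unfolding M c by (simp add: of_rat_adele_inverse_nat[OF N])
    qed
    hence "\<exists>!c. c < N * N \<and> ?M * (x - ?a c) \<in> Zhat"
      using ex by (simp only:)
    then obtain c where c: "c < N * N" "?M * (x - ?a c) \<in> Zhat"
        "\<And>d. d < N * N \<Longrightarrow> ?M * (x - ?a d) \<in> Zhat \<Longrightarrow> d = c" by blast
    have "(\<Sum>d<N * N. indicator Zhat (?M * (x - ?a d))) = (\<Sum>d<N * N. if d = c then 1 else 0 :: complex)"
    proof (rule sum.cong[OF refl])
      fix d assume "d \<in> {..<N * N}"
      hence "?M * (x - ?a d) \<in> Zhat \<longleftrightarrow> d = c" using c(2,3) by blast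
      thus "indicator Zhat (?M * (x - ?a d)) = (if d = c then 1 else 0 :: complex)"
        by (simp only: indicator_def of_bool_def)
    qed
    also have "\<dots> = 1" using c(1) by simp
    finally show ?thesis by simp
  qed simp
  also have "\<dots> = (\<Sum>c<N * N. f (?a c) * adelic_wave 0 (?a c) ?M x)"
    unfolding summand by (simp add: sum_distrib_left)
  finally show ?thesis .
qed

section \<open>Consequences of the translation invariance of the measure\<close>

locale Haar =
  fixes \<mu> :: "finite_adele measure"
  assumes Haar: "normalized_Haar \<mu>"
begin

lemma sets_eq [measurable_cong, simp]: "sets \<mu> = sets borel"
  using Haar by (simp add: normalized_Haar_def)

lemma space_eq [simp]: "space \<mu> = UNIV"
  using sets_eq_imp_space_eq[OF sets_eq] by simp

lemma open_sets: "open S \<Longrightarrow> S \<in> sets \<mu>"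
  by simp

lemma emeasure_translate: "A \<in> sets \<mu> \<Longrightarrow> emeasure \<mu> ((+) a ` A) = emeasure \<mu> A"
  using Haar unfolding normalized_Haar_def by blast

lemma emeasure_Zhat: "emeasure \<mu> Zhat = 1"
  using Haar by (simp add: normalized_Haar_def Zhat_def)

lemma translate_measurable: "(+) a \<in> measurable \<mu> \<mu>"
proof -
  have "(+) a \<in> borel_measurable \<mu>"
    by (rule borel_measurableI) (simp add: open_vimage_translate)
  thus ?thesis by (simp cong: measurable_cong_sets)
qed

lemma image_translate: "(+) a ` A = (+) (- a) -` (A :: finite_adele set)"
proof safe
  fix x assume "- a + x \<in> A"
  thus "x \<in> (+) a ` A" by (intro image_eqI[of _ _ "- a + x"]) auto
qed auto

lemma image_translate_sets: "A \<in> sets \<mu> \<Longrightarrow> (+) a ` A \<in> sets \<mu>"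
  using measurable_sets[OF translate_measurable, of A "- a"] by (simp add: image_translate)

lemma distr_translate: "distr \<mu> \<mu> ((+) a) = \<mu>"
proof (rule measure_eqI)
  fix A assume "A \<in> sets (distr \<mu> \<mu> ((+) a))"
  hence A: "A \<in> sets \<mu>" by simp
  have "emeasure (distr \<mu> \<mu> ((+) a)) A = emeasure \<mu> ((+) (- a) ` A)"
    using emeasure_distr[OF translate_measurable A] unfolding image_translate by simp
  thus "emeasure (distr \<mu> \<mu> ((+) a)) A = emeasure \<mu> A" using emeasure_translate[OF A, of "- a"] by (simp only:)
qed simp

lemma integral_translate:
  fixes f :: "finite_adele \<Rightarrow> complex"
  assumes "f \<in> borel_measurable \<mu>"
  shows "(\<integral>x. f (a + x) \<partial>\<mu>) = (\<integral>x. f x \<partial>\<mu>)"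
  using integral_distr[OF translate_measurable assms, of a] by (simp add: distr_translate)

text \<open>Subadditivity suffices for both bounds on lattice measures: A = \<open>Zhat\<close>
  gives finiteness and B = \<open>Zhat\<close> gives positivity.\<close>

lemma emeasure_le_translates:
  assumes "A \<in> sets \<mu>" "B \<subseteq> (\<Union>c<K. (+) (t c) ` A)"
  shows "emeasure \<mu> B \<le> of_nat K * emeasure \<mu> A"
proof -
  have "emeasure \<mu> B \<le> emeasure \<mu> (\<Union>c<K. (+) (t c) ` A)"
    using assms image_translate_sets by (intro emeasure_mono) auto
  also have "\<dots> \<le> (\<Sum>c<K. emeasure \<mu> ((+) (t c) ` A))"
    using assms image_translate_sets by (intro emeasure_subadditive_finite) auto
  also have "\<dots> = of_nat K * emeasure \<mu> A" using emeasure_translate[OF assms(1)] by simp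
  finally show ?thesis .
qed

lemma lattice_sets: "s * s' = 1 \<Longrightarrow> adele_lattice s \<in> sets \<mu>"
  using open_lattice open_sets by blast

lemma Zhat_sets: "Zhat \<in> sets \<mu>"
  using lattice_sets[of 1 1] by (simp add: adele_lattice_def)

text \<open>If K clears the denominators of s', the lattice lies in 1/K \<open>Zhat\<close>, which K
  translates of \<open>Zhat\<close> cover.\<close>

lemma emeasure_lattice_finite:
  assumes "s * s' = 1"
  shows "emeasure \<mu> (adele_lattice s) < \<infinity>"
proof -
  obtain K where K: "K > 0" "of_rat_adele (of_nat K) * s' \<in> Zhat" by (rule ex_denominator)
  let ?K = "of_rat_adele (of_nat K)"
  have "adele_lattice s \<subseteq> (\<Union>c<K. (+) (of_rat_adele (1 / of_nat K) * of_rat_adele (of_nat c)) ` Zhat)"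
  proof
    fix x assume "x \<in> adele_lattice s"
    hence "(?K * s') * (s * x) \<in> Zhat" using K by (auto simp: adele_lattice_def)
    moreover have "(?K * s') * (s * x) = ?K * (s * s') * x" by (simp add: mult_ac)
    ultimately have "?K * x \<in> Zhat" by (simp add: assms)
    from ex1_implies_ex[OF Zhat_residue_ex1[OF this K(1)]] obtain c where
      c: "c < K" "of_rat_adele (1 / of_nat K) * (?K * x - of_rat_adele (of_nat c)) \<in> Zhat" by blast
    hence "x - of_rat_adele (1 / of_nat K) * of_rat_adele (of_nat c) \<in> Zhat"
      by (simp add: right_diff_distrib mult.assoc[symmetric] of_rat_adele_inverse_nat[OF K(1)])
    thus "x \<in> (\<Union>c<K. (+) (of_rat_adele (1 / of_nat K) * of_rat_adele (of_nat c)) ` Zhat)"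
      using c(1) by (auto simp: image_translate)
  qed
  from emeasure_le_translates[OF Zhat_sets this] have "emeasure \<mu> (adele_lattice s) \<le> of_nat K"
    by (simp add: emeasure_Zhat)
  also have "\<dots> < \<infinity>" by (simp add: of_nat_less_top)
  finally show ?thesis .
qed

text \<open>Conversely, if K clears the denominators of s, the lattice contains K
  \<open>Zhat\<close>, so K of its translates cover \<open>Zhat\<close>, a set of measure 1.\<close>

lemma measure_lattice_pos:
  assumes "s * s' = 1"
  shows "measure \<mu> (adele_lattice s) > 0"
proof -
  obtain K where K: "K > 0" "of_rat_adele (of_nat K) * s \<in> Zhat" by (rule ex_denominator)
  let ?K = "of_rat_adele (of_nat K)"
  have "Zhat \<subseteq> (\<Union>c<K. (+) (of_rat_adele (of_nat c)) ` adele_lattice s)"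
  proof
    fix x assume "x \<in> Zhat"
    from ex1_implies_ex[OF Zhat_residue_ex1[OF this K(1)]] obtain c where
      c: "c < K" "of_rat_adele (1 / of_nat K) * (x - of_rat_adele (of_nat c)) \<in> Zhat" by blast
    hence "(?K * s) * (of_rat_adele (1 / of_nat K) * (x - of_rat_adele (of_nat c))) \<in> Zhat"
      using K by blast
    moreover have "(?K * s) * (of_rat_adele (1 / of_nat K) * (x - of_rat_adele (of_nat c)))
      = (?K * of_rat_adele (1 / of_nat K)) * (s * (x - of_rat_adele (of_nat c)))" by (simp add: mult_ac)
    ultimately have "s * (x - of_rat_adele (of_nat c)) \<in> Zhat"
      by (simp add: of_rat_adele_inverse_nat[OF K(1)])
    thus "x \<in> (\<Union>c<K. (+) (of_rat_adele (of_nat c)) ` adele_lattice s)"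
      using c(1) by (auto simp: image_translate adele_lattice_def)
  qed
  from emeasure_le_translates[OF lattice_sets[OF assms] this]
  have "emeasure \<mu> (adele_lattice s) \<noteq> 0" by (auto simp: emeasure_Zhat)
  moreover have "emeasure \<mu> (adele_lattice s) \<noteq> \<infinity>" using emeasure_lattice_finite[OF assms] by simp
  ultimately show ?thesis by (simp add: measure_def enn2real_positive_iff less_top zero_less_iff_neq_zero)
qed

text \<open>By periodicity f is locally constant, so the preimage of every set whatsoever is
  open.\<close>

lemma adelic_step_measurable:
  assumes "adelic_step N f"
  shows "f \<in> borel_measurable \<mu>"
proof (rule borel_measurableI)
  fix S :: "complex set"
  let ?M = "of_rat_adele (1 / of_nat N)" and ?N = "of_rat_adele (of_nat N)"
  have N: "N > 0" using assms by (simp add: adelic_step_def)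
  have "open (f -` S)"
  proof (rule Topological_Spaces.openI)
    fix x assume x: "x \<in> f -` S"
    have "open ((+) (- x) -` adele_lattice ?M)"
      by (rule open_vimage_translate[OF open_lattice]) (rule of_rat_adele_inverse_nat[OF N])
    moreover have "x \<in> (+) (- x) -` adele_lattice ?M" by (simp add: adele_lattice_def Zhat_closed(1))
    moreover have "(+) (- x) -` adele_lattice ?M \<subseteq> f -` S"
    proof
      fix y assume "y \<in> (+) (- x) -` adele_lattice ?M"
      hence "?M * (y - x) \<in> Zhat" by (simp add: adele_lattice_def)
      hence "f (x + ?N * (?M * (y - x))) = f x" using assms unfolding adelic_step_def by blast
      moreover have "x + ?N * (?M * (y - x)) = y"
        by (simp add: mult.assoc[symmetric] of_rat_adele_inverse_nat[OF N])
      ultimately show "y \<in> f -` S" using x by simp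
    qed
    ultimately show "\<exists>T. open T \<and> x \<in> T \<and> T \<subseteq> f -` S" by blast
  qed
  thus "f -` S \<inter> space \<mu> \<in> sets \<mu>" by simp
qed

lemma wave_0_integrable:
  assumes "s * s' = 1"
  shows "integrable \<mu> (adelic_wave 0 a s)"
proof -
  have eq: "adelic_wave 0 a s = indicator ((+) a ` adele_lattice s)"
    by (auto simp: adelic_wave_def adele_char_Zhat Zhat_closed(1) image_translate adele_lattice_def indicator_def
        fun_eq_iff)
  have "emeasure \<mu> ((+) a ` adele_lattice s) < \<infinity>"
    using emeasure_translate[OF lattice_sets[OF assms]] emeasure_lattice_finite[OF assms] by simp
  thus ?thesis unfolding eq using image_translate_sets[OF lattice_sets[OF assms]]
    by (intro integrable_real_indicator[THEN integrable_of_real, where 'a = complex, simplified of_real_indicator]) auto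
qed

lemma adelic_step_integrable:
  assumes "adelic_step N f"
  shows "integrable \<mu> f"
proof -
  have N: "N > 0" using assms by (simp add: adelic_step_def)
  have "integrable \<mu> (\<lambda>x. \<Sum>c<N * N. f (of_rat_adele (of_nat c / of_nat N)) *
    adelic_wave 0 (of_rat_adele (of_nat c / of_nat N)) (of_rat_adele (1 / of_nat N)) x)"
    by (intro Bochner_Integration.integrable_sum integrable_mult_right)
      (rule wave_0_integrable[OF of_rat_adele_inverse_nat(2)[OF N]])
  thus ?thesis by (simp only: adelic_step_expand[OF assms, symmetric])
qed

text \<open>Orthogonality of characters on the lattice. Triviality of the character is decided at
  the one lattice element s', because the kernel of \<open>adele_char\<close> is exactly
  \<open>Zhat\<close>.\<close>

lemma integral_char_lattice:
  assumes "s * s' = 1"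
  shows "(\<integral>u. adele_char (\<eta> * u) * indicator Zhat (s * u) \<partial>\<mu>)
    = of_real (measure \<mu> (adele_lattice s)) * indicator Zhat (s' * \<eta>)"
proof (cases "s' * \<eta> \<in> Zhat")
  case True
  have "adele_char (\<eta> * u) * indicator Zhat (s * u) = (indicator (adele_lattice s) u :: complex)" for u
  proof (cases "s * u \<in> Zhat")
    case True
    hence "(s' * \<eta>) * (s * u) \<in> Zhat" using \<open>s' * \<eta> \<in> Zhat\<close> by blast
    moreover have "(s' * \<eta>) * (s * u) = (s * s') * (\<eta> * u)" by (simp add: mult_ac)
    ultimately show ?thesis using True by (simp add: assms adele_char_Zhat adele_lattice_def)
  qed (simp add: adele_lattice_def)
  hence "(\<integral>u. adele_char (\<eta> * u) * indicator Zhat (s * u) \<partial>\<mu>) = (\<integral>u. indicator (adele_lattice s) u *\<^sub>R 1 \<partial>\<mu>)"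
    by (intro Bochner_Integration.integral_cong) (auto simp: indicator_def)
  thus ?thesis using True lattice_sets[OF assms] emeasure_lattice_finite[OF assms]
    by (simp add: scaleR_conv_of_real)
next
  case False
  define f where "f u = adele_char (\<eta> * u) * (indicator Zhat (s * u) :: complex)" for u
  have "f = adelic_wave \<eta> 0 s" by (simp add: fun_eq_iff f_def adelic_wave_def)
  hence "f \<in> borel_measurable \<mu>"
    using adelic_step_measurable adelic_step_wave[OF assms, of \<eta> 0] by blast
  \<comment> \<open>Since s s' = 1 is integral, translation by s' preserves the lattice. It
    multiplies the integrand by a constant different from 1, so the integral is 0.\<close>
  hence "(\<integral>u. f (s' + u) \<partial>\<mu>) = (\<integral>u. f u \<partial>\<mu>)" by (rule integral_translate)
  moreover have "f (s' + u) = adele_char (\<eta> * s') * f u" for u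
  proof -
    have "s * (s' + u) \<in> Zhat \<longleftrightarrow> s * u \<in> Zhat"
      using Zhat_add_iff[OF Zhat_closed(2), of "s * u"] by (simp add: distrib_left assms add.commute)
    thus ?thesis by (simp add: f_def distrib_left adele_char_add indicator_def)
  qed
  ultimately have "(adele_char (\<eta> * s') - 1) * (\<integral>u. f u \<partial>\<mu>) = 0" by (simp add: algebra_simps)
  moreover have "adele_char (\<eta> * s') \<noteq> 1" using False by (simp add: adele_char_eq_1_iff mult.commute)
  ultimately show ?thesis using False by (simp add: f_def)
qed

text \<open>Moving the centre to 0 by x = a + u merges both characters of u into one with frequency
  \<xi> + \<kappa>, and orthogonality on the lattice evaluates the integral.\<close>

lemma fourier_wave:
  assumes "s * s' = 1"
  shows "fourier \<mu> (adelic_wave \<kappa> a s) =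
    (\<lambda>\<xi>. of_real (measure \<mu> (adele_lattice s)) * adele_char (- (\<kappa> * a)) * adelic_wave a (- \<kappa>) s' \<xi>)"
proof
  fix \<xi>
  obtain N where "adelic_step N (adelic_wave \<kappa> a s)" using adelic_step_wave[OF assms] by blast
  from adelic_step_char_mult[OF this]
  have m: "(\<lambda>x. adele_char (\<xi> * x) * adelic_wave \<kappa> a s x) \<in> borel_measurable \<mu>"
    using adelic_step_measurable by blast
  have "fourier \<mu> (adelic_wave \<kappa> a s) \<xi> = (\<integral>u. adele_char (\<xi> * (a + u)) * adelic_wave \<kappa> a s (a + u) \<partial>\<mu>)"
    unfolding fourier_eq by (rule integral_translate[OF m, symmetric])
  also have "\<dots> = (\<integral>u. adele_char (\<xi> * a) * (adele_char ((\<xi> + \<kappa>) * u) * indicator Zhat (s * u)) \<partial>\<mu>)"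
    by (simp add: adelic_wave_def adele_char_add distrib_left distrib_right mult_ac)
  also have "\<dots> = adele_char (\<xi> * a) * (of_real (measure \<mu> (adele_lattice s)) * indicator Zhat (s' * (\<xi> + \<kappa>)))"
    by (simp add: integral_char_lattice[OF assms])
  \<comment> \<open>The phase is recentred at -\<kappa>, so that the result is again a wave, with
    frequency a and centre -\<kappa>.\<close>
  also have "adele_char (\<xi> * a) = adele_char (- (\<kappa> * a)) * adele_char (a * (\<xi> - - \<kappa>))"
    by (simp add: adele_char_add[symmetric] algebra_simps)
  also have "adele_char (- (\<kappa> * a)) * adele_char (a * (\<xi> - - \<kappa>)) * (of_real (measure \<mu> (adele_lattice s)) * indicator Zhat (s' * (\<xi> + \<kappa>)))
      = of_real (measure \<mu> (adele_lattice s)) * adele_char (- (\<kappa> * a)) * adelic_wave a (- \<kappa>) s' \<xi>"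
    by (simp add: adelic_wave_def mult_ac)
  finally show "fourier \<mu> (adelic_wave \<kappa> a s) \<xi> =
      of_real (measure \<mu> (adele_lattice s)) * adele_char (- (\<kappa> * a)) * adelic_wave a (- \<kappa>) s' \<xi>" .
qed

end

section \<open>Fourier inversion and the spaces of test functions\<close>

lemma fourier_scale: "fourier \<mu> (\<lambda>x. c * f x) = (\<lambda>\<xi>. c * fourier \<mu> f \<xi>)"
proof
  fix \<xi>
  have "fourier \<mu> (\<lambda>x. c * f x) \<xi> = (\<integral>x. c * (adele_char (\<xi> * x) * f x) \<partial>\<mu>)"
    by (simp add: fourier_eq mult.left_commute)
  also have "\<dots> = c * fourier \<mu> f \<xi>" unfolding fourier_eq by (rule integral_mult_right_zero)
  finally show "fourier \<mu> (\<lambda>x. c * f x) \<xi> = c * fourier \<mu> f \<xi>" .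
qed

lemma fourier_0 [simp]: "fourier \<mu> (\<lambda>x. 0) = (\<lambda>\<xi>. 0)"
  by (simp add: fourier_eq fun_eq_iff)

lemma (in Haar) fourier_sum:
  assumes "finite A" "\<And>a. a \<in> A \<Longrightarrow> \<exists>N. adelic_step N (f a)"
  shows "fourier \<mu> (\<lambda>x. \<Sum>a\<in>A. c a * f a x) = (\<lambda>\<xi>. \<Sum>a\<in>A. c a * fourier \<mu> (f a) \<xi>)"
proof
  fix \<xi>
  have int: "integrable \<mu> (\<lambda>x. adele_char (\<xi> * x) * f a x)" if "a \<in> A" for a
  proof -
    obtain N where "adelic_step N (f a)" using assms(2) \<open>a \<in> A\<close> by blast
    from adelic_step_char_mult[OF this] adelic_step_integrable show ?thesis by blast
  qed
  have "fourier \<mu> (\<lambda>x. \<Sum>a\<in>A. c a * f a x) \<xi> = (\<integral>x. (\<Sum>a\<in>A. c a * (adele_char (\<xi> * x) * f a x)) \<partial>\<mu>)"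
    by (simp add: fourier_eq sum_distrib_left mult.left_commute)
  also have "\<dots> = (\<Sum>a\<in>A. (\<integral>x. c a * (adele_char (\<xi> * x) * f a x) \<partial>\<mu>))"
    by (rule Bochner_Integration.integral_sum) (intro integrable_mult_right int)
  also have "\<dots> = (\<Sum>a\<in>A. c a * fourier \<mu> (f a) \<xi>)"
    unfolding fourier_eq by (rule sum.cong[OF refl integral_mult_right_zero])
  finally show "fourier \<mu> (\<lambda>x. \<Sum>a\<in>A. c a * f a x) \<xi> = (\<Sum>a\<in>A. c a * fourier \<mu> (f a) \<xi>)" .
qed

lemma adelic_wave_uminus:
  "adelic_wave 0 (- a) s x = adelic_wave 0 a s (- x)"
proof -
  have eq: "s * (x - - a) = - (s * (- x - a))" by (simp only: mult_minus_right[symmetric]) (simp add: add.commute)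
  have "- y \<in> Zhat \<longleftrightarrow> y \<in> Zhat" for y
  proof
    assume "- y \<in> Zhat"
    from Zhat_closed(3)[OF this] show "y \<in> Zhat" by simp
  qed (rule Zhat_closed(3))
  hence "indicator Zhat (s * (x - - a)) = (indicator Zhat (s * (- x - a)) :: complex)"
    unfolding eq by (simp only: indicator_def)
  thus ?thesis by (simp only: adelic_wave_def mult_zero_left)
qed

text \<open>The factor equals 1, but for injectivity it is enough that it is positive.\<close>

lemma (in Haar) fourier_fourier:
  assumes "adelic_step N f"
  shows "fourier \<mu> (fourier \<mu> f) x =
    of_real (measure \<mu> (adele_lattice (of_rat_adele (1 / of_nat N)))) *
    of_real (measure \<mu> (adele_lattice (of_rat_adele (of_nat N)))) * f (- x)"
proof -
  let ?N = "of_rat_adele (of_nat N)" and ?M = "of_rat_adele (1 / of_nat N)"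
    and ?a = "\<lambda>c. of_rat_adele (of_nat c / of_nat N)"
  have N: "N > 0" using assms by (simp add: adelic_step_def)
  note NM = of_rat_adele_inverse_nat[OF N]
  let ?m = "of_real (measure \<mu> (adele_lattice ?M)) :: complex"
    and ?m' = "of_real (measure \<mu> (adele_lattice ?N)) :: complex"
  define c where "c n = f (?a n)" for n
  have f: "f = (\<lambda>x. \<Sum>n<N * N. c n * adelic_wave 0 (?a n) ?M x)"
    unfolding c_def by (rule ext) (rule adelic_step_expand[OF assms])
  have "fourier \<mu> f = (\<lambda>\<xi>. \<Sum>n<N * N. c n * fourier \<mu> (adelic_wave 0 (?a n) ?M) \<xi>)"
    by (subst f, rule fourier_sum) (simp_all only: finite_lessThan adelic_step_wave[OF NM(2)])
  also have "\<dots> = (\<lambda>\<xi>. \<Sum>n<N * N. (c n * ?m) * adelic_wave (?a n) 0 ?N \<xi>)"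
    by (simp add: fourier_wave[OF NM(2)] adele_char_Zhat Zhat_closed(1) mult.assoc)
  finally have "fourier \<mu> (fourier \<mu> f) = (\<lambda>x. \<Sum>n<N * N. (c n * ?m) * fourier \<mu> (adelic_wave (?a n) 0 ?N) x)"
    using fourier_sum[of "{..<N * N}" "\<lambda>n. adelic_wave (?a n) 0 ?N" "\<lambda>n. c n * ?m"] adelic_step_wave[OF NM(1)]
    by simp
  \<comment> \<open>The second transform returns each wave to the indicator of a coset of the
    original lattice, now around the opposite centre: hence the reflection of x.\<close>
  also have "\<dots> = (\<lambda>x. \<Sum>n<N * N. (?m * ?m') * (c n * adelic_wave 0 (?a n) ?M (- x)))"
    by (simp add: fourier_wave[OF NM(1)] adele_char_Zhat Zhat_closed(1) adelic_wave_uminus mult_ac)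
  also have "\<dots> = (\<lambda>x. ?m * ?m' * f (- x))"
    by (subst f) (simp add: sum_distrib_left)
  finally show ?thesis by (rule fun_cong)
qed

lemma (in Haar) fourier_inj:
  assumes "adelic_step N f" "adelic_step K g" "fourier \<mu> f = fourier \<mu> g"
  shows "f = g"
proof -
  \<comment> \<open>The difference is written as a combination indexed by \<open>bool\<close>, so
    that the lemmas on finite combinations apply to it.\<close>
  define F where "F b = (if b then f else g)" for b :: bool
  define c where "c b = (if b then 1 else - 1 :: complex)" for b :: bool
  have F: "\<exists>N. adelic_step N (F b)" for b using assms(1,2) by (auto simp: F_def)
  have UN: "(\<Sum>b\<in>UNIV. c b * G b) = G True - G False" for G :: "bool \<Rightarrow> complex"
    by (simp add: c_def UNIV_bool)
  obtain L where L: "adelic_step L (\<lambda>x. \<Sum>b\<in>UNIV. c b * F b x)"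
    using adelic_step_sum[of UNIV F c] F by auto
  hence L': "adelic_step L (\<lambda>x. f x - g x)" unfolding UN by (simp add: F_def)
  hence L0: "L > 0" by (simp add: adelic_step_def)
  have "fourier \<mu> (\<lambda>x. \<Sum>b\<in>UNIV. c b * F b x) = (\<lambda>x. 0)"
    using fourier_sum[of UNIV F c] F assms(3) unfolding UN by (simp add: F_def)
  hence "fourier \<mu> (\<lambda>x. f x - g x) = (\<lambda>x. 0)" unfolding UN by (simp add: F_def)
  hence "f (- x) - g (- x) = 0" for x
    using fourier_fourier[OF L', of x] measure_lattice_pos[OF of_rat_adele_inverse_nat(1)[OF L0]]
      measure_lattice_pos[OF of_rat_adele_inverse_nat(2)[OF L0]] by simp
  hence "f x - g x = 0" for x by (metis minus_minus)
  thus ?thesis by (simp add: fun_eq_iff)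
qed

section \<open>Schwartz-Bruhat functions as adelic step functions\<close>

lemma Omega_padic_norm:
  assumes "prime p" "x \<in> carrier (Qp p)"
  shows "\<Omega> (padic_norm p x) = of_bool (x \<in> Zp p)"
  using padic_norm_nonneg[OF assms] assms(2) by (simp add: \<Omega>_def Zp_def)

lemma prime_prod_Omega:
  "prime_prod (\<lambda>p. if Q p then \<Omega> (padic_norm p (component x p)) else 1) =
    of_bool (\<forall>p. prime p \<and> Q p \<longrightarrow> component x p \<in> Zp p)"
proof -
  let ?S = "{p. prime p \<and> component x p \<notin> Zp p}"
  have "prime_prod (\<lambda>p. if Q p then \<Omega> (padic_norm p (component x p)) else 1) =
      (\<Prod>p\<in>?S. if Q p then \<Omega> (padic_norm p (component x p)) else 1)"
    by (rule prime_prod_eq) (auto simp: finite_not_integral Omega_padic_norm)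
  also have "\<dots> = (\<Prod>p\<in>?S. of_bool (\<not> Q p))"
    by (rule prod.cong) (auto simp: Omega_padic_norm)
  also have "\<dots> = of_bool (\<forall>p\<in>?S. \<not> Q p)"
    using finite_not_integral[of x] by (auto simp: prod_zero_iff)
  finally show ?thesis by (simp add: of_bool_def) metis
qed

lemma indicator_Zhat_eq: "indicator Zhat x = prime_prod (\<lambda>p. \<Omega> (padic_norm p (component x p)))"
  using prime_prod_Omega[of "\<lambda>_. True" x] by (simp add: Zhat_def indicator_def)

text \<open>The last property holds because the infinite product is really a finite one: a zero
  factor at any prime makes it vanish.\<close>

lemma product_function_factors:
  assumes "f \<in> product_functions m"
  obtains \<eta> where "f = (\<lambda>\<xi>. prime_prod (\<lambda>p. \<eta> p (component \<xi> p)))"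
    "\<And>p. prime p \<Longrightarrow> \<eta> p \<in> test_functions p"
    "\<And>p x. prime p \<Longrightarrow> p > m \<Longrightarrow> x \<in> carrier (Qp p) \<Longrightarrow> \<eta> p x = of_bool (x \<in> Zp p)"
    "\<And>\<xi> p. prime p \<Longrightarrow> f \<xi> \<noteq> 0 \<Longrightarrow> \<eta> p (component \<xi> p) \<noteq> 0"
proof -
  from assms obtain \<eta> where \<eta>: "f = (\<lambda>\<xi>. prime_prod (\<lambda>p. \<eta> p (component \<xi> p)))"
    "\<And>p. prime p \<Longrightarrow> \<eta> p \<in> test_functions p"
    "\<And>p x. prime p \<Longrightarrow> p > m \<Longrightarrow> x \<in> carrier (Qp p) \<Longrightarrow> \<eta> p x = \<Omega> (padic_norm p x)"
    unfolding product_functions_def by blast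
  have 3: "\<eta> p x = of_bool (x \<in> Zp p)" if "prime p" "p > m" "x \<in> carrier (Qp p)" for p x
    using \<eta>(3)[OF that] Omega_padic_norm[OF that(1,3)] by simp
  have "\<eta> p (component \<xi> p) \<noteq> 0" if p: "prime p" "f \<xi> \<noteq> 0" for \<xi> p
  proof -
    \<comment> \<open>Outside this finite set the factors are 1; p is inserted so that its factor
      appears in the product in any case.\<close>
    let ?S = "insert p ({p. prime p \<and> p \<le> m} \<union> {p. prime p \<and> component \<xi> p \<notin> Zp p})"
    have fin: "finite ?S" using finite_not_integral[of \<xi>] by simp
    have "f \<xi> = (\<Prod>p\<in>?S. \<eta> p (component \<xi> p))"
      unfolding \<eta>(1) using p(1) fin by (intro prime_prod_eq) (auto simp: 3)
    thus ?thesis using p(2) fin by (simp del: prod.insert)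
  qed
  thus ?thesis using that \<eta>(1,2) 3 by blast
qed

lemma padic_norm_rat_of_nat_dvd:
  assumes "prime p" "p ^ n dvd N"
  shows "padic_norm_rat p (of_nat N) \<le> 1 / real p ^ n"
proof -
  obtain M where M: "N = p ^ n * M" using assms(2) by blast
  have "padic_norm_rat p (of_int (int M)) \<le> 1" by (rule padic_norm_rat_of_int[OF assms(1)])
  hence "padic_norm_rat p (of_nat M) \<le> 1" by simp
  thus ?thesis using prime_gt_0_nat[OF assms(1)]
    by (simp add: M padic_norm_rat_mult assms(1) padic_norm_rat_prime_power divide_right_mono)
qed

text \<open>N collects the powers \<open>p ^ n p\<close> that serve the local factors for p \<le> m.
  For larger p the factor is the indicator of \<open>Zp\<close>, for which integrality of N is
  enough.\<close>

lemma product_function_imp_adelic_step: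
  assumes "f \<in> product_functions m"
  shows "\<exists>N. adelic_step N f"
proof -
  obtain \<eta> where \<eta>: "f = (\<lambda>\<xi>. prime_prod (\<lambda>p. \<eta> p (component \<xi> p)))"
    "\<And>p. prime p \<Longrightarrow> \<eta> p \<in> test_functions p"
    "\<And>p x. prime p \<Longrightarrow> p > m \<Longrightarrow> x \<in> carrier (Qp p) \<Longrightarrow> \<eta> p x = of_bool (x \<in> Zp p)"
    "\<And>\<xi> p. prime p \<Longrightarrow> f \<xi> \<noteq> 0 \<Longrightarrow> \<eta> p (component \<xi> p) \<noteq> 0"
    by (rule product_function_factors[OF assms]) (rule that)
  have "\<exists>n. step_function p n (\<eta> p)" if "prime p" for p
    using test_function_imp_step_function[OF that \<eta>(2)[OF that]] .
  then obtain n where n: "\<And>p. prime p \<Longrightarrow> step_function p (n p) (\<eta> p)" by metis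
  define P where "P = {p. prime p \<and> p \<le> m}"
  define N where "N = (\<Prod>p\<in>P. p ^ n p)"
  have "finite P" by (simp add: P_def)
  have "N > 0" unfolding N_def by (rule prod_pos) (auto simp: P_def prime_gt_0_nat)
  have normN: "padic_norm_rat p (of_nat N) \<le> 1 / real p ^ n p" if "p \<in> P" for p
    using that \<open>finite P\<close> by (intro padic_norm_rat_of_nat_dvd) (auto simp: N_def P_def)
  have "adelic_step N f"
    unfolding adelic_step_def
  proof (intro conjI allI ballI impI)
    fix x z assume z: "z \<in> Zhat"
    have "\<eta> p (component (x + of_rat_adele (of_nat N) * z) p) = \<eta> p (component x p)" if p: "prime p" for p
    proof -
      interpret Q: cring "Qp p" using Qp_cring[OF p] .
      let ?x = "component x p" and ?z = "of_rat_padic p (of_nat N) \<otimes>\<^bsub>Qp p\<^esub> component z p"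
      have xc: "?x \<in> carrier (Qp p)" "?z \<in> carrier (Qp p)" using p by auto
      have zp: "component z p \<in> Zp p" using z p by (simp add: Zhat_def)
      have comp: "component (x + of_rat_adele (of_nat N) * z) p = ?x \<oplus>\<^bsub>Qp p\<^esub> ?z"
        using p by (simp add: component_simps component_of_rat_adele)
      show ?thesis
      proof (cases "p \<le> m")
        case True
        have "?x \<ominus>\<^bsub>Qp p\<^esub> (?x \<oplus>\<^bsub>Qp p\<^esub> ?z) = \<ominus>\<^bsub>Qp p\<^esub> ?z" using xc by algebra
        hence "padic_norm p (?x \<ominus>\<^bsub>Qp p\<^esub> (?x \<oplus>\<^bsub>Qp p\<^esub> ?z)) = padic_norm_rat p (of_nat N) * padic_norm p (component z p)"
          using p xc by (simp add: padic_norm_uminus padic_norm_mult)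
        also have "\<dots> \<le> 1 / real p ^ n p * 1"
          using normN[of p] True p zp padic_norm_nonneg[OF p] padic_norm_rat_nonneg
          by (intro mult_mono) (auto simp: P_def Zp_def)
        finally have "\<eta> p ?x = \<eta> p (?x \<oplus>\<^bsub>Qp p\<^esub> ?z)"
          using n[OF p] xc Q.a_closed[OF xc] unfolding step_function_def by simp
        thus ?thesis by (simp add: comp)
      next
        case False
        have zz: "?z \<in> Zp p"
          using padic_norm_rat_of_int[OF p, of "int N"] p
          by (intro Zp_mult[OF p _ zp]) (simp add: of_rat_padic_in_Zp_iff)
        have "?x \<in> Zp p" if "?x \<oplus>\<^bsub>Qp p\<^esub> ?z \<in> Zp p"
        proof -
          have "(?x \<oplus>\<^bsub>Qp p\<^esub> ?z) \<ominus>\<^bsub>Qp p\<^esub> ?z = ?x" using xc by algebra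
          thus ?thesis using Zp_diff[OF p that zz] by simp
        qed
        hence "?x \<oplus>\<^bsub>Qp p\<^esub> ?z \<in> Zp p \<longleftrightarrow> ?x \<in> Zp p" using Zp_add[OF p _ zz] by blast
        thus ?thesis using False p xc \<eta>(3)[OF p, of ?x] \<eta>(3)[OF p, of "?x \<oplus>\<^bsub>Qp p\<^esub> ?z"] by (simp add: comp)
      qed
    qed
    thus "f (x + of_rat_adele (of_nat N) * z) = f x" unfolding \<eta>(1) by (rule prime_prod_cong)
  next
    fix x assume x: "f x \<noteq> 0"
    have "component (of_rat_adele (of_nat N) * x) p \<in> Zp p" if p: "prime p" for p
    proof -
      interpret Q: cring "Qp p" using Qp_cring[OF p] .
      have nz: "\<eta> p (component x p) \<noteq> 0" using \<eta>(4)[OF p x] .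
      have "padic_norm_rat p (of_nat N) * padic_norm p (component x p) \<le> 1"
      proof (cases "p \<le> m")
        case True
        have "padic_norm p (component x p) \<le> real p ^ n p"
          using n[OF p] nz p unfolding step_function_def by simp
        hence "padic_norm_rat p (of_nat N) * padic_norm p (component x p) \<le> 1 / real p ^ n p * real p ^ n p"
          using normN[of p] True p padic_norm_nonneg[OF p] padic_norm_rat_nonneg
          by (intro mult_mono) (auto simp: P_def)
        thus ?thesis using prime_gt_0_nat[OF p] by simp
      next
        case False
        hence "component x p \<in> Zp p" using \<eta>(3)[OF p] nz p by (auto split: if_splits)
        hence "padic_norm p (component x p) \<le> 1" by (simp add: Zp_def)
        moreover have "padic_norm_rat p (of_nat N) \<le> 1" using padic_norm_rat_of_int[OF p, of "int N"] by simp
        ultimately show ?thesis using padic_norm_nonneg[OF p] p padic_norm_rat_nonneg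
          by (intro mult_le_one) auto
      qed
      thus ?thesis using p by (simp add: component_simps component_of_rat_adele Zp_def padic_norm_mult)
    qed
    thus "of_rat_adele (of_nat N) * x \<in> Zhat" by (simp add: Zhat_def)
  qed (rule \<open>N > 0\<close>)
  thus ?thesis ..
qed

lemma complex_span_adelic_step:
  assumes "f \<in> complex_span S" "\<And>g. g \<in> S \<Longrightarrow> \<exists>N. adelic_step N g"
  shows "\<exists>N. adelic_step N f"
proof -
  obtain T c where f: "f = (\<lambda>x. \<Sum>g\<in>T. c g * g x)" and T: "finite T" "T \<subseteq> S"
    using assms(1) by (auto simp: complex_span_def)
  show ?thesis unfolding f
    by (rule adelic_step_sum[where f = "\<lambda>g. g"]) (use assms(2) T in auto)
qed

lemma Schwartz_Bruhat_adelic_step: "f \<in> Schwartz_Bruhat \<Longrightarrow> \<exists>N. adelic_step N f"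
  unfolding Schwartz_Bruhat_def
  by (rule complex_span_adelic_step) (auto intro: product_function_imp_adelic_step)

lemma \<Psi>_space_adelic_step: "f \<in> \<Psi>_space m \<Longrightarrow> \<exists>N. adelic_step N f"
  unfolding \<Psi>_space_def
  by (auto intro: complex_span_adelic_step product_function_imp_adelic_step)

lemma complex_span_scale: "g \<in> S \<Longrightarrow> (\<lambda>x. c * g x) \<in> complex_span S"
  unfolding complex_span_def by (intro CollectI exI[of _ "{g}"] exI[of _ "\<lambda>_. c"]) auto

text \<open>An \<open>inv_into\<close> undoes a map that is injective on the given set, and all
  Schwartz-Bruhat functions are step functions, where \<open>fourier_inj\<close> applies.\<close>

lemma (in Haar) fourier_inv_fourier: "f \<in> Schwartz_Bruhat \<Longrightarrow> fourier_inv \<mu> (fourier \<mu> f) = f"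
  unfolding fourier_inv_def
  by (rule inv_into_f_f) (auto intro!: inj_onI dest!: Schwartz_Bruhat_adelic_step intro: fourier_inj)

text \<open>\<open>p ^ n\<close> dominates four norms: those of k and s give the radius of
  constancy, those of s' and a bound the support.\<close>

lemma step_function_wave:
  assumes "prime p" "k \<in> carrier (Qp p)" "a \<in> carrier (Qp p)" "s \<in> carrier (Qp p)" "s' \<in> carrier (Qp p)"
    and ss: "s \<otimes>\<^bsub>Qp p\<^esub> s' = \<one>\<^bsub>Qp p\<^esub>"
  shows "\<exists>n. step_function p n
    (\<lambda>y. padic_char p (k \<otimes>\<^bsub>Qp p\<^esub> (y \<ominus>\<^bsub>Qp p\<^esub> a)) * \<Omega> (padic_norm p (s \<otimes>\<^bsub>Qp p\<^esub> (y \<ominus>\<^bsub>Qp p\<^esub> a))))"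
proof -
  interpret Q: cring "Qp p" using Qp_cring[OF assms(1)] .
  have p: "real p > 1" using prime_gt_1_nat[OF assms(1)] by simp
  note norm0 = padic_norm_nonneg[OF assms(1)]
  obtain n where n: "Max {padic_norm p k, padic_norm p a, padic_norm p s, padic_norm p s'} < real p ^ n"
    using real_arch_pow[OF p] by blast
  hence nk: "padic_norm p k \<le> real p ^ n" "padic_norm p a \<le> real p ^ n"
    "padic_norm p s \<le> real p ^ n" "padic_norm p s' \<le> real p ^ n" by auto
  have small: "c \<otimes>\<^bsub>Qp p\<^esub> (x \<ominus>\<^bsub>Qp p\<^esub> y) \<in> Zp p"
    if "c \<in> carrier (Qp p)" "padic_norm p c \<le> real p ^ n" "x \<in> carrier (Qp p)" "y \<in> carrier (Qp p)"
      "padic_norm p (x \<ominus>\<^bsub>Qp p\<^esub> y) \<le> 1 / real p ^ n" for c x y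
  proof -
    have "padic_norm p c * padic_norm p (x \<ominus>\<^bsub>Qp p\<^esub> y) \<le> real p ^ n * (1 / real p ^ n)"
      using that norm0 p by (intro mult_mono) auto
    thus ?thesis using that p assms(1) by (simp add: Zp_def padic_norm_mult)
  qed
  \<comment> \<open>The two arguments differ by c times x - y, which is integral when x and y are
    close.\<close>
  have expand: "c \<otimes>\<^bsub>Qp p\<^esub> (x \<ominus>\<^bsub>Qp p\<^esub> a) = c \<otimes>\<^bsub>Qp p\<^esub> (y \<ominus>\<^bsub>Qp p\<^esub> a) \<oplus>\<^bsub>Qp p\<^esub> c \<otimes>\<^bsub>Qp p\<^esub> (x \<ominus>\<^bsub>Qp p\<^esub> y)"
    if "c \<in> carrier (Qp p)" "x \<in> carrier (Qp p)" "y \<in> carrier (Qp p)" for c x y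
    using that assms(3) by algebra
  let ?f = "\<lambda>y. padic_char p (k \<otimes>\<^bsub>Qp p\<^esub> (y \<ominus>\<^bsub>Qp p\<^esub> a)) * \<Omega> (padic_norm p (s \<otimes>\<^bsub>Qp p\<^esub> (y \<ominus>\<^bsub>Qp p\<^esub> a)))"
  have "?f x = ?f y" if xy: "x \<in> carrier (Qp p)" "y \<in> carrier (Qp p)"
      "padic_norm p (x \<ominus>\<^bsub>Qp p\<^esub> y) \<le> 1 / real p ^ n" for x y
  proof -
    have "padic_frac p (k \<otimes>\<^bsub>Qp p\<^esub> (x \<ominus>\<^bsub>Qp p\<^esub> a)) = padic_frac p (k \<otimes>\<^bsub>Qp p\<^esub> (y \<ominus>\<^bsub>Qp p\<^esub> a))"
      unfolding expand[OF assms(2) xy(1,2)]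
      by (rule padic_frac_add_Zp[OF assms(1)]) (use small[OF assms(2) nk(1) xy] xy assms in simp_all)
    moreover have "s \<otimes>\<^bsub>Qp p\<^esub> (x \<ominus>\<^bsub>Qp p\<^esub> a) \<in> Zp p \<longleftrightarrow> s \<otimes>\<^bsub>Qp p\<^esub> (y \<ominus>\<^bsub>Qp p\<^esub> a) \<in> Zp p"
    proof
      assume "s \<otimes>\<^bsub>Qp p\<^esub> (y \<ominus>\<^bsub>Qp p\<^esub> a) \<in> Zp p"
      thus "s \<otimes>\<^bsub>Qp p\<^esub> (x \<ominus>\<^bsub>Qp p\<^esub> a) \<in> Zp p"
        unfolding expand[OF assms(4) xy(1,2)] using small[OF assms(4) nk(3) xy] Zp_add[OF assms(1)] by blast
    next
      assume "s \<otimes>\<^bsub>Qp p\<^esub> (x \<ominus>\<^bsub>Qp p\<^esub> a) \<in> Zp p"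
      moreover have "s \<otimes>\<^bsub>Qp p\<^esub> (y \<ominus>\<^bsub>Qp p\<^esub> x) \<in> Zp p"
        using small[OF assms(4) nk(3) xy(2,1)] xy padic_norm_minus_commute[OF assms(1) xy(1,2)] by simp
      ultimately show "s \<otimes>\<^bsub>Qp p\<^esub> (y \<ominus>\<^bsub>Qp p\<^esub> a) \<in> Zp p"
        unfolding expand[OF assms(4) xy(2,1)] using Zp_add[OF assms(1)] by blast
    qed
    ultimately show ?thesis using xy assms by (simp add: padic_char_def Omega_padic_norm)
  qed
  moreover have "padic_norm p x \<le> real p ^ n" if x: "x \<in> carrier (Qp p)" "?f x \<noteq> 0" for x
  proof -
    have z: "s \<otimes>\<^bsub>Qp p\<^esub> (x \<ominus>\<^bsub>Qp p\<^esub> a) \<in> Zp p"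
      using x assms by (auto simp: Omega_padic_norm split: if_splits)
    have "(s \<otimes>\<^bsub>Qp p\<^esub> s') \<otimes>\<^bsub>Qp p\<^esub> (x \<ominus>\<^bsub>Qp p\<^esub> a) = x \<ominus>\<^bsub>Qp p\<^esub> a"
      using x assms(1,3) by (simp add: ss)
    moreover have "(s \<otimes>\<^bsub>Qp p\<^esub> s') \<otimes>\<^bsub>Qp p\<^esub> (x \<ominus>\<^bsub>Qp p\<^esub> a) = s' \<otimes>\<^bsub>Qp p\<^esub> (s \<otimes>\<^bsub>Qp p\<^esub> (x \<ominus>\<^bsub>Qp p\<^esub> a))"
      using x assms(3-5) by algebra
    ultimately have "padic_norm p (x \<ominus>\<^bsub>Qp p\<^esub> a) = padic_norm p s' * padic_norm p (s \<otimes>\<^bsub>Qp p\<^esub> (x \<ominus>\<^bsub>Qp p\<^esub> a))"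
      using padic_norm_mult[OF assms(1,5) Zp_carrier[OF z]] by simp
    also have "\<dots> \<le> real p ^ n * 1"
      using nk(4) z norm0 assms(5) Zp_carrier[OF z] by (intro mult_mono) (auto simp: Zp_def)
    finally have "padic_norm p (x \<ominus>\<^bsub>Qp p\<^esub> a) \<le> real p ^ n" by simp
    moreover have "(x \<ominus>\<^bsub>Qp p\<^esub> a) \<oplus>\<^bsub>Qp p\<^esub> a = x" using x assms(3) by algebra
    ultimately show ?thesis
      using padic_norm_add[OF assms(1), of "x \<ominus>\<^bsub>Qp p\<^esub> a" a] nk(2) x assms(3) by simp
  qed
  ultimately have "step_function p n ?f" unfolding step_function_def by blast
  thus ?thesis ..
qed

text \<open>Character and indicator both factor over the primes. Beyond m the local frequency and
  centre are 0 and the scale is 1, which leaves the factor \<Omega>.\<close>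

lemma adelic_wave_product_function:
  assumes "s * s' = 1"
    and "\<And>p. prime p \<Longrightarrow> p > m \<Longrightarrow> component \<kappa> p = \<zero>\<^bsub>Qp p\<^esub>"
    and "\<And>p. prime p \<Longrightarrow> p > m \<Longrightarrow> component a p = \<zero>\<^bsub>Qp p\<^esub>"
    and "\<And>p. prime p \<Longrightarrow> p > m \<Longrightarrow> component s p = \<one>\<^bsub>Qp p\<^esub>"
  shows "adelic_wave \<kappa> a s \<in> product_functions m"
proof -
  define \<eta> where "\<eta> p y = padic_char p (component \<kappa> p \<otimes>\<^bsub>Qp p\<^esub> (y \<ominus>\<^bsub>Qp p\<^esub> component a p)) *
      \<Omega> (padic_norm p (component s p \<otimes>\<^bsub>Qp p\<^esub> (y \<ominus>\<^bsub>Qp p\<^esub> component a p)))" for p y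
  have "adelic_wave \<kappa> a s x = prime_prod (\<lambda>p. \<eta> p (component x p))" for x
  proof -
    let ?u = "\<kappa> * (x - a)" and ?v = "s * (x - a)"
    \<comment> \<open>Both products are expanded over one finite set, so that they can be multiplied
      factor by factor.\<close>
    let ?S = "{p. prime p \<and> component ?u p \<notin> Zp p} \<union> {p. prime p \<and> component ?v p \<notin> Zp p}"
    let ?f = "\<lambda>p. padic_char p (component ?u p)" and ?g = "\<lambda>p. \<Omega> (padic_norm p (component ?v p))"
    have fin: "finite ?S" using finite_not_integral by simp
    have "adelic_wave \<kappa> a s x = prime_prod ?f * prime_prod ?g"
      by (simp only: adelic_wave_def prime_prod_padic_char indicator_Zhat_eq)
    also have "prime_prod ?f = (\<Prod>p\<in>?S. ?f p)"
      by (rule prime_prod_eq[OF fin]) (auto simp: padic_char_Zp)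
    also have "prime_prod ?g = (\<Prod>p\<in>?S. ?g p)"
      by (rule prime_prod_eq[OF fin]) (auto simp: Omega_padic_norm)
    also have "(\<Prod>p\<in>?S. ?f p) * (\<Prod>p\<in>?S. ?g p) = prime_prod (\<lambda>p. ?f p * ?g p)"
      unfolding prod.distrib[symmetric]
      by (rule prime_prod_eq[OF fin, symmetric]) (auto simp: padic_char_Zp Omega_padic_norm)
    also have "\<dots> = prime_prod (\<lambda>p. \<eta> p (component x p))"
      by (rule prime_prod_cong) (simp add: \<eta>_def component_simps)
    finally show ?thesis .
  qed
  moreover have "\<eta> p \<in> test_functions p" if p: "prime p" for p
  proof -
    have "component s p \<otimes>\<^bsub>Qp p\<^esub> component s' p = \<one>\<^bsub>Qp p\<^esub>"
      using p assms(1) by (simp add: component_times[symmetric] component_one)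
    from step_function_wave[OF p _ _ _ _ this, of "component \<kappa> p" "component a p"] p
    show ?thesis unfolding \<eta>_def using step_function_imp_test_function[OF p] by auto
  qed
  moreover have "\<eta> p x = \<Omega> (padic_norm p x)" if p: "prime p" "p > m" "x \<in> carrier (Qp p)" for p x
  proof -
    interpret Q: cring "Qp p" using Qp_cring[OF p(1)] .
    have "x \<ominus>\<^bsub>Qp p\<^esub> \<zero>\<^bsub>Qp p\<^esub> = x" using p(3) by algebra
    thus ?thesis using p by (simp add: \<eta>_def assms(2-4) padic_char_Zp Zp_zero)
  qed
  ultimately show ?thesis unfolding product_functions_def by blast
qed

text \<open>At p the function looks like the indicator of \<open>Zp\<close> tensored with a function
  of the other components. Stated without choosing a tensor decomposition, the property passes to
  linear combinations.\<close>

definition unramified :: "nat \<Rightarrow> (finite_adele \<Rightarrow> complex) \<Rightarrow> bool" where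
  "unramified p f \<longleftrightarrow>
     (\<forall>\<xi>. component \<xi> p \<notin> Zp p \<longrightarrow> f \<xi> = 0) \<and>
     (\<forall>\<xi> \<xi>'. component \<xi> p \<in> Zp p \<longrightarrow> component \<xi>' p \<in> Zp p \<longrightarrow>
        (\<forall>q. prime q \<longrightarrow> q \<noteq> p \<longrightarrow> component \<xi> q = component \<xi>' q) \<longrightarrow> f \<xi> = f \<xi>')"

lemma product_function_unramified:
  assumes "f \<in> product_functions m" "prime p" "p > m"
  shows "unramified p f"
proof -
  obtain \<eta> where \<eta>: "f = (\<lambda>\<xi>. prime_prod (\<lambda>p. \<eta> p (component \<xi> p)))"
    "\<And>p. prime p \<Longrightarrow> \<eta> p \<in> test_functions p"
    "\<And>p x. prime p \<Longrightarrow> p > m \<Longrightarrow> x \<in> carrier (Qp p) \<Longrightarrow> \<eta> p x = of_bool (x \<in> Zp p)"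
    "\<And>\<xi> p. prime p \<Longrightarrow> f \<xi> \<noteq> 0 \<Longrightarrow> \<eta> p (component \<xi> p) \<noteq> 0"
    by (rule product_function_factors[OF assms(1)]) (rule that)
  have 1: "f \<xi> = 0" if "component \<xi> p \<notin> Zp p" for \<xi>
    using that \<eta>(4)[OF assms(2), of \<xi>] \<eta>(3)[OF assms(2,3), of "component \<xi> p"] assms(2) by auto
  have 2: "f \<xi> = f \<xi>'" if "component \<xi> p \<in> Zp p" "component \<xi>' p \<in> Zp p"
    "\<forall>q. prime q \<longrightarrow> q \<noteq> p \<longrightarrow> component \<xi> q = component \<xi>' q" for \<xi> \<xi>'
  proof -
    have "\<eta> q (component \<xi> q) = \<eta> q (component \<xi>' q)" if q: "prime q" for q
    proof (cases "q = p")
      case True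
      thus ?thesis using \<eta>(3)[OF assms(2,3)] assms(2) \<open>component \<xi> p \<in> Zp p\<close> \<open>component \<xi>' p \<in> Zp p\<close> by simp
    next
      case False
      hence "component \<xi> q = component \<xi>' q" using \<open>\<forall>q. _\<close> q by blast
      thus ?thesis by (rule arg_cong)
    qed
    thus ?thesis unfolding \<eta>(1) by (rule prime_prod_cong)
  qed
  show ?thesis unfolding unramified_def using 1 2 by blast
qed

lemma unramified_linear_combination:
  assumes "\<And>a. a \<in> A \<Longrightarrow> unramified p (f a)"
  shows "unramified p (\<lambda>x. \<Sum>a\<in>A. c a * f a x)"
  unfolding unramified_def
proof (intro conjI allI impI)
  fix \<xi> assume "component \<xi> p \<notin> Zp p"
  hence "f a \<xi> = 0" if "a \<in> A" for a using assms[OF that] unfolding unramified_def by blast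
  thus "(\<Sum>a\<in>A. c a * f a \<xi>) = 0" by simp
next
  fix \<xi> \<xi>'
  assume *: "component \<xi> p \<in> Zp p" "component \<xi>' p \<in> Zp p"
    "\<forall>q. prime q \<longrightarrow> q \<noteq> p \<longrightarrow> component \<xi> q = component \<xi>' q"
  have "f a \<xi> = f a \<xi>'" if "a \<in> A" for a
    using assms[OF that] * unfolding unramified_def by blast
  thus "(\<Sum>a\<in>A. c a * f a \<xi>) = (\<Sum>a\<in>A. c a * f a \<xi>')" by simp
qed

lemma unramified_diff:
  assumes "unramified p f" "unramified p g"
  shows "unramified p (\<lambda>x. f x - g x)"
proof -
  have "unramified p (\<lambda>x. \<Sum>b\<in>UNIV. (if b then 1 else - 1) * (if b then f x else g x))"
    using unramified_linear_combination[of UNIV p "\<lambda>b. if b then f else g" "\<lambda>b. if b then 1 else - 1"] assms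
    by (simp add: if_distribR)
  thus ?thesis by (simp add: UNIV_bool)
qed

lemma \<Psi>_space_unramified:
  assumes "f \<in> \<Psi>_space m" "prime p" "p > m"
  shows "unramified p f"
proof -
  obtain T c where "f = (\<lambda>x. \<Sum>g\<in>T. c g * g x)" "T \<subseteq> product_functions m"
    using assms(1) by (auto simp: \<Psi>_space_def complex_span_def)
  thus ?thesis using unramified_linear_combination[of T p "\<lambda>g. g" c] product_function_unramified assms by blast
qed

text \<open>Evaluating where the component at the largest prime is 0 isolates the last summand.\<close>

lemma direct_sum:
  assumes "finite M" "\<And>m. m \<in> M \<Longrightarrow> prime m"
    and "\<And>m \<xi>. m \<in> M \<Longrightarrow> component \<xi> m = \<zero>\<^bsub>Qp m\<^esub> \<Longrightarrow> \<phi> m \<xi> = 0"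
    and "\<And>m p. m \<in> M \<Longrightarrow> prime p \<Longrightarrow> p > m \<Longrightarrow> unramified p (\<phi> m)"
    and "\<And>\<xi>. (\<Sum>m\<in>M. \<phi> m \<xi>) = 0"
  shows "\<forall>m\<in>M. \<phi> m = (\<lambda>\<xi>. 0)"
  using assms
proof (induction M rule: finite_linorder_max_induct)
  case (insert b A)
  have b: "prime b" by (rule insert.prems(1)) simp
  have bA: "b \<notin> A" using insert.hyps(2) by blast
  have sum0: "\<phi> b \<xi> + (\<Sum>m\<in>A. \<phi> m \<xi>) = 0" for \<xi>
    using insert.prems(4)[of \<xi>] insert.hyps(1) bA by simp
  have unr: "unramified b (\<phi> m)" if "m \<in> A" for m
  proof (rule insert.prems(3)[OF _ b])
    show "m \<in> insert b A" "m < b" using that insert.hyps(2) by blast+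
  qed
  \<comment> \<open>Outside \<open>Zp b\<close> every summand over A vanishes; inside, the
    b-component can be moved to 0 without changing these summands.\<close>
  have zero: "(\<Sum>m\<in>A. \<phi> m \<xi>) = 0" for \<xi>
  proof (cases "component \<xi> b \<in> Zp b")
    case False
    hence "\<phi> m \<xi> = 0" if "m \<in> A" for m using unr[OF that] unfolding unramified_def by blast
    thus ?thesis by simp
  next
    case True
    \<comment> \<open>Multiplication by this idempotent erases the b-component and keeps all
      others.\<close>
    define e where "e = adele (\<lambda>p. if p = b then \<zero>\<^bsub>Qp p\<^esub> else \<one>\<^bsub>Qp p\<^esub>)"
    have e: "component e p = (if p = b then \<zero>\<^bsub>Qp p\<^esub> else \<one>\<^bsub>Qp p\<^esub>)" if p: "prime p" for p
      unfolding e_def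
    proof (rule component_adele[OF _ _ p])
      have "{p. prime p \<and> (if p = b then \<zero>\<^bsub>Qp p\<^esub> else \<one>\<^bsub>Qp p\<^esub>) \<notin> Zp p} = {}"
        using Zp_zero Zp_one by auto
      thus "finite {p. prime p \<and> (if p = b then \<zero>\<^bsub>Qp p\<^esub> else \<one>\<^bsub>Qp p\<^esub>) \<notin> Zp p}"
        by (simp only: finite.emptyI)
    qed (auto intro: Zp_carrier[OF Zp_zero] Zp_carrier[OF Zp_one])
    let ?\<xi> = "\<xi> * e"
    have comp: "component ?\<xi> p = (if p = b then \<zero>\<^bsub>Qp p\<^esub> else component \<xi> p)" if p: "prime p" for p
    proof -
      interpret Q: cring "Qp p" using Qp_cring[OF p] .
      have "component \<xi> p \<otimes>\<^bsub>Qp p\<^esub> \<zero>\<^bsub>Qp p\<^esub> = \<zero>\<^bsub>Qp p\<^esub>"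
        "component \<xi> p \<otimes>\<^bsub>Qp p\<^esub> \<one>\<^bsub>Qp p\<^esub> = component \<xi> p" using p by simp_all
      thus ?thesis using p by (cases "p = b") (simp_all add: component_times e)
    qed
    have "\<phi> m ?\<xi> = \<phi> m \<xi>" if "m \<in> A" for m
    proof -
      have "component ?\<xi> b \<in> Zp b" using comp[OF b] Zp_zero[OF b] by simp
      moreover have "\<forall>q. prime q \<longrightarrow> q \<noteq> b \<longrightarrow> component ?\<xi> q = component \<xi> q" using comp by simp
      ultimately show ?thesis using unr[OF that] True unfolding unramified_def by blast
    qed
    hence "(\<Sum>m\<in>A. \<phi> m \<xi>) = (\<Sum>m\<in>A. \<phi> m ?\<xi>)" by simp
    also have "\<dots> = - \<phi> b ?\<xi>" using sum0[of ?\<xi>] by (simp add: add_eq_0_iff)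
    also have "\<phi> b ?\<xi> = 0" by (rule insert.prems(2)) (simp_all add: comp[OF b])
    finally show ?thesis by simp
  qed
  have IH: "\<forall>m\<in>A. \<phi> m = (\<lambda>\<xi>. 0)"
  proof (rule insert.IH)
    fix m assume "m \<in> A"
    hence m: "m \<in> insert b A" by blast
    show "prime m" by (rule insert.prems(1)[OF m])
    show "\<phi> m \<xi> = 0" if "component \<xi> m = \<zero>\<^bsub>Qp m\<^esub>" for \<xi> by (rule insert.prems(2)[OF m that])
    show "unramified p (\<phi> m)" if "prime p" "p > m" for p by (rule insert.prems(3)[OF m that])
  qed (rule zero)
  have "\<phi> b \<xi> = 0" for \<xi> using sum0[of \<xi>] unfolding zero by simp
  hence "\<phi> b = (\<lambda>\<xi>. 0)" by (rule ext)
  with IH show ?case by blast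
qed simp

section \<open>The wavelets as eigenfunctions\<close>

text \<open>The default d beyond m is 1 for scalings and 0 for frequencies and centres.\<close>

definition adele_upto :: "nat \<Rightarrow> rat \<Rightarrow> (nat \<Rightarrow> rat) \<Rightarrow> finite_adele" where
  "adele_upto m d c = adele (\<lambda>p. of_rat_padic p (if p \<le> m then c p else d))"

lemma component_adele_upto:
  assumes "d \<in> \<int>" "prime p"
  shows "component (adele_upto m d c) p = of_rat_padic p (if p \<le> m then c p else d)"
  unfolding adele_upto_def
proof (rule component_adele[OF _ _ assms(2)])
  have "{p. prime p \<and> of_rat_padic p (if p \<le> m then c p else d) \<notin> Zp p} \<subseteq> {..m}"
    using assms(1) rat_integral_iff_norms by (auto simp: of_rat_padic_in_Zp_iff)
  thus "finite {p. prime p \<and> of_rat_padic p (if p \<le> m then c p else d) \<notin> Zp p}"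
    by (rule finite_subset) simp
qed simp

text \<open>Ultrametric triangles are isosceles: a sum smaller than one of its terms forces both
  terms to have the same norm.\<close>

lemma padic_norm_eq_of_add_less:
  assumes "prime p" "x \<in> carrier (Qp p)" "y \<in> carrier (Qp p)"
    and "padic_norm p (x \<oplus>\<^bsub>Qp p\<^esub> y) < padic_norm p y"
  shows "padic_norm p x = padic_norm p y"
proof -
  interpret Q: cring "Qp p" using Qp_cring[OF assms(1)] .
  have "(x \<oplus>\<^bsub>Qp p\<^esub> y) \<ominus>\<^bsub>Qp p\<^esub> y = x" "(x \<oplus>\<^bsub>Qp p\<^esub> y) \<ominus>\<^bsub>Qp p\<^esub> x = y"
    using assms(2,3) by algebra+
  moreover have "x \<oplus>\<^bsub>Qp p\<^esub> y \<in> carrier (Qp p)" using assms(2,3) by simp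
  ultimately have "padic_norm p x \<le> max (padic_norm p (x \<oplus>\<^bsub>Qp p\<^esub> y)) (padic_norm p y)"
    "padic_norm p y \<le> max (padic_norm p (x \<oplus>\<^bsub>Qp p\<^esub> y)) (padic_norm p x)"
    using padic_norm_diff[OF assms(1), of "x \<oplus>\<^bsub>Qp p\<^esub> y" y] padic_norm_diff[OF assms(1), of "x \<oplus>\<^bsub>Qp p\<^esub> y" x]
      assms(2,3) by simp_all
  thus ?thesis using assms(4) by linarith
qed

text \<open>For nonnegative real bases the principal branch has no jump, so complex powers are
  multiplicative.\<close>

lemma prod_of_real_powr:
  assumes "\<And>a. a \<in> A \<Longrightarrow> f a \<ge> 0"
  shows "(\<Prod>a\<in>A. of_real (f a) powr z) = of_real (\<Prod>a\<in>A. f a) powr (z :: complex)"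
  using assms
proof (induction A rule: infinite_finite_induct)
  case (insert a A)
  thus ?case using powr_times_real_left[of "of_real (f a)" "of_real (\<Prod>x\<in>A. f x)" z] by simp
qed auto

text \<open>As 0 < k < q, the numerator is prime to q and the norm comes from the denominator
  alone.\<close>

lemma padic_norm_rat_wavelet_frequency:
  assumes "prime q" "k \<in> {1..q - 1}"
  shows "padic_norm_rat q (of_nat k / of_nat q ^ n) = real q ^ n"
proof -
  have q: "q > 0" using prime_gt_0_nat[OF assms(1)] .
  have "\<not> q dvd k" using assms(2) q by (auto dest: dvd_imp_le)
  hence "multiplicity (int q) (int k) = 0" by (simp add: not_dvd_imp_multiplicity_0 int_dvd_int_iff)
  moreover have "multiplicity (int q) (int q ^ n) = n" using assms(1) by (simp add: prime_gt_1_nat)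
  ultimately show ?thesis using padic_norm_rat_fraction[OF assms(1), of "int k" "int q ^ n"] assms(2) q
    by auto
qed

section \<open>The wavelet as a wave with scale, centre and frequency\<close>

locale wavelet = Haar +
  fixes m :: nat and k j :: "nat \<Rightarrow> nat" and a :: "nat \<Rightarrow> rat"
  assumes m: "prime m"
    and k: "\<And>q. prime q \<Longrightarrow> q \<le> m \<Longrightarrow> k q \<in> {1..q - 1}"
begin

text \<open>\<open>\<tau>\<close> is the inverse of \<open>\<sigma>\<close>. From \<sigma> x - a =
  \<sigma> (x - \<tau> a) the centre is \<tau> a, and moving the factor \<sigma> into k/q gives the
  frequency.\<close>

definition \<sigma> where "\<sigma> = adele_upto m 1 (\<lambda>q. 1 / of_nat q ^ j q)"
definition \<tau> where "\<tau> = adele_upto m 1 (\<lambda>q. of_nat q ^ j q)"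
definition shift where "shift = \<tau> * adele_upto m 0 a"
definition freq where "freq = adele_upto m 0 (\<lambda>q. of_nat (k q) / of_nat q) * \<sigma>"
definition amplitude :: complex where
  "amplitude = (\<Prod>q | prime q \<and> q \<le> m. of_real (real q powr (real (j q) / 2)))"

lemma component_upto:
  assumes "prime q"
  shows "component \<sigma> q = of_rat_padic q (if q \<le> m then 1 / of_nat q ^ j q else 1)"
    and "component \<tau> q = of_rat_padic q (if q \<le> m then of_nat q ^ j q else 1)"
    and "component freq q = of_rat_padic q (if q \<le> m then of_nat (k q) / of_nat q ^ (j q + 1) else 0)"
    and "component shift q = of_rat_padic q (if q \<le> m then of_nat q ^ j q * a q else 0)"
  using assms
  by (simp_all add: \<sigma>_def \<tau>_def freq_def shift_def component_times component_adele_upto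
      of_rat_padic_mult[symmetric] del: of_rat_padic_0 of_rat_padic_1)

lemma scale: "\<sigma> * \<tau> = 1" "\<tau> * \<sigma> = 1"
proof -
  show 1: "\<sigma> * \<tau> = 1"
    by (rule finite_adele_eqI)
      (simp add: component_times component_one component_upto of_rat_padic_mult[symmetric] prime_gt_0_nat)
  show "\<tau> * \<sigma> = 1" using 1 by (simp add: mult.commute)
qed

text \<open>The adele y is the common argument of all factors: the rescaled and shifted component at
  q \<le> m, and that of x itself beyond m. The finite product of \<Omega> factors and the infinite
  tail thus combine to the indicator of \<open>Zhat\<close> at y.\<close>

lemma wavelet_eq: "adelic_wavelet m k j a = (\<lambda>x. amplitude * adelic_wave freq shift \<sigma> x)"
proof
  fix x
  let ?P = "{q. prime q \<and> q \<le> m}" and ?b = "adele_upto m 0 a"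
    and ?\<kappa> = "adele_upto m 0 (\<lambda>q. of_nat (k q) / of_nat q)"
  define y where "y = \<sigma> * x - ?b"
  have P: "finite ?P" by simp
  have y: "\<sigma> * (x - shift) = y"
  proof -
    have "\<sigma> * (x - shift) = \<sigma> * x - (\<sigma> * \<tau>) * ?b" by (simp add: shift_def right_diff_distrib mult.assoc)
    thus ?thesis by (simp add: y_def scale)
  qed
  have y': "freq * (x - shift) = ?\<kappa> * y" by (simp add: freq_def mult.assoc y)
  have yq: "component y q = (of_rat_padic q (1 / of_nat q ^ j q) \<otimes>\<^bsub>Qp q\<^esub> component x q)
                  \<ominus>\<^bsub>Qp q\<^esub> of_rat_padic q (a q)" if "prime q" "q \<le> m" for q
    using that by (simp add: y_def component_simps component_upto component_adele_upto)
  have yx: "component y q = component x q" if q: "prime q" "q > m" for q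
  proof -
    interpret Q: cring "Qp q" using Qp_cring[OF q(1)] .
    have "X \<ominus>\<^bsub>Qp q\<^esub> \<zero>\<^bsub>Qp q\<^esub> = X" if "X \<in> carrier (Qp q)" for X using that by algebra
    thus ?thesis using q by (simp add: y_def component_simps component_upto component_adele_upto)
  qed
  have "adele_char (?\<kappa> * y) = (\<Prod>q\<in>?P. padic_char q (component (?\<kappa> * y) q))"
    unfolding prime_prod_padic_char[symmetric]
  proof (rule prime_prod_eq[OF P])
    fix q :: nat assume q: "prime q" "q \<notin> ?P"
    interpret Q: cring "Qp q" using Qp_cring[OF q(1)] .
    show "padic_char q (component (?\<kappa> * y) q) = 1"
      using q by (simp add: component_times component_adele_upto padic_char_Zp Zp_zero)
  qed simp
  also have "\<dots> = (\<Prod>q\<in>?P. padic_char q (of_rat_padic q (of_nat (k q) / of_nat q) \<otimes>\<^bsub>Qp q\<^esub> component y q))"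
    by (rule prod.cong) (auto simp: component_times component_adele_upto)
  finally have char: "adele_char (?\<kappa> * y) = \<dots>" .
  have "(\<Prod>q\<in>?P. \<Omega> (padic_norm q (component y q))) = (\<Prod>q\<in>?P. of_bool (component y q \<in> Zp q))"
    by (rule prod.cong) (auto simp: Omega_padic_norm)
  also have "\<dots> = of_bool (\<forall>q\<in>?P. component y q \<in> Zp q)" using P by (auto simp: prod_zero_iff)
  finally have "(\<Prod>q\<in>?P. \<Omega> (padic_norm q (component y q))) *
      prime_prod (\<lambda>q. if q > m then \<Omega> (padic_norm q (component x q)) else 1)
    = of_bool ((\<forall>q\<in>?P. component y q \<in> Zp q) \<and> (\<forall>q. prime q \<and> q > m \<longrightarrow> component x q \<in> Zp q))"
    by (simp only: prime_prod_Omega of_bool_conj)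
  also have "(\<forall>q\<in>?P. component y q \<in> Zp q) \<and> (\<forall>q. prime q \<and> q > m \<longrightarrow> component x q \<in> Zp q) \<longleftrightarrow> y \<in> Zhat"
    using yx unfolding Zhat_def by (auto simp: not_le) (metis not_le)
  finally have ind: "(\<Prod>q\<in>?P. \<Omega> (padic_norm q (component y q))) *
      prime_prod (\<lambda>q. if q > m then \<Omega> (padic_norm q (component x q)) else 1) = indicator Zhat y"
    by (simp add: indicator_def)
  have "adelic_wavelet m k j a x = (\<Prod>q\<in>?P. of_real (real q powr (real (j q) / 2)) *
        padic_char q (of_rat_padic q (of_nat (k q) / of_nat q) \<otimes>\<^bsub>Qp q\<^esub> component y q) *
        \<Omega> (padic_norm q (component y q))) *
      prime_prod (\<lambda>q. if q > m then \<Omega> (padic_norm q (component x q)) else 1)"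
    unfolding adelic_wavelet_def Let_def
    by (intro arg_cong2[where f = "(*)"] prod.cong refl) (auto simp: yq)
  also have "\<dots> = amplitude * adele_char (?\<kappa> * y) * indicator Zhat y"
    unfolding char ind[symmetric] amplitude_def by (simp only: prod.distrib mult.assoc)
  also have "\<dots> = amplitude * adelic_wave freq shift \<sigma> x"
    by (simp add: adelic_wave_def y y')
  finally show "adelic_wavelet m k j a x = amplitude * adelic_wave freq shift \<sigma> x" .
qed

lemma amplitude_nonzero: "amplitude \<noteq> 0"
  unfolding amplitude_def by (subst prod_zero_iff) (auto simp: prime_gt_0_nat)

text \<open>At the centre \<open>shift\<close> the character and the indicator are 1, so the value
  there is the amplitude.\<close>

lemma wavelet_nonzero: "adelic_wavelet m k j a \<noteq> (\<lambda>x. 0)"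
proof
  assume "adelic_wavelet m k j a = (\<lambda>x. 0)"
  from fun_cong[OF this, of shift] show False
    using amplitude_nonzero by (simp add: wavelet_eq adelic_wave_def Zhat_closed(1))
qed

lemma wave_product_function: "adelic_wave freq shift \<sigma> \<in> product_functions m"
  by (rule adelic_wave_product_function[OF scale(1)]) (simp_all add: component_upto)

lemma dual_wave_product_function: "adelic_wave (- shift) freq \<tau> \<in> product_functions m"
proof (rule adelic_wave_product_function[OF scale(2)])
  fix p assume p: "prime p" "p > m"
  interpret Q: cring "Qp p" using Qp_cring[OF p(1)] .
  show "component (- shift) p = \<zero>\<^bsub>Qp p\<^esub>" using p by (simp add: component_uminus component_upto)
qed (simp_all add: component_upto)

lemma scaled_wavelet_Schwartz_Bruhat: "(\<lambda>x. c * adelic_wavelet m k j a x) \<in> Schwartz_Bruhat"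
proof -
  have "(\<lambda>x. (c * amplitude) * adelic_wave freq shift \<sigma> x) \<in> Schwartz_Bruhat"
    unfolding Schwartz_Bruhat_def using wave_product_function by (intro complex_span_scale) blast
  thus ?thesis by (simp add: wavelet_eq mult.assoc)
qed

lemma norm_freq: "prime q \<Longrightarrow> q \<le> m \<Longrightarrow> padic_norm q (component freq q) = real q ^ (j q + 1)"
  using padic_norm_rat_wavelet_frequency[of q "k q" "j q + 1"] k by (simp add: component_upto)

text \<open>On the spectrum \<xi> + \<open>freq\<close> has norm at most \<open>q ^ j q\<close>,
  strictly less than the norm \<open>q ^ (j q + 1)\<close> of \<open>freq\<close>; so \<xi> and
  \<open>freq\<close> have equal norms.\<close>

lemma norm_on_spectrum:
  assumes "\<tau> * (\<xi> + freq) \<in> Zhat" "prime q" "q \<le> m"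
  shows "padic_norm q (component \<xi> q) = real q ^ (j q + 1)"
proof -
  have q: "real q > 1" using prime_gt_1_nat[OF assms(2)] by simp
  interpret Q: cring "Qp q" using Qp_cring[OF assms(2)] .
  have "padic_norm q (component (\<tau> * (\<xi> + freq)) q) \<le> 1" using assms by (simp add: Zhat_def Zp_def)
  hence "1 / real q ^ j q * padic_norm q (component (\<xi> + freq) q) \<le> 1"
    using assms(2,3) by (simp add: component_times padic_norm_mult component_upto padic_norm_rat_prime_power)
  hence "padic_norm q (component (\<xi> + freq) q) \<le> real q ^ j q" using q by (simp add: field_simps)
  also have "\<dots> < real q ^ (j q + 1)" using q by (intro power_strict_increasing) auto
  finally have "padic_norm q (component \<xi> q) = padic_norm q (component freq q)"
    using assms(2,3) norm_freq by (intro padic_norm_eq_of_add_less) (simp_all add: component_plus)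
  thus ?thesis using norm_freq assms by simp
qed

text \<open>A preimage of the wavelet under \<open>fourier\<close>: in \<open>fourier_wave\<close>
  centre and frequency change places up to sign, and the divisor cancels the lattice measure and the
  phase produced there.\<close>

definition dual :: "finite_adele \<Rightarrow> complex" where
  "dual \<xi> = amplitude / (of_real (measure \<mu> (adele_lattice \<tau>)) * adele_char (shift * freq)) *
     adelic_wave (- shift) freq \<tau> \<xi>"

lemma fourier_dual: "fourier \<mu> dual = adelic_wavelet m k j a"
proof -
  have "measure \<mu> (adele_lattice \<tau>) > 0" by (rule measure_lattice_pos[OF scale(2)])
  thus ?thesis unfolding dual_def[abs_def] fourier_scale fourier_wave[OF scale(2)] wavelet_eq by simp
qed

text \<open>If \<xi> has component 0 at r \<le> m, then \<tau> (\<xi> - \<open>freq\<close>) has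
  norm exactly r > 1 there, so the indicator in \<open>dual\<close> vanishes.\<close>

lemma dual_\<Psi>_space: "dual \<in> \<Psi>_space m"
proof -
  have "dual \<in> complex_span (product_functions m)"
    unfolding dual_def[abs_def] by (rule complex_span_scale[OF dual_wave_product_function])
  moreover have "dual \<xi> = 0" if r: "prime r" "r \<le> m" "component \<xi> r = \<zero>\<^bsub>Qp r\<^esub>" for \<xi> r
  proof -
    interpret Q: cring "Qp r" using Qp_cring[OF r(1)] .
    have r1: "real r > 1" using prime_gt_1_nat[OF r(1)] by simp
    have "\<zero>\<^bsub>Qp r\<^esub> \<ominus>\<^bsub>Qp r\<^esub> component freq r = \<ominus>\<^bsub>Qp r\<^esub> component freq r" using r(1) by (simp add: a_minus_def)
    hence "padic_norm r (component (\<tau> * (\<xi> - freq)) r) = 1 / real r ^ j r * real r ^ (j r + 1)"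
      using r norm_freq[OF r(1,2)] by (simp add: component_times component_minus padic_norm_mult padic_norm_uminus
          component_upto(2) padic_norm_rat_prime_power)
    also have "\<dots> = real r" using r1 by simp
    finally have "\<tau> * (\<xi> - freq) \<notin> Zhat" using r r1 by (auto simp: Zhat_def Zp_def)
    thus ?thesis by (simp add: dual_def adelic_wave_def)
  qed
  ultimately show ?thesis by (auto simp: \<Psi>_space_def)
qed

lemma wavelet_\<Phi>_space: "adelic_wavelet m k j a \<in> \<Phi>_space \<mu> m"
  unfolding \<Phi>_space_def using fourier_dual dual_\<Psi>_space by (metis image_eqI)

definition eigenvalue :: "complex \<Rightarrow> complex" where
  "eigenvalue \<gamma> = of_real (\<Prod>q | prime q \<and> q \<le> m. real (q ^ (j q + 1))) powr \<gamma>"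

text \<open>The Fourier transform of the wavelet lives where all \<open>|\<xi>\<^sub>q|\<close>, \<open>q \<le> m\<close>, are the constants
  \<open>q ^ (j q + 1)\<close>.\<close>

lemma symbol_fourier:
  "symbol m \<gamma> \<xi> * fourier \<mu> (adelic_wavelet m k j a) \<xi> = eigenvalue \<gamma> * fourier \<mu> (adelic_wavelet m k j a) \<xi>"
proof (cases "\<tau> * (\<xi> + freq) \<in> Zhat")
  case False
  hence "fourier \<mu> (adelic_wavelet m k j a) \<xi> = 0"
    unfolding wavelet_eq fourier_scale fourier_wave[OF scale(1)] by (simp add: adelic_wave_def)
  thus ?thesis by simp
next
  case True
  have "(\<Prod>q | prime q \<and> q \<le> m. complex_of_real (padic_norm q (component \<xi> q)) powr \<gamma>)
      = (\<Prod>q | prime q \<and> q \<le> m. of_real (real (q ^ (j q + 1))) powr \<gamma>)"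
    by (rule prod.cong) (auto simp: norm_on_spectrum[OF True] simp del: power_Suc)
  also have "\<dots> = eigenvalue \<gamma>" unfolding eigenvalue_def by (rule prod_of_real_powr) simp
  finally have "(\<Prod>q | prime q \<and> q \<le> m. complex_of_real (padic_norm q (component \<xi> q)) powr \<gamma>) = eigenvalue \<gamma>" .
  moreover have "component \<xi> q \<in> Zp q" if q: "prime q" "q > m" for q
  proof -
    interpret Q: cring "Qp q" using Qp_cring[OF q(1)] .
    have "component (\<tau> * (\<xi> + freq)) q \<in> Zp q" using True q by (simp add: Zhat_def)
    thus ?thesis using q by (simp add: component_simps component_upto)
  qed
  ultimately have "symbol m \<gamma> \<xi> = eigenvalue \<gamma>"
    unfolding symbol_def prime_prod_Omega by simp
  thus ?thesis by simp
qed

lemma D0_on_wavelet: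
  "D0_on \<mu> m \<gamma> (adelic_wavelet m k j a) = (\<lambda>x. eigenvalue \<gamma> * adelic_wavelet m k j a x)"
  unfolding D0_on_def symbol_fourier fourier_scale[symmetric]
  by (rule fourier_inv_fourier[OF scaled_wavelet_Schwartz_Bruhat])

text \<open>Takes care of the trivial summands of a decomposition. The zero function is seen to be
  Schwartz-Bruhat as the zero multiple of the wavelet.\<close>

lemma D0_on_0: "D0_on \<mu> n \<gamma> (\<lambda>x. 0) = (\<lambda>x. 0)"
proof -
  have "(\<lambda>x. 0 * adelic_wavelet m k j a x) \<in> Schwartz_Bruhat" by (rule scaled_wavelet_Schwartz_Bruhat)
  hence "fourier_inv \<mu> (fourier \<mu> (\<lambda>x. 0)) = (\<lambda>x. 0)" by (intro fourier_inv_fourier) simp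
  thus ?thesis by (simp add: D0_on_def)
qed

text \<open>This is what the definite description in \<open>D0\<close> requires. Injectivity of
  \<open>fourier\<close> turns a decomposition of the wavelet into one of \<open>dual\<close> over
  the spaces \<open>\<Psi>_space\<close>, whose sum is direct.\<close>

lemma wavelet_decomposition_unique:
  assumes "finite M" "\<And>n. n \<in> M \<Longrightarrow> prime n \<and> Z n \<in> \<Phi>_space \<mu> n"
    and "adelic_wavelet m k j a = (\<lambda>x. \<Sum>n\<in>M. Z n x)"
  shows "m \<in> M" and "\<And>n. n \<in> M \<Longrightarrow> Z n = (if n = m then adelic_wavelet m k j a else (\<lambda>x. 0))"
proof -
  have "\<exists>f. f \<in> \<Psi>_space n \<and> Z n = fourier \<mu> f" if "n \<in> M" for n
    using assms(2)[OF that] by (auto simp: \<Phi>_space_def)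
  then obtain f where f: "\<And>n. n \<in> M \<Longrightarrow> f n \<in> \<Psi>_space n" "\<And>n. n \<in> M \<Longrightarrow> Z n = fourier \<mu> (f n)" by metis
  have fs: "\<exists>N. adelic_step N (f n)" if "n \<in> M" for n using \<Psi>_space_adelic_step[OF f(1)[OF that]] .
  have "fourier \<mu> (\<lambda>x. \<Sum>n\<in>M. 1 * f n x) = (\<lambda>x. \<Sum>n\<in>M. 1 * fourier \<mu> (f n) x)"
    by (rule fourier_sum[OF assms(1) fs])
  also have "\<dots> = fourier \<mu> dual" unfolding fourier_dual assms(3) using f(2) by simp
  finally have F: "fourier \<mu> (\<lambda>x. \<Sum>n\<in>M. 1 * f n x) = fourier \<mu> dual" .
  obtain N where N: "adelic_step N (\<lambda>x. \<Sum>n\<in>M. 1 * f n x)"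
    using adelic_step_sum[of M f "\<lambda>_. 1", OF assms(1) fs] by blast
  obtain K where K: "adelic_step K dual" using \<Psi>_space_adelic_step[OF dual_\<Psi>_space] by blast
  have sum: "(\<Sum>n\<in>M. f n x) = dual x" for x using fun_cong[OF fourier_inj[OF N K F], of x] by simp
  \<comment> \<open>Subtracting \<open>dual\<close> at index m makes the whole sum vanish. The
    family is extended by 0 to \<open>insert m M\<close>, since m is not yet known to lie in
    M.\<close>
  define g where "g n = (if n \<in> M then f n else (\<lambda>x. 0))" for n
  define \<phi> where "\<phi> n = (if n = m then (\<lambda>x. g n x - dual x) else g n)" for n
  have g\<Psi>: "g n \<xi> = 0" if "prime n" "component \<xi> n = \<zero>\<^bsub>Qp n\<^esub>" for n \<xi>
    using that f(1)[of n] by (auto simp: g_def \<Psi>_space_def)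
  have gu: "unramified p (g n)" if "prime p" "p > n" for n p
  proof (cases "n \<in> M")
    case True
    thus ?thesis using \<Psi>_space_unramified[OF f(1)[OF True] that] by (simp add: g_def)
  next
    case False
    thus ?thesis by (simp add: g_def unramified_def)
  qed
  have "\<forall>n\<in>insert m M. \<phi> n = (\<lambda>\<xi>. 0)"
  proof (rule direct_sum)
    show "finite (insert m M)" using assms(1) by simp
    show pr: "prime n" if "n \<in> insert m M" for n using that assms(2) m by blast
    show "\<phi> n \<xi> = 0" if n: "n \<in> insert m M" "component \<xi> n = \<zero>\<^bsub>Qp n\<^esub>" for n \<xi>
    proof -
      have "dual \<xi> = 0" if "n = m" using dual_\<Psi>_space n(2) m unfolding \<Psi>_space_def that by blast
      thus ?thesis using g\<Psi>[OF pr[OF n(1)] n(2)] by (cases "n = m") (simp_all add: \<phi>_def)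
    qed
    show "unramified p (\<phi> n)" if "n \<in> insert m M" "prime p" "p > n" for n p
      using unramified_diff[OF gu \<Psi>_space_unramified[OF dual_\<Psi>_space]] gu[OF that(2,3)] that
      by (auto simp: \<phi>_def)
    show "(\<Sum>n\<in>insert m M. \<phi> n \<xi>) = 0" for \<xi>
    proof -
      have "(\<Sum>n\<in>insert m M. \<phi> n \<xi>) = (\<Sum>n\<in>insert m M. g n \<xi> - (if n = m then dual \<xi> else 0))"
        by (rule sum.cong) (auto simp: \<phi>_def)
      also have "\<dots> = (\<Sum>n\<in>insert m M. g n \<xi>) - dual \<xi>"
        using assms(1) by (simp add: sum_subtractf)
      also have "(\<Sum>n\<in>insert m M. g n \<xi>) = (\<Sum>n\<in>M. f n \<xi>)"
        by (rule sum.mono_neutral_cong_right) (use assms(1) in \<open>auto simp: g_def\<close>)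
      finally show ?thesis using sum by simp
    qed
  qed
  hence \<phi>0: "\<phi> n = (\<lambda>\<xi>. 0)" if "n \<in> insert m M" for n using that by blast
  have gm: "g m = dual" using fun_cong[OF \<phi>0[of m]] by (auto simp: \<phi>_def)
  \<comment> \<open>Were m outside M, \<open>g m\<close> and hence \<open>dual\<close> would be 0,
    contradicting that its transform, the wavelet, is not.\<close>
  have "dual \<noteq> (\<lambda>x. 0)" using fourier_dual wavelet_nonzero fourier_0 by metis
  thus mM: "m \<in> M" using gm by (cases "m \<in> M") (simp_all add: g_def)
  show "Z n = (if n = m then adelic_wavelet m k j a else (\<lambda>x. 0))" if n: "n \<in> M" for n
  proof (cases "n = m")
    case True
    hence "f n = dual" using gm mM by (simp add: g_def)
    thus ?thesis using True f(2)[OF n] fourier_dual by simp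
  next
    case False
    hence "f n = (\<lambda>x. 0)" using \<phi>0[of n] n by (simp add: \<phi>_def g_def)
    thus ?thesis using False f(2)[OF n] by simp
  qed
qed

text \<open>The one-term decomposition at m gives the eigenvalue; in any other one the remaining
  summands are zero functions, which contribute nothing.\<close>

lemma D0_wavelet: "D0 \<mu> \<gamma> (adelic_wavelet m k j a) = (\<lambda>x. eigenvalue \<gamma> * adelic_wavelet m k j a x)"
  unfolding D0_def
proof (rule the_equality)
  let ?W = "adelic_wavelet m k j a"
  show "\<exists>M Z. finite M \<and> (\<forall>n\<in>M. prime n \<and> Z n \<in> \<Phi>_space \<mu> n) \<and>
      ?W = (\<lambda>x. \<Sum>n\<in>M. Z n x) \<and>
      (\<lambda>x. eigenvalue \<gamma> * ?W x) = (\<lambda>x. \<Sum>n\<in>M. D0_on \<mu> n \<gamma> (Z n) x)"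
    using m wavelet_\<Phi>_space by (intro exI[of _ "{m}"] exI[of _ "\<lambda>_. ?W"]) (simp add: D0_on_wavelet)
next
  let ?W = "adelic_wavelet m k j a"
  fix \<eta>
  assume "\<exists>M Z. finite M \<and> (\<forall>n\<in>M. prime n \<and> Z n \<in> \<Phi>_space \<mu> n) \<and>
      ?W = (\<lambda>x. \<Sum>n\<in>M. Z n x) \<and> \<eta> = (\<lambda>x. \<Sum>n\<in>M. D0_on \<mu> n \<gamma> (Z n) x)"
  then obtain M Z where M: "finite M" "\<And>n. n \<in> M \<Longrightarrow> prime n \<and> Z n \<in> \<Phi>_space \<mu> n"
      "?W = (\<lambda>x. \<Sum>n\<in>M. Z n x)" and \<eta>: "\<eta> = (\<lambda>x. \<Sum>n\<in>M. D0_on \<mu> n \<gamma> (Z n) x)" by blast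
  have mM: "m \<in> M" by (rule wavelet_decomposition_unique(1)[OF M(1) M(2) M(3)])
  have Z: "Z n = (if n = m then ?W else (\<lambda>x. 0))" if "n \<in> M" for n
    by (rule wavelet_decomposition_unique(2)[OF M(1) M(2) M(3) that])
  have "(\<Sum>n\<in>M. D0_on \<mu> n \<gamma> (Z n) x) = (\<Sum>n\<in>M. if n = m then eigenvalue \<gamma> * ?W x else 0)" for x
  proof (rule sum.cong[OF refl])
    fix n assume "n \<in> M"
    from Z[OF this] show "D0_on \<mu> n \<gamma> (Z n) x = (if n = m then eigenvalue \<gamma> * ?W x else 0)"
      by (simp add: D0_on_wavelet D0_on_0)
  qed
  thus "\<eta> = (\<lambda>x. eigenvalue \<gamma> * ?W x)" using mM M(1) by (simp add: \<eta>)
qed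

lemma wavelet_\<Phi>_total: "adelic_wavelet m k j a \<in> \<Phi>_total \<mu>"
proof -
  have "(\<lambda>x. 1 * adelic_wavelet m k j a x) \<in> \<Phi>_total \<mu>"
    unfolding \<Phi>_total_def using m wavelet_\<Phi>_space by (intro complex_span_scale) blast
  thus ?thesis by simp
qed

end

theorem corollary9p2:
  fixes \<mu> :: "finite_adele measure" and \<gamma> :: complex and m :: nat
    and k j :: "nat \<Rightarrow> nat" and a :: "nat \<Rightarrow> rat"
  assumes "normalized_Haar \<mu>"
    and "prime m"
    and "\<And>q. prime q \<Longrightarrow> q \<le> m \<Longrightarrow> k q \<in> {1..q - 1}"
    and "\<And>q. prime q \<Longrightarrow> q \<le> m \<Longrightarrow> a q \<in> I_set q"
  shows "adelic_wavelet m k j a \<in> \<Phi>_total \<mu> \<and>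
    adelic_wavelet m k j a \<noteq> (\<lambda>x. 0) \<and>
    D0 \<mu> \<gamma> (adelic_wavelet m k j a) =
      (\<lambda>x. of_real (\<Prod>q | prime q \<and> q \<le> m. real (q ^ (j q + 1))) powr \<gamma> * adelic_wavelet m k j a x)"
proof -
  interpret wavelet \<mu> m k j a
    by unfold_locales (rule assms(1-3); assumption?)+
  show ?thesis
    using wavelet_\<Phi>_total wavelet_nonzero D0_wavelet[of \<gamma>] by (simp add: eigenvalue_def)
qed

end
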